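(* Let $G$ be a subgroup of finite index of $\mathrm{SL}_2(\mathbb{Z})$, let $D\in\mathbb{Z}_{\ge1}$, $k\in\frac1D\mathbb{Z}$, and let $\chi$ be a multiplier system for $G$ of weight $k$ of cover index $D$ (not assumed to be of finite order). Let $f$ be a nonzero meromorphic modular form of weight $k$ for $G$ with character $\chi$, and let $m=[\overline{\mathrm{SL}_2(\mathbb{Z})}:\overline{G}]$. Then $$\deg(\operatorname{div} f)=\frac{1}{12}mk.$$
   Context: Notation: $e(x)=\exp(2\pi i x)$, $q=e(\tau)$ for $\tau$ in the upper half plane $\mathbb{H}$; for $z\in\mathbb{C}^\times$, $r\in\mathbb{Q}$, $z^r=\exp(r\log z)$ with $-\pi<\operatorname{Im}\log z\le\pi$. The $D$-cover $\widetilde{\mathrm{GL}_2^+(\mathbb{R})}^D$ is the group of pairs $(M,\phi)$ with $M\in\mathrm{GL}_2^+(\mathbb{R})$ and $\phi(\tau)=\varepsilon(c'\tau+d')^{1/D}$, where $\varepsilon^D=1$ and $\begin{pmatrix}a'&b'\\c'&d'\end{pmatrix}=(\det M)^{-1/2}M$; the product is $(M_1,\phi_1)(M_2,\phi_2)=(M_1M_2,\phi_1(M_2\tau)\phi_2(\tau))$. For a subgroup $G$, $\widetilde G^D$ denotes its preimage; for $\gamma=\begin{pmatrix}a&b\\c&d\end{pmatrix}\in\mathrm{SL}_2(\mathbb{R})$, $\widetilde\gamma=(\gamma,(c\tau+d)^{1/D})$. For $k\in\frac1D\mathbb{Z}$ and $f$ meromorphic on $\mathbb{H}$, $(f|_k(M,\phi))(\tau)=\phi(\tau)^{-Dk}f(M\tau)$.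 A multiplier system for $G$ of weight $k$ of cover index $D$ is a unitary character $\chi:\widetilde G^D\to\mathbb{C}^\times$ with $\chi(I,e(1/D))=e(-k)$ and, if $-I\in G$, $\chi(\widetilde{-I})=e(-k/2)$. A meromorphic modular form of weight $k$ for $G$ with character $\chi$ is a meromorphic $f$ on $\mathbb{H}$ with $f|_k\gamma=\chi(\gamma)f$ for all $\gamma\in\widetilde G^D$ such that for every $\gamma\in\mathrm{SL}_2(\mathbb{Z})$, $f|_k\widetilde\gamma$ has no poles for $\operatorname{Im}\tau$ large and there equals a series $\sum_n c_nq^n$ over exponents $n$ in a set of the form $\kappa+\frac1h\mathbb{Z}$, with only finitely many $n<0$ having $c_n\ne0$; $\operatorname{ord}_{i\infty}(f|_k\widetilde\gamma)$ is the least $n$ with $c_n\neq0$. For $g\in \mathrm{SL}_2(\mathbb{Z})$-subgroups, $\overline{H}$ denotes the image in $\mathrm{PSL}_2(\mathbb{Z})$ and $\overline{H}_x$ the stabilizer of $x$. Divisor: $\operatorname{div} f$ is the $\mathbb{Q}$-valued function on $G\backslash(\mathbb{H}\cup\mathbb{P}^1(\mathbb{Q}))$ given by $\operatorname{div}_{G\tau}(f)=n_0/|\overline{G}_\tau|$ for $\tau\in\mathbb{H}$, $n_0$ the order of $f$ at $\tau$; and for a cusp $x=\gamma(i\infty)$, $\gamma\in\mathrm{SL}_2(\mathbb{Z})$, $\operatorname{div}_{Gx}(f)=\operatorname{ord}_{i\infty}(f|_k\widetilde\gamma)\cdot w_x$, with width $w_x=[\overline{\mathrm{SL}_2(\mathbb{Z})}_x:\overline{G}_x]$.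 Its degree is the (finite) sum of all its values. *)

theory Defs
  imports "HOL-Complex_Analysis.Complex_Analysis"
begin

type_synonym mat2 = "real^2^2"

definition ee :: "complex \<Rightarrow> complex" where
  "ee x = exp (2 * of_real pi * \<i> * x)"

definition UHP :: "complex set" where
  "UHP = {z. Im z > 0}"

definition mob :: "mat2 \<Rightarrow> complex \<Rightarrow> complex" where
  "mob M z = (of_real (M$1$1) * z + of_real (M$1$2)) / (of_real (M$2$1) * z + of_real (M$2$2))"

definition SL2Z :: "mat2 set" where
  "SL2Z = {M. (\<forall>i j. M$i$j \<in> \<int>) \<and> det M = 1}"

definition SL2R :: "mat2 set" where
  "SL2R = {M. det M = 1}"

definition GL2plus :: "mat2 set" where
  "GL2plus = {M. det M > 0}"

definition subgroup_SL2Z :: "mat2 set \<Rightarrow> bool" where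
  "subgroup_SL2Z G \<longleftrightarrow> G \<subseteq> SL2Z \<and> mat 1 \<in> G \<and> (\<forall>g\<in>G. \<forall>h\<in>G. g ** h \<in> G)
     \<and> (\<forall>g\<in>G. matrix_inv g \<in> G)"

definition lcosets :: "mat2 set \<Rightarrow> mat2 set \<Rightarrow> mat2 set set" where
  "lcosets A H = {(\<lambda>h. g ** h) ` H | g. g \<in> A}"

text \<open>Index of the image of H in the image of A in PSL2 (i.e. the groups modulo {+I,-I}):
  for groups A containing -I this equals the number of cosets of +-H in A.\<close>
definition pindex :: "mat2 set \<Rightarrow> mat2 set \<Rightarrow> nat" where
  "pindex A H = card (lcosets A (H \<union> uminus ` H))"

definition proj :: "mat2 \<Rightarrow> mat2 set" where
  "proj g = {g, - g}"

text \<open>An element (M, phi) of the D-cover with phi(tau) = eps (c' tau + d')^(1/D) is encoded by the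
  pair (M, eps); this encoding is bijective since (c' tau + d')^(1/D) is not identically 0.\<close>

definition cphi :: "nat \<Rightarrow> mat2 \<times> complex \<Rightarrow> complex \<Rightarrow> complex" where
  "cphi D g \<tau> = (case g of (M, \<epsilon>) \<Rightarrow>
      \<epsilon> * (of_real (M$2$1 / sqrt (det M)) * \<tau> + of_real (M$2$2 / sqrt (det M)))
          powr (1 / of_nat D))"

definition cover :: "nat \<Rightarrow> mat2 set \<Rightarrow> (mat2 \<times> complex) set" where
  "cover D S = {(M, \<epsilon>). M \<in> S \<and> M \<in> GL2plus \<and> \<epsilon> ^ D = 1}"

definition cover_mult :: "nat \<Rightarrow> mat2 \<times> complex \<Rightarrow> mat2 \<times> complex \<Rightarrow> mat2 \<times> complex" where
  "cover_mult D g1 g2 = (fst g1 ** fst g2,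
     THE \<epsilon>. \<epsilon> ^ D = 1 \<and> (\<forall>\<tau>\<in>UHP. cphi D g1 (mob (fst g2) \<tau>) * cphi D g2 \<tau>
                                 = cphi D (fst g1 ** fst g2, \<epsilon>) \<tau>))"

text \<open>The canonical lift (gamma, (c tau + d)^(1/D)) of gamma in SL2(R).\<close>
definition tilde :: "mat2 \<Rightarrow> mat2 \<times> complex" where
  "tilde \<gamma> = (\<gamma>, 1)"

definition slash :: "nat \<Rightarrow> real \<Rightarrow> (complex \<Rightarrow> complex) \<Rightarrow> mat2 \<times> complex \<Rightarrow> complex \<Rightarrow> complex" where
  "slash D k f g \<tau> = cphi D g \<tau> powr (- of_real (real D * k)) * f (mob (fst g) \<tau>)"

definition multiplier_system ::
    "nat \<Rightarrow> real \<Rightarrow> mat2 set \<Rightarrow> (mat2 \<times> complex \<Rightarrow> complex) \<Rightarrow> bool" where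
  "multiplier_system D k G chi \<longleftrightarrow>
     (\<forall>g\<in>cover D G. norm (chi g) = 1) \<and>
     (\<forall>g\<in>cover D G. \<forall>h\<in>cover D G. chi (cover_mult D g h) = chi g * chi h) \<and>
     chi (mat 1, ee (1 / of_nat D)) = ee (- of_real k) \<and>
     (- mat 1 \<in> G \<longrightarrow> chi (tilde (- mat 1)) = ee (- of_real k / 2))"

definition qexp_rep :: "(complex \<Rightarrow> complex) \<Rightarrow> real \<Rightarrow> nat \<Rightarrow> (int \<Rightarrow> complex) \<Rightarrow> bool" where
  "qexp_rep g \<kappa> h c \<longleftrightarrow> h > 0 \<and>
     (\<exists>y0. \<forall>\<tau>. Im \<tau> > y0 \<longrightarrow> \<not> is_pole g \<tau> \<and>
        ((\<lambda>j. c j * ee (of_real (\<kappa> + real_of_int j / real h) * \<tau>)) has_sum g \<tau>) UNIV) \<and>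
     finite {j. \<kappa> + real_of_int j / real h < 0 \<and> c j \<noteq> 0}"

definition has_qexp :: "(complex \<Rightarrow> complex) \<Rightarrow> bool" where
  "has_qexp g \<longleftrightarrow> (\<exists>\<kappa> h c. qexp_rep g \<kappa> h c)"

definition ord_inf :: "(complex \<Rightarrow> complex) \<Rightarrow> real" where
  "ord_inf g = (case (SOME (\<kappa>, h, c). qexp_rep g \<kappa> h c) of (\<kappa>, h, c) \<Rightarrow>
      Inf {\<kappa> + real_of_int j / real h | j. c j \<noteq> 0})"

definition mero_modular_form ::
    "nat \<Rightarrow> real \<Rightarrow> mat2 set \<Rightarrow> (mat2 \<times> complex \<Rightarrow> complex) \<Rightarrow> (complex \<Rightarrow> complex) \<Rightarrow> bool" where
  "mero_modular_form D k G chi f \<longleftrightarrow>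
     f meromorphic_on UHP \<and>
     (\<forall>g\<in>cover D G. \<forall>\<tau>\<in>UHP. \<forall>\<^sub>F w in at \<tau>. slash D k f g w = chi g * f w) \<and>
     (\<forall>\<gamma>\<in>SL2Z. has_qexp (slash D k f (tilde \<gamma>)))"

text \<open>f is not the zero meromorphic function (values at isolated points are irrelevant).\<close>
definition nonzero_mero :: "(complex \<Rightarrow> complex) \<Rightarrow> bool" where
  "nonzero_mero f \<longleftrightarrow> (\<exists>z\<in>UHP. \<not> (\<forall>\<^sub>F w in at z. f w = 0))"

text \<open>Points of H \<union> P^1(Q) (as a subset of the Riemann sphere).\<close>
datatype pt = Fin complex | Infty

definition mob_pt :: "mat2 \<Rightarrow> pt \<Rightarrow> pt" where
  "mob_pt M p = (case p of
       Fin z \<Rightarrow> (if of_real (M$2$1) * z + of_real (M$2$2) = 0 then Infty else Fin (mob M z))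
     | Infty \<Rightarrow> (if M$2$1 = 0 then Infty else Fin (of_real (M$1$1 / M$2$1))))"

definition Hbar :: "pt set" where
  "Hbar = {Fin \<tau> | \<tau>. \<tau> \<in> UHP} \<union> {Fin (of_real (of_rat q)) | q. True} \<union> {Infty}"

definition orbit :: "mat2 set \<Rightarrow> pt \<Rightarrow> pt set" where
  "orbit G p = {mob_pt g p | g. g \<in> G}"

definition orbits :: "mat2 set \<Rightarrow> pt set set" where
  "orbits G = {orbit G p | p. p \<in> Hbar}"

definition stab :: "mat2 set \<Rightarrow> pt \<Rightarrow> mat2 set" where
  "stab A p = {g \<in> A. mob_pt g p = p}"

definition width :: "mat2 set \<Rightarrow> pt \<Rightarrow> nat" where
  "width G x = pindex (stab SL2Z x) (stab G x)"

definition divisor ::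
    "nat \<Rightarrow> real \<Rightarrow> mat2 set \<Rightarrow> (complex \<Rightarrow> complex) \<Rightarrow> pt set \<Rightarrow> real" where
  "divisor D k G f Orb =
     (if \<exists>\<tau>\<in>UHP. Fin \<tau> \<in> Orb then
        (let \<tau> = SOME \<tau>. \<tau> \<in> UHP \<and> Fin \<tau> \<in> Orb
         in real_of_int (zorder f \<tau>) / real (card (proj ` stab G (Fin \<tau>))))
      else
        (let x = SOME x. x \<in> Orb;
             \<gamma> = SOME \<gamma>. \<gamma> \<in> SL2Z \<and> mob_pt \<gamma> Infty = x
         in ord_inf (slash D k f (tilde \<gamma>)) * real (width G x)))"

definition div_support ::
    "nat \<Rightarrow> real \<Rightarrow> mat2 set \<Rightarrow> (complex \<Rightarrow> complex) \<Rightarrow> pt set set" where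
  "div_support D k G f = {Orb \<in> orbits G. divisor D k G f Orb \<noteq> 0}"

definition div_degree :: "nat \<Rightarrow> real \<Rightarrow> mat2 set \<Rightarrow> (complex \<Rightarrow> complex) \<Rightarrow> real" where
  "div_degree D k G f = (\<Sum>Orb \<in> div_support D k G f. divisor D k G f Orb)"

end

theory Submission
  imports Defs
begin

text \<open>
  The product \<open>J\<close> of the translates of \<open>f ^ (4 * D) / G4 powi (D * k)\<close> over coset representatives of \<open>\<plusminus>G\<close> in
  \<open>SL2Z\<close> is invariant under \<open>SL2Z\<close> up to sixth roots of unity, whatever the order of the character.
  It therefore suffices that an invariant meromorphic function has degree 0, and that the only zero of
  the Eisenstein series \<open>G4\<close>, a simple one, is the orbit of the third root of unity, so that \<open>G4\<close> has degree 1/3.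

  For an invariant function \<open>J\<close> the weighted numbers of zeros of \<open>J + c\<close> for \<open>c \<ge> 0\<close>, the limit \<open>c \<rightarrow> \<infinity>\<close>
  being the number of poles of \<open>J\<close>, all agree: counted in the \<open>q\<close>-disc with a continuous compactly
  supported weight which distributes the multiplicity of an orbit over its points, they vary
  continuously, while by invariance they lie in \<open>(1/N) \<int>\<close> for a fixed \<open>N\<close>. This replaces the usual contour integral around
  a fundamental domain.
\<close>

no_notation fps_nth (infixl \<open>$\<close> 75)

section \<open>Weighted zero counts in holomorphic families\<close>

text \<open>The character may have infinite order on \<open>G\<close>, so in general no power of
  \<open>f\<close> is \<open>G\<close>-invariant. The product over cosets moves the obstruction to
  the full group: the scalars by which \<open>SL2Z\<close> changes it depend only on the image in
  the abelianisation of PSL2(Z), a group of order 6, and the sixth power removes them. The exponents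
  are matched by the integer \<open>b = D * k\<close>: each factor has weight 4 D k - 4 b = 0. With
  m cosets, degree zero reads 24 D deg f = 6 m b / 3, which is the formula. In the homotopy a
  sharply cut off region would fail, because the count jumps when a zero of J + c crosses its
  boundary. Under a weight that falls to 0 at height 1/2 such a zero fades out, and its translates,
  which move simultaneously by invariance, take up exactly what it loses.\<close>

lemma finite_zeros_compact:
  fixes f :: "complex \<Rightarrow> complex"
  assumes "f holomorphic_on S" "open S" "connected S" "compact K" "K \<subseteq> S" "\<exists>z\<in>S. f z \<noteq> 0"
  shows "finite {z\<in>K. f z = 0}"
proof (cases "f constant_on S")
  case True
  with assms have "{z\<in>K. f z = 0} = {}"
    unfolding constant_on_def by fastforce
  then show ?thesis by (metis finite.emptyI)
next
  case False
  with holomorphic_compact_finite_zeros[OF assms(1-5)] show ?thesis by blast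
qed

lemma holomorphic_eventually_nonzero:
  assumes "f holomorphic_on S" "open S" "connected S" "\<exists>z\<in>S. f z \<noteq> 0" "p \<in> S"
  shows "eventually (\<lambda>w. f w \<noteq> 0) (at p)"
proof -
  obtain z0 where "z0 \<in> S" "f z0 \<noteq> 0" using assms by auto
  from non_zero_neighbour_alt[OF assms(1-3,5) this] show ?thesis
    by (auto elim: eventually_mono)
qed

text \<open>Rouche on the circle of radius \<open>r\<close>, inside the ball of radius
  \<open>2 * r\<close>, which supplies an open connected domain containing the circle. Zeros in that
  ball are weighted by winding numbers, 1 inside and 0 outside the closed disc, so only those inside
  survive; on the circle itself the inequality excludes zeros of both functions.\<close>

lemma Rouche_circle_single_zero:
  fixes f g :: "complex \<Rightarrow> complex"
  assumes holo: "f holomorphic_on ball p (2*r)" "g holomorphic_on ball p (2*r)" and r: "r > 0"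
    and less: "\<And>z. z \<in> sphere p r \<Longrightarrow> norm (g z - f z) < norm (f z)"
    and f0: "\<And>z. z \<in> cball p r \<Longrightarrow> f z = 0 \<longleftrightarrow> z = p"
    and fin: "finite {z\<in>ball p (2*r). f z = 0}" "finite {z\<in>ball p (2*r). g z = 0}"
  shows "(\<Sum>z\<in>{z\<in>ball p r. g z = 0}. zorder g z) = zorder f p"
proof -
  let ?S = "ball p (2*r)" and ?\<gamma> = "circlepath p r"
  have w1: "winding_number ?\<gamma> z = 1" if "z \<in> ball p r" for z
    using that by (intro winding_number_circlepath) (auto simp: dist_norm norm_minus_commute)
  have w0: "winding_number ?\<gamma> z = 0" if "z \<notin> cball p r" for z
    using r that by (intro winding_number_zero_outside[of _ "cball p r"]) (auto simp: sphere_cball)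
  have nz: "g z \<noteq> 0" "f z \<noteq> 0" if "z \<in> sphere p r" for z
    using less[OF that] by auto
  have red: "(\<Sum>z\<in>{z\<in>?S. h z = 0}. winding_number ?\<gamma> z * zorder h z)
      = (\<Sum>z\<in>{z\<in>ball p r. h z = 0}. of_int (zorder h z))"
    if "finite {z\<in>?S. h z = 0}" "\<And>z. z \<in> sphere p r \<Longrightarrow> h z \<noteq> 0" for h :: "complex \<Rightarrow> complex"
  proof (rule sum.mono_neutral_cong_right)
    show "{z\<in>ball p r. h z = 0} \<subseteq> {z\<in>?S. h z = 0}" using r by auto
    show "\<forall>i\<in>{z\<in>?S. h z = 0} - {z\<in>ball p r. h z = 0}. winding_number ?\<gamma> i * of_int (zorder h i) = 0"
    proof
      fix i assume i: "i \<in> {z\<in>?S. h z = 0} - {z\<in>ball p r. h z = 0}"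
      then have "i \<notin> sphere p r" using that(2) by auto
      with i have "i \<notin> cball p r" by auto
      then show "winding_number ?\<gamma> i * of_int (zorder h i) = 0" using w0 by auto
    qed
  qed (use that w1 in auto)
  have "(\<Sum>z\<in>{z\<in>?S. g z = 0}. winding_number ?\<gamma> z * zorder g z)
      = (\<Sum>z\<in>{z\<in>?S. f z = 0}. winding_number ?\<gamma> z * zorder f z)"
  proof -
    have "(\<Sum>z\<in>{z\<in>?S. f z + (g z - f z) = 0}. winding_number ?\<gamma> z * zorder (\<lambda>z. f z + (g z - f z)) z)
      = (\<Sum>z\<in>{z\<in>?S. f z = 0}. winding_number ?\<gamma> z * zorder f z)"
  proof (rule Rouche_theorem[of ?S f "\<lambda>z. g z - f z" ?\<gamma>])
    show "\<forall>z\<in>path_image ?\<gamma>. norm (g z - f z) < norm (f z)"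
      using less r by auto
    show "\<forall>z. z \<notin> ?S \<longrightarrow> winding_number ?\<gamma> z = 0"
      using r by (auto intro!: w0)
  qed (use r holo fin in \<open>auto intro!: holomorphic_intros\<close>)
    then show ?thesis by simp
  qed
  then have "(\<Sum>z\<in>{z\<in>ball p r. g z = 0}. complex_of_int (zorder g z))
      = (\<Sum>z\<in>{z\<in>ball p r. f z = 0}. complex_of_int (zorder f z))"
    using red[of f] red[of g] fin nz by simp
  also have "{z\<in>ball p r. f z = 0} = {p}" using f0 r by auto
  finally have "complex_of_int (\<Sum>z\<in>{z\<in>ball p r. g z = 0}. zorder g z) = complex_of_int (zorder f p)"
    by simp
  then show ?thesis by (simp only: of_int_eq_iff)
qed

text \<open>Zeros may move, split and merge, but Rouche preserves their total multiplicity in a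
  small disc around each zero of \<open>u t0\<close>, and continuity of \<Psi> makes the weights
  within a disc nearly equal. Zeros entering or leaving \<open>K\<close> are harmless because \<Psi>
  vanishes on \<open>S\<close> outside \<open>K\<close>.\<close>

lemma continuous_on_weighted_zero_count:
  fixes A B :: "complex \<Rightarrow> complex" and \<Psi> :: "complex \<Rightarrow> real" and S K :: "complex set"
  defines "u \<equiv> (\<lambda>(t::real) z. (1 - of_real t) * A z + of_real t * B z)"
  assumes holo: "A holomorphic_on S" "B holomorphic_on S" and S: "open S" "connected S"
    and K: "compact K" "K \<subseteq> S" and cont: "continuous_on S \<Psi>"
    and supp: "\<And>z. z \<in> S \<Longrightarrow> z \<notin> K \<Longrightarrow> \<Psi> z = 0"
    and nz: "\<And>t. t \<in> {0..1} \<Longrightarrow> \<exists>z\<in>S. u t z \<noteq> 0"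
  shows "continuous_on {0..1} (\<lambda>t. \<Sum>z\<in>{z\<in>K. u t z = 0}. real_of_int (zorder (u t) z) * \<Psi> z)"
proof -
  have uholo: "u t holomorphic_on S" for t
    unfolding u_def by (intro holomorphic_intros holo)
  have fin: "finite {z\<in>K'. u t z = 0}" if "compact K'" "K' \<subseteq> S" "t \<in> {0..1}" for K' t
    using finite_zeros_compact[OF uholo S that(1,2) nz[OF that(3)]] .
  have evnz: "eventually (\<lambda>w. u t w \<noteq> 0) (at p)" if "t \<in> {0..1}" "p \<in> S" for t p
    using holomorphic_eventually_nonzero[OF uholo S nz[OF that(1)] that(2)] .
  have ana: "u t analytic_on {p}" if "p \<in> S" for t p
    using uholo S that analytic_at by blast
  have ge0: "zorder (u t) p \<ge> 0" if "t \<in> {0..1}" "p \<in> S" for t p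
    using zorder_ge_0[OF ana[OF that(2)]] evnz[OF that] eventually_frequently[OF at_neq_bot] by blast
  show ?thesis
    unfolding continuous_on_iff
  proof (intro ballI allI impI)
    fix t0 \<epsilon> :: real assume t0: "t0 \<in> {0..1}" and \<epsilon>: "\<epsilon> > 0"
    define Z where "Z = {z\<in>K. u t0 z = 0}"
    define W where "W = (\<Sum>z\<in>Z. real_of_int (zorder (u t0) z))"
    \<comment> \<open>The total error will be at most \<open>W\<close> times \<delta>; the summand 1
      covers the case \<open>W = 0\<close>.\<close>
    define \<delta> where "\<delta> = \<epsilon> / (1 + W)"
    have ZS: "Z \<subseteq> S" using K by (auto simp: Z_def)
    have finZ: "finite Z" unfolding Z_def by (rule fin[OF K t0])
    have W: "W \<ge> 0" unfolding W_def using ge0[OF t0] ZS by (intro sum_nonneg) auto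
    have \<delta>: "\<delta> > 0" using \<epsilon> W by (auto simp: \<delta>_def)
    have "eventually (\<lambda>r. cball p (2*r) \<subseteq> S \<and> (\<forall>z\<in>cball p r. u t0 z = 0 \<longleftrightarrow> z = p) \<and>
        (\<forall>z\<in>cball p r. \<bar>\<Psi> z - \<Psi> p\<bar> < \<delta>)) (at_right (0::real))" if p: "p \<in> Z" for p
    proof -
      have pS: "p \<in> S" using p ZS by auto
      obtain r1 where r1: "r1 > 0" "cball p r1 \<subseteq> S"
        using S pS open_contains_cball by blast
      obtain r2 where r2: "r2 > 0" "\<And>z. z \<noteq> p \<Longrightarrow> dist z p < r2 \<Longrightarrow> u t0 z \<noteq> 0"
        using evnz[OF t0 pS] unfolding eventually_at by auto
      obtain r3 where r3: "r3 > 0" "\<And>z. z \<in> S \<Longrightarrow> dist z p < r3 \<Longrightarrow> \<bar>\<Psi> z - \<Psi> p\<bar> < \<delta>"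
        using cont pS \<delta> unfolding continuous_on_iff dist_real_def by metis
      show ?thesis
      proof (rule eventually_at_rightI[of 0 "min (r1/2) (min r2 r3)"])
        fix r assume r: "r \<in> {0<..<min (r1/2) (min r2 r3)}"
        have sub: "cball p (2*r) \<subseteq> S" using r r1 by fastforce
        have sub': "cball p r \<subseteq> S" using sub r by fastforce
        have "u t0 z = 0 \<longleftrightarrow> z = p" if "z \<in> cball p r" for z
          using r2(2)[of z] that r p by (auto simp: dist_commute Z_def)
        moreover have "\<bar>\<Psi> z - \<Psi> p\<bar> < \<delta>" if "z \<in> cball p r" for z
          using r3(2)[of z] that r sub' by (auto simp: dist_commute)
        ultimately show "cball p (2*r) \<subseteq> S \<and> (\<forall>z\<in>cball p r. u t0 z = 0 \<longleftrightarrow> z = p) \<and>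
            (\<forall>z\<in>cball p r. \<bar>\<Psi> z - \<Psi> p\<bar> < \<delta>)" using sub by blast
      qed (use r1 r2 r3 in auto)
    qed
    then have "eventually (\<lambda>r. \<forall>p\<in>Z. cball p (2*r) \<subseteq> S \<and> (\<forall>z\<in>cball p r. u t0 z = 0 \<longleftrightarrow> z = p) \<and>
        (\<forall>z\<in>cball p r. \<bar>\<Psi> z - \<Psi> p\<bar> < \<delta>)) (at_right (0::real))"
      using finZ by (simp add: eventually_ball_finite)
    moreover have "eventually (\<lambda>r::real. r > 0) (at_right 0)"
      by (simp add: eventually_at_right_less)
    moreover have "eventually (\<lambda>r. \<forall>p\<in>Z. \<forall>q\<in>Z. p \<noteq> q \<longrightarrow> 2 * r < dist p q) (at_right (0::real))"
    proof -
      have "eventually (\<lambda>r. p \<noteq> q \<longrightarrow> 2 * r < dist p q) (at_right (0::real))" for p q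
      proof (cases "p = q")
        case False
        then show ?thesis
          by (intro eventually_at_rightI[of 0 "dist p q / 2"]) auto
      qed auto
      then show ?thesis using finZ by (intro eventually_ball_finite ballI) auto
    qed
    ultimately have "eventually (\<lambda>r. r > 0 \<and> (\<forall>p\<in>Z. cball p (2*r) \<subseteq> S \<and>
        (\<forall>z\<in>cball p r. u t0 z = 0 \<longleftrightarrow> z = p) \<and> (\<forall>z\<in>cball p r. \<bar>\<Psi> z - \<Psi> p\<bar> < \<delta>)) \<and>
        (\<forall>p\<in>Z. \<forall>q\<in>Z. p \<noteq> q \<longrightarrow> 2 * r < dist p q)) (at_right (0::real))"
      by eventually_elim auto
    then obtain r where r: "r > 0" and rS: "\<And>p. p \<in> Z \<Longrightarrow> cball p (2*r) \<subseteq> S"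
      and r0: "\<And>p z. p \<in> Z \<Longrightarrow> z \<in> cball p r \<Longrightarrow> u t0 z = 0 \<longleftrightarrow> z = p"
      and r\<Psi>: "\<And>p z. p \<in> Z \<Longrightarrow> z \<in> cball p r \<Longrightarrow> \<bar>\<Psi> z - \<Psi> p\<bar> < \<delta>"
      and rd: "\<And>p q. p \<in> Z \<Longrightarrow> q \<in> Z \<Longrightarrow> p \<noteq> q \<Longrightarrow> 2 * r < dist p q"
      using eventually_happens'[of "at_right (0::real)"] by (smt (verit) trivial_limit_at_right_real)
    have sub1: "cball p r \<subseteq> cball p (2*r)" for p using r by (intro subset_cball) auto
    \<comment> \<open>The part of \<open>K\<close> off the discs together with the bounding circles:
      one lower bound for \<open>u t0\<close> on this compact set both excludes new zeros outside
      the discs and gives the Rouche inequality on the circles.\<close>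
    define C where "C = (K - (\<Union>p\<in>Z. ball p r)) \<union> (\<Union>p\<in>Z. sphere p r)"
    have Ccomp: "compact C"
      unfolding C_def using K finZ by (intro compact_Un compact_diff compact_UN) auto
    have CS: "C \<subseteq> S"
      unfolding C_def using K rS sub1 by (force simp: sphere_cball)
    have Cnz: "u t0 z \<noteq> 0" if "z \<in> C" for z
      using that r r0 unfolding C_def Z_def by fastforce
    obtain m where m: "m > 0" "\<And>z. z \<in> C \<Longrightarrow> m \<le> norm (u t0 z)"
    proof (cases "C = {}")
      case True then show ?thesis using that[of 1] by auto
    next
      case False
      have "continuous_on C (\<lambda>z. norm (u t0 z))"
        using uholo[of t0] CS by (intro continuous_intros holomorphic_on_imp_continuous_on)
           (rule holomorphic_on_subset)
      from continuous_attains_inf[OF Ccomp False this]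
      obtain x where "x \<in> C" "\<And>y. y \<in> C \<Longrightarrow> norm (u t0 x) \<le> norm (u t0 y)" by auto
      then show ?thesis using that[of "norm (u t0 x)"] Cnz by auto
    qed
    have "continuous_on C (\<lambda>z. B z - A z)"
      using holo CS by (intro continuous_intros holomorphic_on_imp_continuous_on)
           (auto elim: holomorphic_on_subset)
    then have "bounded ((\<lambda>z. B z - A z) ` C)"
      using Ccomp compact_continuous_image compact_imp_bounded by blast
    then obtain M where M: "M > 0" "\<And>z. z \<in> C \<Longrightarrow> norm (B z - A z) \<le> M"
      by (auto simp: bounded_pos)
    show "\<exists>d>0. \<forall>t\<in>{0..1}. dist t t0 < d \<longrightarrow>
        dist (\<Sum>z\<in>{z\<in>K. u t z = 0}. real_of_int (zorder (u t) z) * \<Psi> z)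
             (\<Sum>z\<in>{z\<in>K. u t0 z = 0}. real_of_int (zorder (u t0) z) * \<Psi> z) < \<epsilon>"
    \<comment> \<open>The difference of \<open>u t\<close> and \<open>u t0\<close> is
      \<open>t - t0\<close> times that of \<open>B\<close> and \<open>A\<close>, so this radius
      keeps it below \<open>m\<close> on \<open>C\<close>.\<close>
    proof (rule exI[of _ "m / M"], intro conjI ballI impI)
      fix t assume t: "t \<in> {0..1}" and td: "dist t t0 < m / M"
      have less: "norm (u t z - u t0 z) < norm (u t0 z)" if z: "z \<in> C" for z
      proof -
        have "u t z - u t0 z = of_real (t - t0) * (B z - A z)"
          by (simp add: u_def algebra_simps)
        then have "norm (u t z - u t0 z) = \<bar>t - t0\<bar> * norm (B z - A z)"
          by (simp add: norm_mult del: of_real_diff)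
        also have "\<dots> \<le> \<bar>t - t0\<bar> * M" using M z by (intro mult_left_mono) auto
        also have "\<dots> < m" using td M by (simp add: dist_real_def field_simps)
        also have "\<dots> \<le> norm (u t0 z)" using m z by auto
        finally show ?thesis .
      qed
      define Y where "Y p = {z\<in>ball p r. u t z = 0}" for p
      have YS: "Y p \<subseteq> S" if "p \<in> Z" for p
        using rS[OF that] sub1[of p] by (force simp: Y_def)
      have finY: "finite (Y p)" if "p \<in> Z" for p
        by (rule finite_subset[OF _ fin[OF compact_cball rS[OF that] t]])
           (use r in \<open>auto simp: Y_def\<close>)
      have Ysum: "(\<Sum>z\<in>Y p. zorder (u t) z) = zorder (u t0) p" if p: "p \<in> Z" for p
        unfolding Y_def
      proof (rule Rouche_circle_single_zero)
        have sub: "ball p (2*r) \<subseteq> S" using rS[OF p] ball_subset_cball by blast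
        show "u t0 holomorphic_on ball p (2*r)" "u t holomorphic_on ball p (2*r)"
          using uholo sub holomorphic_on_subset by blast+
        show "finite {z\<in>ball p (2*r). u t0 z = 0}" 
          by (rule finite_subset[OF _ fin[OF compact_cball rS[OF p] t0]]) auto
        show "finite {z\<in>ball p (2*r). u t z = 0}" 
          by (rule finite_subset[OF _ fin[OF compact_cball rS[OF p] t]]) auto
        show "norm (u t z - u t0 z) < norm (u t0 z)" if "z \<in> sphere p r" for z
          using that p by (intro less) (auto simp: C_def)
      qed (use r r0[OF p] in auto)
      have disj: "Y p \<inter> Y q = {}" if "p \<in> Z" "q \<in> Z" "p \<noteq> q" for p q
      proof -
        have False if "z \<in> Y p" "z \<in> Y q" for z
        proof -
          have "dist p q \<le> dist p z + dist q z" by (metis dist_commute dist_triangle)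
          moreover have "dist p z < r" "dist q z < r" using that by (auto simp: Y_def)
          ultimately show False using rd[OF \<open>p \<in> Z\<close> \<open>q \<in> Z\<close> \<open>p \<noteq> q\<close>] by linarith
        qed
        then show ?thesis by blast
      qed
      have cover: "{z\<in>K. u t z = 0} \<subseteq> (\<Union>p\<in>Z. Y p)"
      proof
        fix z assume z: "z \<in> {z\<in>K. u t z = 0}"
        have "z \<notin> C" using less[of z] z by auto
        then show "z \<in> (\<Union>p\<in>Z. Y p)" using z by (auto simp: C_def Y_def)
      qed
      have "(\<Sum>z\<in>{z\<in>K. u t z = 0}. real_of_int (zorder (u t) z) * \<Psi> z)
          = (\<Sum>z\<in>(\<Union>p\<in>Z. Y p). real_of_int (zorder (u t) z) * \<Psi> z)"
      \<comment> \<open>The discs may stick out of \<open>K\<close>; the additional zeros there have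
        weight 0.\<close>
      proof (rule sum.mono_neutral_left)
        show "\<forall>z\<in>(\<Union>p\<in>Z. Y p) - {z\<in>K. u t z = 0}. real_of_int (zorder (u t) z) * \<Psi> z = 0"
        proof
          fix z assume z: "z \<in> (\<Union>p\<in>Z. Y p) - {z\<in>K. u t z = 0}"
          then have "z \<in> S" using YS by blast
          moreover have "z \<notin> K" using z by (auto simp: Y_def)
          ultimately show "real_of_int (zorder (u t) z) * \<Psi> z = 0" using supp by simp
        qed
      qed (use cover finZ finY in auto)
      also have "\<dots> = (\<Sum>p\<in>Z. \<Sum>z\<in>Y p. real_of_int (zorder (u t) z) * \<Psi> z)"
        using finZ finY disj by (intro sum.UNION_disjoint) auto
      finally have eq1: "(\<Sum>z\<in>{z\<in>K. u t z = 0}. real_of_int (zorder (u t) z) * \<Psi> z) = \<dots>" .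
      have eq2: "(\<Sum>z\<in>{z\<in>K. u t0 z = 0}. real_of_int (zorder (u t0) z) * \<Psi> z)
          = (\<Sum>p\<in>Z. \<Sum>z\<in>Y p. real_of_int (zorder (u t) z) * \<Psi> p)"
        unfolding Z_def[symmetric] by (intro sum.cong refl) (simp flip: sum_distrib_right of_int_sum add: Ysum)
      have "dist (\<Sum>z\<in>{z\<in>K. u t z = 0}. real_of_int (zorder (u t) z) * \<Psi> z)
             (\<Sum>z\<in>{z\<in>K. u t0 z = 0}. real_of_int (zorder (u t0) z) * \<Psi> z)
          = \<bar>\<Sum>p\<in>Z. \<Sum>z\<in>Y p. real_of_int (zorder (u t) z) * (\<Psi> z - \<Psi> p)\<bar>"
        unfolding eq1 eq2 dist_real_def by (simp add: sum_subtractf right_diff_distrib)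
      also have "\<dots> \<le> (\<Sum>p\<in>Z. \<Sum>z\<in>Y p. \<bar>real_of_int (zorder (u t) z) * (\<Psi> z - \<Psi> p)\<bar>)"
        by (rule order.trans[OF sum_abs]) (intro sum_mono sum_abs)
      also have "\<dots> \<le> (\<Sum>p\<in>Z. \<Sum>z\<in>Y p. real_of_int (zorder (u t) z) * \<delta>)"
      proof (intro sum_mono)
        fix p z assume p: "p \<in> Z" and z: "z \<in> Y p"
        have "zorder (u t) z \<ge> 0" using ge0[OF t] YS[OF p] z by auto
        moreover have "\<bar>\<Psi> z - \<Psi> p\<bar> \<le> \<delta>" using r\<Psi>[OF p, of z] z by (auto simp: Y_def)
        ultimately show "\<bar>real_of_int (zorder (u t) z) * (\<Psi> z - \<Psi> p)\<bar> \<le> real_of_int (zorder (u t) z) * \<delta>"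
          by (auto simp: abs_mult intro!: mult_left_mono)
      qed
      also have "\<dots> = W * \<delta>"
        unfolding W_def sum_distrib_right
        by (intro sum.cong refl) (simp flip: sum_distrib_right of_int_sum add: Ysum)
      also have "\<dots> < \<epsilon>"
        using W \<epsilon> by (simp add: \<delta>_def field_simps)
      finally show "dist (\<Sum>z\<in>{z\<in>K. u t z = 0}. real_of_int (zorder (u t) z) * \<Psi> z)
             (\<Sum>z\<in>{z\<in>K. u t0 z = 0}. real_of_int (zorder (u t0) z) * \<Psi> z) < \<epsilon>" .
    qed (use m M in auto)
  qed
qed

section \<open>The modular group acting on the upper half plane\<close>

text \<open>Group elements are real matrices; naming their integer entries turns group identities
  into integer arithmetic.\<close>

definition imat :: "int \<Rightarrow> int \<Rightarrow> int \<Rightarrow> int \<Rightarrow> mat2" where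
  "imat a b c d = vector [vector [of_int a, of_int b], vector [of_int c, of_int d]]"

lemma imat_nth [simp]:
  "imat a b c d $ 1 $ 1 = of_int a" "imat a b c d $ 1 $ 2 = of_int b"
  "imat a b c d $ 2 $ 1 = of_int c" "imat a b c d $ 2 $ 2 = of_int d"
  by (simp_all add: imat_def)

lemma mat2_eq_iff:
  "A = B \<longleftrightarrow> A$1$1 = B$1$1 \<and> A$1$2 = B$1$2 \<and> A$2$1 = B$2$1 \<and> A$2$2 = (B::mat2)$2$2"
  by (auto simp: vec_eq_iff forall_2)

lemma mat2_mult_nth:
  fixes A B :: mat2
  shows "(A ** B) $ i $ j = A$i$1 * B$1$j + A$i$2 * B$2$j"
  by (simp add: matrix_matrix_mult_def sum_2)

lemma mat1_nth [simp]:
  "(mat 1 :: mat2) $ 1 $ 1 = 1" "(mat 1 :: mat2) $ 1 $ 2 = 0"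
  "(mat 1 :: mat2) $ 2 $ 1 = 0" "(mat 1 :: mat2) $ 2 $ 2 = 1"
  by (simp_all add: mat_def)

lemma imat_mult: "imat a b c d ** imat a' b' c' d' = imat (a*a'+b*c') (a*b'+b*d') (c*a'+d*c') (c*b'+d*d')"
  by (simp add: mat2_eq_iff mat2_mult_nth)

lemma imat_inject: "imat a b c d = imat a' b' c' d' \<longleftrightarrow> a = a' \<and> b = b' \<and> c = c' \<and> d = d'"
  by (simp add: mat2_eq_iff)

lemma uminus_imat: "- imat a b c d = imat (-a) (-b) (-c) (-d)"
  by (simp add: mat2_eq_iff)

lemma mat1_imat: "mat 1 = imat 1 0 0 1"
  by (simp add: mat2_eq_iff)

lemma imat_in_SL2Z: "imat a b c d \<in> SL2Z \<longleftrightarrow> a * d - b * c = 1"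
proof -
  have "det (imat a b c d) = of_int (a * d - b * c)" by (simp add: det_2)
  then show ?thesis by (auto simp: SL2Z_def forall_2 simp flip: of_int_diff of_int_mult)
qed

lemma SL2Z_E:
  assumes "\<gamma> \<in> SL2Z"
  obtains a b c d where "\<gamma> = imat a b c d" "a * d - b * c = 1"
proof -
  have "\<And>i j. \<gamma>$i$j \<in> \<int>" using assms by (auto simp: SL2Z_def)
  then have "\<gamma> = imat \<lfloor>\<gamma>$1$1\<rfloor> \<lfloor>\<gamma>$1$2\<rfloor> \<lfloor>\<gamma>$2$1\<rfloor> \<lfloor>\<gamma>$2$2\<rfloor>"
    by (simp add: mat2_eq_iff)
  with assms that show thesis by (metis imat_in_SL2Z)
qed

lemma SL2Z_det: "\<gamma> \<in> SL2Z \<Longrightarrow> det \<gamma> = 1"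
  by (simp add: SL2Z_def)

lemma SL2Z_mat1 [simp]: "mat 1 \<in> SL2Z"
  by (simp add: mat1_imat imat_in_SL2Z)

lemma SL2Z_mult [simp]: "A \<in> SL2Z \<Longrightarrow> B \<in> SL2Z \<Longrightarrow> A ** B \<in> SL2Z"
proof -
  assume "A \<in> SL2Z" "B \<in> SL2Z"
  then obtain a b c d a' b' c' d' where *: "A = imat a b c d" "a * d - b * c = 1"
    "B = imat a' b' c' d'" "a' * d' - b' * c' = 1" by (metis SL2Z_E)
  have "(a*a'+b*c') * (c*b'+d*d') - (a*b'+b*d') * (c*a'+d*c') = (a * d - b * c) * (a' * d' - b' * c')"
    by (simp add: algebra_simps)
  with * show "A ** B \<in> SL2Z" by (simp add: imat_mult imat_in_SL2Z)
qed

lemma SL2Z_uminus [simp]: "A \<in> SL2Z \<Longrightarrow> - A \<in> SL2Z"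
  by (elim SL2Z_E) (simp add: uminus_imat imat_in_SL2Z)

lemma matrix_inv_inverse:
  assumes "A ** B = mat 1" "B ** A = (mat 1 :: mat2)"
  shows "matrix_inv A = B"
proof -
  have "A ** matrix_inv A = mat 1 \<and> matrix_inv A ** A = mat 1"
    unfolding matrix_inv_def by (rule someI[of _ B]) (use assms in auto)
  then show ?thesis by (metis assms(2) matrix_mul_assoc matrix_mul_lid matrix_mul_rid)
qed

lemma matrix_inv_imat:
  assumes "a * d - b * c = 1"
  shows "matrix_inv (imat a b c d) = imat d (-b) (-c) a"
  using assms by (intro matrix_inv_inverse) (simp_all add: imat_mult mat1_imat imat_inject algebra_simps)

lemma SL2Z_inv:
  assumes "A \<in> SL2Z"
  shows "matrix_inv A \<in> SL2Z" "A ** matrix_inv A = mat 1" "matrix_inv A ** A = mat 1"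
  using assms by (auto elim!: SL2Z_E simp: matrix_inv_imat imat_in_SL2Z imat_mult mat1_imat imat_inject algebra_simps)

lemma SL2Z_mult_inv_cancel:
  assumes "A \<in> SL2Z"
  shows "A ** (matrix_inv A ** B) = B" "matrix_inv A ** (A ** B) = B"
        "B ** A ** matrix_inv A = B" "B ** matrix_inv A ** A = B"
  using SL2Z_inv[OF assms] by (metis matrix_mul_assoc matrix_mul_lid matrix_mul_rid)+

lemma matrix_inv_mult:
  assumes "A \<in> SL2Z" "B \<in> SL2Z"
  shows "matrix_inv (A ** B) = matrix_inv B ** matrix_inv A"
  by (rule matrix_inv_inverse)
     (metis SL2Z_inv SL2Z_mult_inv_cancel assms matrix_mul_assoc)+

lemma matrix_inv_matrix_inv: "A \<in> SL2Z \<Longrightarrow> matrix_inv (matrix_inv A) = A"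
  by (rule matrix_inv_inverse) (auto simp: SL2Z_inv)

lemma mat2_uminus_mult: "(- A) ** B = - ((A::mat2) ** (B::mat2))" "A ** (- B) = - ((A::mat2) ** (B::mat2))"
  by (simp_all add: mat2_eq_iff mat2_mult_nth)

lemma matrix_inv_uminus: "A \<in> SL2Z \<Longrightarrow> matrix_inv (- A) = - matrix_inv A"
  by (rule matrix_inv_inverse) (auto simp: SL2Z_inv mat2_uminus_mult)

text \<open>The classical automorphy factor; its cocycle relation is
  \<open>autfac_mult\<close>.\<close>

definition autfac :: "mat2 \<Rightarrow> complex \<Rightarrow> complex" where
  "autfac M z = of_real (M$2$1) * z + of_real (M$2$2)"

lemma autfac_nonzero: assumes "det M = 1" "z \<in> UHP" shows "autfac M z \<noteq> 0"
proof
  assume "autfac M z = 0"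
  then have "Im (autfac M z) = 0" "Re (autfac M z) = 0" by auto
  then have "M$2$1 * Im z = 0" "M$2$1 * Re z + M$2$2 = 0" by (auto simp: autfac_def)
  with assms have "M$2$1 = 0" "M$2$2 = 0" by (auto simp: UHP_def)
  with assms(1) show False by (simp add: det_2)
qed

lemma mob_autfac: "mob M z = (of_real (M$1$1) * z + of_real (M$1$2)) / autfac M z"
  by (simp add: mob_def autfac_def)

lemma Im_mob:
  assumes "det M = 1" "z \<in> UHP"
  shows "Im (mob M z) = Im z / (norm (autfac M z))\<^sup>2"
proof -
  let ?n = "of_real (M$1$1) * z + of_real (M$1$2)"
  have *: "Im (?n * cnj (autfac M z)) = det M * Im z"
    by (simp add: autfac_def det_2 algebra_simps)
  have "mob M z = ?n * cnj (autfac M z) / of_real ((norm (autfac M z))\<^sup>2)"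
    unfolding mob_autfac using complex_div_cnj[of ?n "autfac M z"] by simp
  then have "Im (mob M z) = Im (?n * cnj (autfac M z)) / (norm (autfac M z))\<^sup>2"
    by (simp add: Im_divide_of_real)
  then show ?thesis using * assms by simp
qed

lemma mob_UHP: "det M = 1 \<Longrightarrow> z \<in> UHP \<Longrightarrow> mob M z \<in> UHP"
  using autfac_nonzero[of M z] Im_mob[of M z] by (simp add: UHP_def)

lemma mob_SL2Z_UHP [simp]: "M \<in> SL2Z \<Longrightarrow> z \<in> UHP \<Longrightarrow> mob M z \<in> UHP"
  by (simp add: SL2Z_det mob_UHP)

lemma autfac_mult:
  assumes "det B = 1" "z \<in> UHP"
  shows "autfac (A ** B) z = autfac A (mob B z) * autfac B z"
  using autfac_nonzero[OF assms] by (simp add: autfac_def mob_autfac mat2_mult_nth field_simps)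

lemma mob_mult:
  assumes "det A = 1" "det B = 1" "z \<in> UHP"
  shows "mob (A ** B) z = mob A (mob B z)"
proof -
  have 1: "autfac B z \<noteq> 0" and 2: "autfac A (mob B z) \<noteq> 0"
    using autfac_nonzero assms mob_UHP by auto
  have "(of_real ((A**B)$1$1) * z + of_real ((A**B)$1$2))
      = (of_real (A$1$1) * mob B z + of_real (A$1$2)) * autfac B z"
    using 1 by (simp add: mob_autfac mat2_mult_nth field_simps)
       (simp add: autfac_def algebra_simps)
  then show ?thesis using 1 2
    unfolding mob_autfac[of "A**B"] mob_autfac[of A] autfac_mult[OF assms(2,3)] by simp
qed

lemma mob_SL2Z_mult: "A \<in> SL2Z \<Longrightarrow> B \<in> SL2Z \<Longrightarrow> z \<in> UHP \<Longrightarrow> mob (A ** B) z = mob A (mob B z)"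
  by (simp add: mob_mult SL2Z_det)

lemma mob_mat1 [simp]: "mob (mat 1) z = z"
  by (simp add: mob_def)

lemma mob_uminus [simp]: "mob (- A) z = mob A z"
proof -
  have "mob (-A) z = (-(of_real (A$1$1) * z + of_real (A$1$2))) / (-(of_real (A$2$1) * z + of_real (A$2$2)))"
    by (simp add: mob_def)
  then show ?thesis unfolding mob_def by (simp only: minus_divide_divide)
qed

lemma mob_inv_cancel:
  assumes "A \<in> SL2Z" "z \<in> UHP"
  shows "mob A (mob (matrix_inv A) z) = z" "mob (matrix_inv A) (mob A z) = z"
  using assms by (simp_all flip: mob_SL2Z_mult add: SL2Z_inv)

lemma mob_inj: "A \<in> SL2Z \<Longrightarrow> z \<in> UHP \<Longrightarrow> w \<in> UHP \<Longrightarrow> mob A z = mob A w \<Longrightarrow> z = w"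
  by (metis mob_inv_cancel(2))

lemma open_UHP: "open UHP"
  unfolding UHP_def by (rule open_halfspace_Im_gt)

lemma convex_UHP: "convex UHP"
  unfolding UHP_def by (rule convex_halfspace_Im_gt)

lemma connected_UHP: "connected UHP"
  using convex_UHP convex_connected by blast

text \<open>The factor next to \<open>w - z\<close> is holomorphic and nowhere zero in
  \<open>w\<close>, so \<open>mob A\<close> takes each of its values simply. This is what makes zero
  orders invariant in \<open>zorder_mob\<close>.\<close>

lemma mob_diff:
  assumes "det A = 1" "z \<in> UHP" "w \<in> UHP"
  shows "mob A w - mob A z = (w - z) / (autfac A w * autfac A z)"
proof -
  have 1: "autfac A z \<noteq> 0" "autfac A w \<noteq> 0" using autfac_nonzero assms by auto
  have "of_real (A$1$1) * of_real (A$2$2) - of_real (A$1$2) * of_real (A$2$1) = complex_of_real (det A)"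
    by (simp add: det_2)
  then have d: "of_real (A$1$1) * of_real (A$2$2) = 1 + of_real (A$1$2) * complex_of_real (A$2$1)"
    using assms by (simp add: algebra_simps)
  have "(of_real (A$1$1) * w + of_real (A$1$2)) * autfac A z - (of_real (A$1$1) * z + of_real (A$1$2)) * autfac A w
     = (of_real (A$1$1) * of_real (A$2$2) - of_real (A$1$2) * of_real (A$2$1)) * (w - z)"
    by (simp add: autfac_def algebra_simps)
  also have "\<dots> = w - z" by (simp add: d)
  finally show ?thesis using 1 unfolding mob_autfac by (simp add: divide_simps mult.commute)
qed

lemma autfac_holomorphic [holomorphic_intros]: "autfac A holomorphic_on S"
  unfolding autfac_def by (intro holomorphic_intros)

lemma mob_holomorphic: "det A = 1 \<Longrightarrow> mob A holomorphic_on UHP"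
  unfolding mob_def[abs_def]
  by (intro holomorphic_intros) (use autfac_nonzero in \<open>auto simp: autfac_def\<close>)

lemma mob_analytic: "det A = 1 \<Longrightarrow> z \<in> UHP \<Longrightarrow> mob A analytic_on {z}"
  using mob_holomorphic open_UHP analytic_at by blast

lemma filterlim_mob:
  assumes "A \<in> SL2Z" "z \<in> UHP"
  shows "filterlim (mob A) (at (mob A z)) (at z)"
proof (rule filterlim_atI)
  have "isCont (mob A) z"
    using mob_analytic[of A z] SL2Z_det assms analytic_at_imp_isCont by blast
  then show "(mob A \<longlongrightarrow> mob A z) (at z)" by (simp add: isCont_def)
  have "eventually (\<lambda>w. w \<in> UHP - {z}) (at z)"
    using open_UHP assms by (intro eventually_at_in_open) auto
  then show "eventually (\<lambda>w. mob A w \<noteq> mob A z) (at z)"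
    by eventually_elim (use mob_inj assms in auto)
qed

lemma eventually_mob:
  assumes "A \<in> SL2Z" "z \<in> UHP" "eventually P (at (mob A z))"
  shows "eventually (\<lambda>w. P (mob A w)) (at z)"
  using filterlim_mob[OF assms(1,2)] assms(3) by (rule eventually_compose_filterlim[rotated])

lemma eventually_in_UHP: "z \<in> UHP \<Longrightarrow> eventually (\<lambda>w. w \<in> UHP) (at z)"
  using open_UHP by (intro eventually_at_in_open') auto

text \<open>Equality of filters, stronger than the limit in \<open>filterlim_mob\<close>, is what
  lets \<open>remove_sings\<close> commute with composition by \<open>mob A\<close>.\<close>

lemma filtermap_mob:
  assumes "A \<in> SL2Z" "z \<in> UHP"
  shows "filtermap (mob A) (at z) = at (mob A z)"
proof (rule filter_eq_iff[THEN iffD2], intro allI iffI)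
  fix P assume "eventually P (filtermap (mob A) (at z))"
  then have *: "eventually (\<lambda>w. P (mob A w)) (at z)" by (simp add: eventually_filtermap)
  have z: "z = mob (matrix_inv A) (mob A z)" using mob_inv_cancel assms by simp
  have "eventually (\<lambda>w. P (mob A (mob (matrix_inv A) w))) (at (mob A z))"
    using * assms by (intro eventually_mob[where P = "\<lambda>w. P (mob A w)"]) (auto simp: SL2Z_inv simp flip: z)
  moreover have "eventually (\<lambda>w. w \<in> UHP) (at (mob A z))"
    using assms by (intro eventually_in_UHP) auto
  ultimately show "eventually P (at (mob A z))"
    by eventually_elim (use assms mob_inv_cancel(1) in simp)
next
  fix P assume "eventually P (at (mob A z))"
  then show "eventually P (filtermap (mob A) (at z))"
    using eventually_mob[OF assms] by (simp add: eventually_filtermap)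
qed

lemma zorder_mob:
  assumes "A \<in> SL2Z" "z \<in> UHP" "f meromorphic_on {mob A z}" "eventually (\<lambda>w. f w \<noteq> 0) (at (mob A z))"
  shows "zorder (\<lambda>w. f (mob A w)) z = zorder f (mob A z)"
proof -
  have d: "det A = 1" using assms by (simp add: SL2Z_det)
  have "zorder (\<lambda>x. mob A x - mob A z) z = 1"
  proof (rule zorder_eqI[OF open_UHP assms(2), where g = "\<lambda>w. 1 / (autfac A w * autfac A z)"])
    show "(\<lambda>w. 1 / (autfac A w * autfac A z)) holomorphic_on UHP"
      by (intro holomorphic_intros) (use autfac_nonzero d assms in auto)
  qed (use mob_diff[OF d assms(2)] autfac_nonzero[OF d] assms(2) in auto)
  moreover have "zorder (f \<circ> mob A) z = zorder f (mob A z) * zorder (\<lambda>x. mob A x - mob A z) z"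
    using assms filterlim_mob[OF assms(1,2)] mob_analytic[OF d assms(2)]
    by (intro zorder_compose') (auto simp: meromorphic_at_iff filterlim_at)
  ultimately show ?thesis by (simp add: o_def)
qed

lemma meromorphic_mob:
  assumes "A \<in> SL2Z" "f meromorphic_on UHP"
  shows "(\<lambda>w. f (mob A w)) meromorphic_on UHP"
proof (rule meromorphic_on_compose[OF assms(2)])
  show "mob A analytic_on UHP"
    using mob_holomorphic[of A] assms SL2Z_det open_UHP by (simp add: analytic_on_open)
qed (use assms in auto)

definition Tpow :: "int \<Rightarrow> mat2" where "Tpow n = imat 1 n 0 1"
definition Smat :: mat2 where "Smat = imat 0 (-1) 1 0"

lemma Tpow_SL2Z [simp]: "Tpow n \<in> SL2Z" and Smat_SL2Z [simp]: "Smat \<in> SL2Z"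
  by (auto simp: Tpow_def Smat_def imat_in_SL2Z)

lemma mob_Tpow [simp]: "mob (Tpow n) z = z + of_int n"
  by (simp add: Tpow_def mob_def)

lemma autfac_Tpow [simp]: "autfac (Tpow n) z = 1"
  by (simp add: Tpow_def autfac_def)

lemma mob_Smat [simp]: "mob Smat z = - 1 / z"
  by (simp add: Smat_def mob_def)

lemma autfac_Smat [simp]: "autfac Smat z = z"
  by (simp add: Smat_def autfac_def)

lemma SL2Z_c0:
  assumes "A \<in> SL2Z" "A $ 2 $ 1 = 0"
  obtains n where "A = Tpow n \<or> A = - Tpow n"
proof -
  obtain a b c d where *: "A = imat a b c d" "a * d - b * c = 1"
    using assms SL2Z_E by metis
  with assms have "c = 0" by simp
  then have "a * d = 1" using * by simp
  then have "a = 1 \<and> d = 1 \<or> a = -1 \<and> d = -1" by (simp add: zmult_eq_1_iff)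
  then show thesis
    using that[of b] that[of "-b"] * \<open>c = 0\<close> by (auto simp: Tpow_def uminus_imat imat_inject)
qed

text \<open>\<open>A ** matrix_inv B\<close> has lower row (0, 1), hence is a translation: lower
  rows parametrise the cosets of the translation group.\<close>

lemma same_bottom_row:
  assumes "A \<in> SL2Z" "B \<in> SL2Z" "A$2$1 = B$2$1" "A$2$2 = B$2$2"
  obtains n where "A = Tpow n ** B"
proof -
  obtain a b c d where A: "A = imat a b c d" "a * d - b * c = 1"
    using assms SL2Z_E by metis
  obtain a' b' c' d' where B: "B = imat a' b' c' d'" "a' * d' - b' * c' = 1"
    using assms SL2Z_E by metis
  have [simp]: "c' = c" "d' = d" using assms A B by auto
  have "A ** matrix_inv B = imat (a * d - b * c) (b * a' - a * b') (c * d - d * c) (d * a' - c * b')"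
    using A B by (simp add: matrix_inv_imat imat_mult imat_inject algebra_simps)
  also have "\<dots> = Tpow (b * a' - a * b')" using A B by (simp add: Tpow_def imat_inject algebra_simps)
  finally have "A = Tpow (b * a' - a * b') ** B"
    using SL2Z_mult_inv_cancel(4)[OF assms(2)] by metis
  then show thesis using that by blast
qed

text \<open>Generation by \<open>Smat\<close> and \<open>Tpow 1\<close> through the Euclidean
  algorithm on the lower row. The recursion ends with a translation up to sign, and the sign is the
  square of \<open>Smat\<close>.\<close>

lemma SL2Z_induct:
  assumes g: "\<gamma> \<in> SL2Z"
    and S: "P Smat" and T: "P (Tpow 1)"
    and mult: "\<And>A B. A \<in> SL2Z \<Longrightarrow> B \<in> SL2Z \<Longrightarrow> P A \<Longrightarrow> P B \<Longrightarrow> P (A ** B)"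
    and inv: "\<And>A. A \<in> SL2Z \<Longrightarrow> P A \<Longrightarrow> P (matrix_inv A)"
  shows "P \<gamma>"
proof -
  have Tnat: "P (Tpow (int n))" for n
  proof (induction n)
    case 0
    have "matrix_inv Smat ** Smat = Tpow 0" by (simp add: SL2Z_inv Tpow_def mat1_imat)
    then show ?case using mult[of "matrix_inv Smat" Smat] inv S by (simp add: SL2Z_inv)
  next
    case (Suc n)
    have "Tpow 1 ** Tpow (int n) = Tpow (int (Suc n))" by (simp add: Tpow_def imat_mult imat_inject)
    then show ?case using mult[of "Tpow 1" "Tpow (int n)"] T Suc by simp
  qed
  have PT: "P (Tpow n)" for n
  proof (cases "n \<ge> 0")
    case True then show ?thesis using Tnat[of "nat n"] by simp
  next
    case False
    have "matrix_inv (Tpow (-n)) = Tpow n" by (simp add: Tpow_def matrix_inv_imat)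
    then show ?thesis using inv[of "Tpow (-n)"] Tnat[of "nat (-n)"] False by simp
  qed
  have mS: "- mat 1 = Smat ** Smat" by (simp add: Smat_def imat_mult mat1_imat uminus_imat)
  have Pm1: "P (- mat 1)" unfolding mS by (intro mult S) auto
  have Pneg: "P (- A)" if "P A" "A \<in> SL2Z" for A
  proof -
    have "- A = (- mat 1) ** A" by (simp add: mat2_uminus_mult)
    then show ?thesis using mult[of "- mat 1" A] Pm1 that by auto
  qed
  show ?thesis using g
  proof (induction "nat \<bar>\<lfloor>\<gamma>$2$1\<rfloor>\<bar>" arbitrary: \<gamma> rule: less_induct)
    case less
    obtain a b c d where *: "\<gamma> = imat a b c d" "a * d - b * c = 1"
      using less SL2Z_E by metis
    show ?case
    proof (cases "c = 0")
      case True
      then obtain n where "\<gamma> = Tpow n \<or> \<gamma> = - Tpow n" using SL2Z_c0[of \<gamma>] less * by auto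
      then show ?thesis using PT Pneg by auto
    next
      case False
      \<comment> \<open>Right multiplication by \<open>Tpow n\<close> replaces \<open>d\<close> by
        \<open>c * n + d\<close>, here \<open>d mod c\<close>, and \<open>Smat\<close> then moves it
        into the lower left corner.\<close>
      define n where "n = - (d div c)"
      define B where "B = \<gamma> ** Tpow n ** Smat"
      have B: "B = imat (a * n + b) (-a) (c * n + d) (-c)"
        by (simp add: B_def * Tpow_def Smat_def imat_mult imat_inject algebra_simps)
      have BS: "B \<in> SL2Z" unfolding B_def using less by auto
      have "c * n + d = d mod c" by (simp add: n_def minus_mult_div_eq_mod[symmetric] algebra_simps)
      then have "\<bar>c * n + d\<bar> < \<bar>c\<bar>" using False by (simp add: abs_mod_less)
      moreover have "\<lfloor>B $ 2 $ 1\<rfloor> = c * n + d" unfolding B imat_nth by (rule floor_of_int)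
      moreover have "\<lfloor>\<gamma> $ 2 $ 1\<rfloor> = c" by (simp add: *)
      ultimately have "P B" using less(1)[of B] BS by linarith
      then have "P (B ** matrix_inv Smat ** matrix_inv (Tpow n))"
        using BS S PT inv by (intro mult) (auto simp: SL2Z_inv)
      also have "B ** matrix_inv Smat ** matrix_inv (Tpow n) = \<gamma>"
        unfolding B_def by (simp add: SL2Z_mult_inv_cancel)
      finally show ?thesis .
    qed
  qed
qed

section \<open>A continuous weight on orbits\<close>

text \<open>Half open, so every point of \<open>UHP\<close> has exactly one integer translate in it
  and no boundary identification remains.\<close>

definition strip :: "complex set" where "strip = {z. 0 \<le> Re z \<and> Re z < 1 \<and> Im z > 0}"

lemma strip_UHP: "strip \<subseteq> UHP" by (auto simp: strip_def UHP_def)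

lemma shift_to_strip: 
  assumes "z \<in> UHP" shows "z + of_int (- \<lfloor>Re z\<rfloor>) \<in> strip"
  using assms by (auto simp: strip_def UHP_def) linarith+

lemma strip_shift_eq:
  assumes "z \<in> strip" "z + of_int n \<in> strip" shows "n = 0"
  using assms by (auto simp: strip_def)

text \<open>The squared modulus splits into two squares, each at most \<open>2 * Im z\<close>. The
  resulting bounds depend only on a box containing \<open>z\<close>, so that one finite set of rows
  serves a whole neighbourhood, as \<open>continuous_on_height_sum\<close> requires.\<close>

lemma bottom_rows_bounded:
  assumes "0 < y" "y \<le> Im z" "Im z \<le> Y" "\<bar>Re z\<bar> \<le> X"
    "(norm (of_int c * z + of_int d))\<^sup>2 \<le> 2 * Im z"
  shows "\<bar>c\<bar> \<le> \<lceil>2 / y + 1\<rceil>" "\<bar>d\<bar> \<le> \<lceil>(2 / y + 1) * X + 2 * Y + 1\<rceil>"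
proof -
  have n: "(norm (of_int c * z + of_int d))\<^sup>2 = (c * Re z + d)\<^sup>2 + (c * Im z)\<^sup>2"
    by (simp add: cmod_power2)
  have yy: "Im z > 0" using assms by linarith
  have "(c * Im z)\<^sup>2 \<le> 2 * Im z" using assms(5) n by (smt (verit) zero_le_power2)
  then have "(real_of_int c)\<^sup>2 * Im z \<le> 2" using yy by (simp add: power2_eq_square mult.assoc)
  then have "(real_of_int c)\<^sup>2 \<le> 2 / Im z" using yy by (simp add: field_simps)
  also have "\<dots> \<le> 2 / y" using assms yy by (intro divide_left_mono) auto
  finally have c2: "(real_of_int c)\<^sup>2 \<le> 2 / y" .
  \<comment> \<open>A crude substitute for taking square roots; only finiteness of the set of rows
    matters.\<close>
  have ab: "\<bar>x\<bar> \<le> x\<^sup>2 + 1" for x :: real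
  proof (cases "\<bar>x\<bar> \<le> 1")
    case False
    then have "\<bar>x\<bar> * 1 \<le> \<bar>x\<bar> * \<bar>x\<bar>" by (intro mult_left_mono) auto
    then show ?thesis by (simp add: power2_eq_square)
  qed (use zero_le_power2[of x] in linarith)
  have c1: "\<bar>real_of_int c\<bar> \<le> 2 / y + 1" using c2 ab[of c] by linarith
  then show "\<bar>c\<bar> \<le> \<lceil>2 / y + 1\<rceil>" by linarith
  have "(c * Re z + d)\<^sup>2 \<le> 2 * Im z" using assms(5) n by (smt (verit) zero_le_power2)
  then have "\<bar>c * Re z + d\<bar> \<le> 2 * Y + 1" using ab[of "c * Re z + d"] assms(3) by linarith
  moreover have "\<bar>c * Re z\<bar> \<le> (2 / y + 1) * X"
    unfolding abs_mult using c1 assms by (intro mult_mono) auto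
  ultimately have "\<bar>real_of_int d\<bar> \<le> (2 / y + 1) * X + 2 * Y + 1" by linarith
  then show "\<bar>d\<bar> \<le> \<lceil>(2 / y + 1) * X + 2 * Y + 1\<rceil>" by linarith
qed

text \<open>The lower rows of the matrices that carry \<open>z\<close> above height 1/2, by
  \<open>Im_gt_half_iff\<close>.\<close>

definition bottom_rows :: "complex \<Rightarrow> (int \<times> int) set" where
  "bottom_rows z = {(c, d). coprime c d \<and> (norm (of_int c * z + of_int d))\<^sup>2 < 2 * Im z}"

definition bottom_row :: "mat2 \<Rightarrow> int \<times> int" where "bottom_row A = (\<lfloor>A$2$1\<rfloor>, \<lfloor>A$2$2\<rfloor>)"

lemma bottom_row_imat [simp]: "bottom_row (imat a b c d) = (c, d)" by (simp add: bottom_row_def)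

lemma finite_bottom_rows: assumes "z \<in> UHP" shows "finite (bottom_rows z)"
proof (rule finite_subset)
  let ?C = "\<lceil>2 / Im z + 1\<rceil>" and ?D = "\<lceil>(2 / Im z + 1) * \<bar>Re z\<bar> + 2 * Im z + 1\<rceil>"
  show "bottom_rows z \<subseteq> {-?C..?C} \<times> {-?D..?D}"
  proof (safe, goal_cases)
    case (1 c d)
    then have "\<bar>c\<bar> \<le> ?C" using bottom_rows_bounded(1)[of "Im z" z "Im z" "\<bar>Re z\<bar>" c d] assms
      by (auto simp: bottom_rows_def UHP_def)
    then show ?case by auto
  next
    case (2 c d)
    then have "\<bar>d\<bar> \<le> ?D" using bottom_rows_bounded(2)[of "Im z" z "Im z" "\<bar>Re z\<bar>" c d] assms
      by (auto simp: bottom_rows_def UHP_def)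
    then show ?case by auto
  qed
qed auto

lemma autfac_imat: "autfac (imat a b c d) z = of_int c * z + of_int d"
  by (simp add: autfac_def)

lemma Im_gt_half_iff:
  assumes "A \<in> SL2Z" "z \<in> UHP"
  shows "Im (mob A z) > 1/2 \<longleftrightarrow> (norm (autfac A z))\<^sup>2 < 2 * Im z"
proof -
  have "(norm (autfac A z))\<^sup>2 > 0" using autfac_nonzero[OF SL2Z_det] assms by simp
  moreover have "Im (mob A z) = Im z / (norm (autfac A z))\<^sup>2" using Im_mob[OF SL2Z_det] assms by simp
  ultimately show ?thesis by (simp add: less_divide_eq mult.commute)
qed

definition to_strip :: "complex \<Rightarrow> mat2 set" where
  "to_strip z = {A \<in> SL2Z. mob A z \<in> strip \<and> Im (mob A z) > 1/2}"

text \<open>A coprime pair completes to a matrix by Bezout, uniquely up to a translation on the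
  left, and exactly one of these translations puts the image into \<open>strip\<close>.\<close>

lemma bij_betw_bottom_row:
  assumes z: "z \<in> UHP" shows "bij_betw bottom_row (to_strip z) (bottom_rows z)"
  unfolding bij_betw_def
proof
  show "inj_on bottom_row (to_strip z)"
  proof (rule inj_onI)
    fix A B assume A: "A \<in> to_strip z" and B: "B \<in> to_strip z" and eq: "bottom_row A = bottom_row B"
    have AB: "A \<in> SL2Z" "B \<in> SL2Z" using A B by (auto simp: to_strip_def)
    have "A$2$1 = B$2$1" "A$2$2 = B$2$2"
      using eq AB by (auto elim!: SL2Z_E)
    then obtain n where n: "A = Tpow n ** B" using same_bottom_row AB by blast
    have "mob A z = mob B z + of_int n" unfolding n using z AB by (simp add: mob_SL2Z_mult)
    then have "n = 0" using A B strip_shift_eq[of "mob B z" n] by (auto simp: to_strip_def)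
    then show "A = B" using n by (simp add: Tpow_def flip: mat1_imat)
  qed
  show "bottom_row ` to_strip z = bottom_rows z"
  proof (intro equalityI subsetI)
    fix x assume "x \<in> bottom_row ` to_strip z"
    then obtain A where A: "A \<in> to_strip z" "x = bottom_row A" by auto
    then have "A \<in> SL2Z" by (simp add: to_strip_def)
    then obtain a b c d where *: "A = imat a b c d" "a * d - b * c = 1"
      using SL2Z_E by metis
    have "coprime c d"
    proof (rule coprimeI)
      fix l assume "l dvd c" "l dvd d"
      then have "l dvd a * d - b * c" by simp
      then show "is_unit l" using * by simp
    qed
    moreover have "(norm (autfac A z))\<^sup>2 < 2 * Im z" using A z Im_gt_half_iff[of A z] by (auto simp: to_strip_def)
    ultimately show "x \<in> bottom_rows z" using A * by (auto simp: bottom_rows_def autfac_imat)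
  next
    fix x assume "x \<in> bottom_rows z"
    then obtain c d where x: "x = (c, d)" "coprime c d" "(norm (of_int c * z + of_int d))\<^sup>2 < 2 * Im z"
      by (auto simp: bottom_rows_def)
    obtain u v where "u * c + v * d = gcd c d" using bezout_int by blast
    then have uv: "v * d - (-u) * c = 1" using x by (simp add: coprime_iff_gcd_eq_1)
    define B where "B = imat v (-u) c d"
    have B: "B \<in> SL2Z" unfolding B_def imat_in_SL2Z by (rule uv)
    define n where "n = - \<lfloor>Re (mob B z)\<rfloor>"
    define A where "A = Tpow n ** B"
    have A: "A \<in> SL2Z" using B by (auto simp: A_def)
    have Am: "A = imat (v + n * c) (-u + n * d) c d" by (simp add: A_def B_def Tpow_def imat_mult imat_inject)
    have "mob A z = mob B z + of_int n" unfolding A_def using z B by (simp add: mob_SL2Z_mult)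
    then have "mob A z \<in> strip" using shift_to_strip[of "mob B z"] B z by (simp add: n_def)
    moreover have "Im (mob A z) > 1/2"
      using Im_gt_half_iff[OF A z] x by (simp add: Am autfac_imat)
    ultimately have "A \<in> to_strip z" using A by (simp add: to_strip_def)
    then show "x \<in> bottom_row ` to_strip z" using Am x by (intro image_eqI[of _ _ A]) auto
  qed
qed

lemma finite_to_strip: "z \<in> UHP \<Longrightarrow> finite (to_strip z)"
  using bij_betw_bottom_row finite_bottom_rows bij_betw_finite by blast

text \<open>The classical reduction: minimise the modulus of the automorphy factor, then translate
  until the real part is at most 1/2 in absolute value. Since applying \<open>Smat\<close> cannot
  lower the minimum, the point has modulus at least 1 and hence height at least
  \<open>sqrt 3 / 2\<close>.\<close>

lemma reduction:
  assumes z: "z \<in> UHP"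
  obtains A where "A \<in> SL2Z" "mob A z \<in> strip" "Im (mob A z) \<ge> sqrt 3 / 2"
proof -
  define N where "N A = norm (autfac A z)" for A
  have *: "\<exists>A0\<in>SL2Z. \<forall>A\<in>SL2Z. N A0 \<le> N A"
  proof -
    \<comment> \<open>The identity gives the value 1, so the minimum may be sought among the values
      up to 1, of which there are finitely many.\<close>
    define R where "R = {N A |A. A \<in> SL2Z \<and> N A \<le> 1}"
    have "R \<subseteq> (\<lambda>(c,d). norm (of_int c * z + of_int d)) `
        ({-\<lceil>2 / Im z + 1\<rceil>..\<lceil>2 / Im z + 1\<rceil>} \<times> {-\<lceil>1 + \<lceil>2 / Im z + 1\<rceil> * \<bar>Re z\<bar>\<rceil>..\<lceil>1 + \<lceil>2 / Im z + 1\<rceil> * \<bar>Re z\<bar>\<rceil>})"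
    proof
      fix x assume "x \<in> R"
      then obtain A where A: "A \<in> SL2Z" "x = N A" "N A \<le> 1" by (auto simp: R_def)
      obtain a b c d where m: "A = imat a b c d" using A SL2Z_E by metis
      have yy: "Im z > 0" using z by (simp add: UHP_def)
      have n1: "norm (of_int c * z + of_int d) \<le> 1" using A m by (simp add: N_def autfac_imat)
      have "\<bar>c * Im z\<bar> \<le> 1" using n1 abs_Im_le_cmod[of "of_int c * z + of_int d"] by simp
      then have "\<bar>real_of_int c\<bar> \<le> 1 / Im z" using yy by (simp add: abs_mult field_simps)
      moreover have "1 / Im z \<le> 2 / Im z" using yy by (simp add: field_simps)
      ultimately have c: "\<bar>c\<bar> \<le> \<lceil>2 / Im z + 1\<rceil>" by linarith
      have "\<bar>c * Re z + d\<bar> \<le> 1" using n1 abs_Re_le_cmod[of "of_int c * z + of_int d"] by simp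
      moreover have "\<bar>c * Re z\<bar> \<le> \<lceil>2 / Im z + 1\<rceil> * \<bar>Re z\<bar>"
        unfolding abs_mult using c by (intro mult_right_mono) auto
      ultimately have "\<bar>d\<bar> \<le> \<lceil>1 + \<lceil>2 / Im z + 1\<rceil> * \<bar>Re z\<bar>\<rceil>" by linarith
      then show "x \<in> (\<lambda>(c,d). norm (of_int c * z + of_int d)) `
        ({-\<lceil>2 / Im z + 1\<rceil>..\<lceil>2 / Im z + 1\<rceil>} \<times> {-\<lceil>1 + \<lceil>2 / Im z + 1\<rceil> * \<bar>Re z\<bar>\<rceil>..\<lceil>1 + \<lceil>2 / Im z + 1\<rceil> * \<bar>Re z\<bar>\<rceil>})"
        using c A m by (intro image_eqI[of _ _ "(c,d)"]) (auto simp: N_def autfac_imat)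
    qed
    then have finR: "finite R" by (rule finite_subset) auto
    have "N (mat 1) = 1" by (simp add: N_def autfac_def)
    then have "1 \<in> R" unfolding R_def by (force simp: R_def)
    then have "Min R \<in> R" using finR by (intro Min_in) auto
    then obtain A0 where A0: "A0 \<in> SL2Z" "N A0 = Min R" "N A0 \<le> 1" by (auto simp: R_def)
    have "N A0 \<le> N A" if "A \<in> SL2Z" for A
    proof (cases "N A \<le> 1")
      case True
      then have "N A \<in> R" using that by (auto simp: R_def)
      then show ?thesis using finR A0 by simp
    qed (use A0 in auto)
    then show ?thesis using A0 by blast
  qed
  then obtain A0 where A0: "A0 \<in> SL2Z" "\<And>A. A \<in> SL2Z \<Longrightarrow> N A0 \<le> N A" by blast
  define w where "w = mob A0 z"
  have w: "w \<in> UHP" using A0 z by (simp add: w_def)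
  define n where "n = - round (Re w)"
  define w' where "w' = w + of_int n"
  have w': "w' = mob (Tpow n ** A0) z" using A0 z by (simp add: w'_def w_def mob_SL2Z_mult)
  have "autfac (Smat ** (Tpow n ** A0)) z = w' * (autfac (Tpow n) w * autfac A0 z)"
    using A0 z by (simp add: autfac_mult SL2Z_det SL2Z_mult w' w_def)
  then have "N (Smat ** (Tpow n ** A0)) = norm w' * N A0" by (simp add: N_def norm_mult)
  then have "N A0 \<le> norm w' * N A0" using A0(2)[of "Smat ** (Tpow n ** A0)"] A0(1) by auto
  moreover have "N A0 > 0" using autfac_nonzero[of A0 z] A0 z SL2Z_det by (auto simp: N_def)
  ultimately have "norm w' \<ge> 1" by simp
  moreover have "\<bar>Re w'\<bar> \<le> 1/2"
    using of_int_round_abs_le[of "Re w"] by (simp add: w'_def n_def abs_minus_commute)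
  ultimately have "(Im w')\<^sup>2 \<ge> 3/4"
  proof -
    assume a: "norm w' \<ge> 1" "\<bar>Re w'\<bar> \<le> 1/2"
    have "(Re w')\<^sup>2 \<le> (1/2)\<^sup>2" using a(2) by (intro abs_le_square_iff[THEN iffD1]) auto
    moreover have "(norm w')\<^sup>2 \<ge> 1" using a(1) by simp
    ultimately show ?thesis unfolding cmod_power2 by (simp add: power_divide)
  qed
  moreover have "Im w' > 0" using w by (simp add: w'_def UHP_def)
  ultimately have im: "Im w' \<ge> sqrt 3 / 2"
    by (intro power2_le_imp_le[of "sqrt 3 / 2"]) (auto simp: power_divide)
  \<comment> \<open>The centred translate \<open>w'\<close> served for the estimate; the point
    delivered is another translate of the same height, lying in \<open>strip\<close>.\<close>
  define A where "A = Tpow (- \<lfloor>Re w\<rfloor>) ** A0"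
  have mA: "mob A z = w + of_int (- \<lfloor>Re w\<rfloor>)" using A0 z by (simp add: A_def w_def mob_SL2Z_mult)
  show thesis
  proof
    show "A \<in> SL2Z" using A0 by (auto simp: A_def)
    show "mob A z \<in> strip" using shift_to_strip[OF w] mA by simp
    show "Im (mob A z) \<ge> sqrt 3 / 2" using im by (simp add: mA w'_def)
  qed
qed

lemma half_less_sqrt3: "1 / 2 < sqrt 3 / 2" by simp

definition zstab :: "complex \<Rightarrow> mat2 set" where "zstab z = {A \<in> SL2Z. mob A z = z}"

text \<open>The matrices taking \<open>z\<close> to a given point of its orbit form a left coset of
  the stabiliser, so all these fibres have the same size.\<close>

lemma zstab_transport:
  assumes B: "B \<in> SL2Z" and z: "z \<in> UHP"
  shows "bij_betw (\<lambda>A. B ** A) (zstab z) {A \<in> SL2Z. mob A z = mob B z}"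
proof (rule bij_betw_byWitness[where f' = "\<lambda>A. matrix_inv B ** A"])
  show "(\<lambda>A. B ** A) ` zstab z \<subseteq> {A \<in> SL2Z. mob A z = mob B z}"
    using B z by (auto simp: zstab_def mob_SL2Z_mult)
  show "(\<lambda>A. matrix_inv B ** A) ` {A \<in> SL2Z. mob A z = mob B z} \<subseteq> zstab z"
    using B z SL2Z_inv(1)[OF B] mob_inv_cancel(2)[OF B z] by (auto simp: zstab_def mob_SL2Z_mult)
qed (use B in \<open>auto simp: SL2Z_mult_inv_cancel\<close>)

lemma zstab_conj:
  assumes B: "B \<in> SL2Z" and z: "z \<in> UHP"
  shows "bij_betw (\<lambda>A. B ** A ** matrix_inv B) (zstab z) (zstab (mob B z))"
proof (rule bij_betw_byWitness[where f' = "\<lambda>A. matrix_inv B ** (A ** B)"])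
  have iB: "matrix_inv B \<in> SL2Z" using B by (rule SL2Z_inv)
  show "(\<lambda>A. B ** A ** matrix_inv B) ` zstab z \<subseteq> zstab (mob B z)"
    using B z iB mob_inv_cancel(2)[OF B z] by (auto simp: zstab_def mob_SL2Z_mult)
  show "(\<lambda>A. matrix_inv B ** (A ** B)) ` zstab (mob B z) \<subseteq> zstab z"
    using B z iB mob_inv_cancel(2)[OF B z] by (auto simp: zstab_def mob_SL2Z_mult)
  show "\<forall>a\<in>zstab z. matrix_inv B ** (B ** a ** matrix_inv B ** B) = a"
    using B by (simp add: SL2Z_mult_inv_cancel)
  show "\<forall>a'\<in>zstab (mob B z). B ** (matrix_inv B ** (a' ** B)) ** matrix_inv B = a'"
    using B by (simp add: SL2Z_mult_inv_cancel)
qed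

lemma card_zstab_mob:
  assumes "B \<in> SL2Z" "z \<in> UHP" shows "card (zstab (mob B z)) = card (zstab z)"
  using bij_betw_same_card[OF zstab_conj[OF assms]] by simp

text \<open>At a point of \<open>strip\<close> above height 1/2, an automorphy factor of modulus 1
  forces the lower row into a grid of 3 by 5 pairs; conjugation carries the bound to every other
  point. The bound 15 is far from sharp but uniform, which is all that a common denominator
  requires.\<close>

lemma finite_zstab_bound:
  assumes z: "z \<in> UHP" shows "finite (zstab z)" "card (zstab z) \<le> 15" "card (zstab z) > 0"
proof -
  obtain B where B: "B \<in> SL2Z" "mob B z \<in> strip" "Im (mob B z) \<ge> sqrt 3 / 2" using reduction[OF z] .
  define w where "w = mob B z"
  have w: "w \<in> UHP" "w \<in> strip" "Im w \<ge> sqrt 3 / 2" using B z by (auto simp: w_def)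
  have im: "Im w > 1/2" using w(3) half_less_sqrt3 by linarith
  then have sub: "zstab w \<subseteq> to_strip w" using w by (auto simp: zstab_def to_strip_def)
  have fin: "finite (zstab w)" using finite_to_strip[OF w(1)] sub finite_subset by blast
  have "bottom_row ` zstab w \<subseteq> {-1..1} \<times> {-2..2}"
  proof
    fix x assume "x \<in> bottom_row ` zstab w"
    then obtain A where A: "A \<in> SL2Z" "mob A w = w" "x = bottom_row A" by (auto simp: zstab_def)
    obtain a b c d where m: "A = imat a b c d" using A SL2Z_E by metis
    have "Im w = Im w / (norm (autfac A w))\<^sup>2" using Im_mob[of A w] A w SL2Z_det by simp
    moreover have "Im w > 0" using w by (simp add: UHP_def)
    ultimately have "(norm (autfac A w))\<^sup>2 = 1"
      by (metis div_by_1 divide_cancel_left less_irrefl)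
    then have "(c * Re w + d)\<^sup>2 + (c * Im w)\<^sup>2 = 1" by (simp add: m autfac_imat cmod_power2)
    then have "(c * Im w)\<^sup>2 \<le> 1" and "(c * Re w + d)\<^sup>2 \<le> 1" by (smt (verit) zero_le_power2)+
    then have ci: "\<bar>c * Im w\<bar> \<le> 1" and d: "\<bar>c * Re w + d\<bar> \<le> 1" by (simp_all add: abs_square_le_1)
    have "\<bar>real_of_int c\<bar> < 2"
    proof (rule ccontr)
      assume "\<not> \<bar>real_of_int c\<bar> < 2"
      then have "2 * (1/2) < \<bar>real_of_int c\<bar> * Im w"
        using im by (intro mult_le_less_imp_less) auto
      then show False using ci w by (simp add: abs_mult UHP_def)
    qed
    then have c: "\<bar>c\<bar> \<le> 1" by linarith
    have "\<bar>real_of_int c\<bar> * \<bar>Re w\<bar> \<le> 1 * 1"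
      using c w(2) by (intro mult_mono) (auto simp: strip_def)
    with d have "\<bar>real_of_int d\<bar> \<le> 2" by (simp flip: abs_mult)
    then have "\<bar>d\<bar> \<le> 2" by linarith
    with c show "x \<in> {-1..1} \<times> {-2..2}" using A m by auto
  qed
  then have "card (bottom_row ` zstab w) \<le> card ({-1..1::int} \<times> {-2..2::int})" by (intro card_mono) auto
  moreover have "inj_on bottom_row (zstab w)"
    using bij_betw_bottom_row[OF w(1)] sub by (meson bij_betw_imp_inj_on inj_on_subset)
  ultimately have le: "card (zstab w) \<le> 15" by (simp add: card_image)
  show "finite (zstab z)" using fin zstab_conj[OF B(1) z] bij_betw_finite w_def by metis
  show "card (zstab z) \<le> 15" using le card_zstab_mob[OF B(1) z] by (simp add: w_def)
  have "mat 1 \<in> zstab z" by (simp add: zstab_def)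
  with \<open>finite (zstab z)\<close> show "card (zstab z) > 0" using card_gt_0_iff by blast
qed

definition strip_orbit :: "complex \<Rightarrow> complex set" where
  "strip_orbit z = {w \<in> strip. Im w > 1/2 \<and> (\<exists>A\<in>SL2Z. w = mob A z)}"

text \<open>By the bijection with bottom rows, \<open>height_sum z\<close> is half the sum of \<open>Im w - 1/2\<close> over the points \<open>w\<close> of the
  orbit of \<open>z\<close> in the strip with \<open>Im w > 1/2\<close>, each counted with the order of the stabiliser. Dividing by it
  yields a continuous weight whose sum over the orbit has bounded denominator, so no fundamental domain and
  no boundary contributions are needed.\<close>

definition height_sum :: "complex \<Rightarrow> real" where
  "height_sum z = (\<Sum>(c,d)\<in>bottom_rows z. (Im z / (norm (of_int c * z + of_int d))\<^sup>2 - 1/2)) / 2"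

definition orbit_weight :: "complex \<Rightarrow> real" where
  "orbit_weight z = max 0 (Im z - 1/2) / height_sum z"

lemma strip_orbit_eq: "strip_orbit z = (\<lambda>A. mob A z) ` to_strip z"
  by (auto simp: strip_orbit_def to_strip_def)

lemma finite_strip_orbit: "z \<in> UHP \<Longrightarrow> finite (strip_orbit z)"
  by (simp add: strip_orbit_eq finite_to_strip)

lemma strip_orbit_nonempty: assumes "z \<in> UHP" shows "strip_orbit z \<noteq> {}"
proof -
  obtain A where A: "A \<in> SL2Z" "mob A z \<in> strip" "Im (mob A z) \<ge> sqrt 3 / 2"
    using reduction[OF assms] .
  moreover from this have "Im (mob A z) > 1/2" using half_less_sqrt3 by linarith
  ultimately have "mob A z \<in> strip_orbit z" unfolding strip_orbit_def by blast
  then show ?thesis by blast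
qed

lemma strip_orbit_mob: assumes "A \<in> SL2Z" "z \<in> UHP" shows "strip_orbit (mob A z) = strip_orbit z"
proof -
  have "strip_orbit (mob B w) \<subseteq> strip_orbit w" if "B \<in> SL2Z" "w \<in> UHP" for B w
  proof
    fix x assume "x \<in> strip_orbit (mob B w)"
    then obtain A where "A \<in> SL2Z" "x = mob A (mob B w)" "x \<in> strip" "Im x > 1/2" by (auto simp: strip_orbit_def)
    moreover from this have "x = mob (A ** B) w" "A ** B \<in> SL2Z" using that by (simp_all add: mob_SL2Z_mult)
    ultimately show "x \<in> strip_orbit w" unfolding strip_orbit_def by blast
  qed
  from this[of A z] this[of "matrix_inv A" "mob A z"] show ?thesis
    using assms mob_inv_cancel by (auto simp: SL2Z_inv)
qed

text \<open>Lower rows correspond to matrices in \<open>to_strip z\<close>, and sorting these by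
  image point gives one coset of the stabiliser for each point of \<open>strip_orbit z\<close>. The
  right-hand side depends only on the orbit, which makes \<open>height_sum\<close>
  invariant.\<close>

lemma height_sum_strip_orbit:
  assumes z: "z \<in> UHP"
  shows "2 * height_sum z = card (zstab z) * (\<Sum>w\<in>strip_orbit z. Im w - 1/2)"
proof -
  have "2 * height_sum z = (\<Sum>(c,d)\<in>bottom_rows z. (Im z / (norm (of_int c * z + of_int d))\<^sup>2 - 1/2))"
    by (simp add: height_sum_def)
  also have "\<dots> = (\<Sum>A\<in>to_strip z. Im (mob A z) - 1/2)"
    unfolding sum.reindex_bij_betw[OF bij_betw_bottom_row[OF z], symmetric]
  proof (rule sum.cong[OF refl])
    fix A assume A: "A \<in> to_strip z"
    then have "A \<in> SL2Z" by (simp add: to_strip_def)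
    then obtain a b c d where m: "A = imat a b c d" "det A = 1" by (metis SL2Z_E SL2Z_det)
    show "(case bottom_row A of (c, d) \<Rightarrow> Im z / (norm (of_int c * z + of_int d))\<^sup>2 - 1/2) = Im (mob A z) - 1/2"
      using Im_mob[OF m(2) z] by (simp add: m autfac_imat)
  qed
  also have "\<dots> = (\<Sum>w\<in>strip_orbit z. \<Sum>A\<in>{A\<in>to_strip z. mob A z = w}. Im (mob A z) - 1/2)"
    unfolding strip_orbit_eq using finite_to_strip[OF z] by (rule sum.image_gen)
  also have "\<dots> = (\<Sum>w\<in>strip_orbit z. card (zstab z) * (Im w - 1/2))"
  proof (rule sum.cong[OF refl])
    fix w assume w: "w \<in> strip_orbit z"
    then obtain B where B: "B \<in> SL2Z" "w = mob B z" by (auto simp: strip_orbit_def)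
    have "{A\<in>to_strip z. mob A z = w} = {A\<in>SL2Z. mob A z = mob B z}"
      using w B by (auto simp: to_strip_def strip_orbit_def)
    then have "card {A\<in>to_strip z. mob A z = w} = card (zstab z)"
      using bij_betw_same_card[OF zstab_transport[OF B(1) z]] by simp
    moreover have "(\<Sum>A\<in>{A\<in>to_strip z. mob A z = w}. Im (mob A z) - 1/2) = (\<Sum>A\<in>{A\<in>to_strip z. mob A z = w}. Im w - 1/2)"
      by (rule sum.cong) auto
    ultimately show "(\<Sum>A\<in>{A\<in>to_strip z. mob A z = w}. Im (mob A z) - 1/2) = card (zstab z) * (Im w - 1/2)"
      by simp
  qed
  finally show ?thesis by (simp add: sum_distrib_left)
qed

lemma height_sum_pos: assumes z: "z \<in> UHP" shows "height_sum z > 0"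
proof -
  have "(\<Sum>w\<in>strip_orbit z. Im w - 1/2) > 0"
    using finite_strip_orbit[OF z] strip_orbit_nonempty[OF z] by (intro sum_pos) (auto simp: strip_orbit_def)
  then have "2 * height_sum z > 0" using height_sum_strip_orbit[OF z] finite_zstab_bound[OF z] by simp
  then show ?thesis by simp
qed

lemma height_sum_mob: "A \<in> SL2Z \<Longrightarrow> z \<in> UHP \<Longrightarrow> height_sum (mob A z) = height_sum z"
  using height_sum_strip_orbit[of z] height_sum_strip_orbit[of "mob A z"] by (simp add: card_zstab_mob strip_orbit_mob)

text \<open>The factor 2 comes from the halving in \<open>height_sum\<close>. Since minus the
  identity stabilises every point, the value is the reciprocal of the order of the stabiliser in
  PSL2(Z), the weight of a point in the degree for the full modular group.\<close>

lemma sum_orbit_weight_strip_orbit: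
  assumes z: "z \<in> UHP" shows "(\<Sum>w\<in>strip_orbit z. orbit_weight w) = 2 / card (zstab z)"
proof -
  have "(\<Sum>w\<in>strip_orbit z. orbit_weight w) = (\<Sum>w\<in>strip_orbit z. (Im w - 1/2) / height_sum z)"
  proof (rule sum.cong[OF refl])
    fix w assume w: "w \<in> strip_orbit z"
    then have "height_sum w = height_sum z" using height_sum_mob z by (auto simp: strip_orbit_def)
    then show "orbit_weight w = (Im w - 1/2) / height_sum z" using w by (simp add: orbit_weight_def strip_orbit_def)
  qed
  also have "\<dots> = (\<Sum>w\<in>strip_orbit z. Im w - 1/2) / height_sum z" by (simp add: sum_divide_distrib)
  also have "\<dots> = 2 / card (zstab z)"
    using height_sum_strip_orbit[OF z] height_sum_pos[OF z] finite_zstab_bound(3)[OF z] by (simp add: field_simps)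
  finally show ?thesis .
qed

lemma orbit_weight_eq_0: "Im z \<le> 1/2 \<Longrightarrow> orbit_weight z = 0"
  by (simp add: orbit_weight_def)

text \<open>Above height 2 a row with nonzero \<open>c\<close> gives a modulus of at least
  \<open>Im z\<close>, whose square is at least \<open>2 * Im z\<close>; only \<open>(0, 1)\<close>
  and \<open>(0, -1)\<close> remain. The halving in \<open>height_sum\<close> compensates for this
  pair, so that the weight tends to 1 at the cusp.\<close>

lemma orbit_weight_eq_1: assumes "Im z > 2" shows "orbit_weight z = 1"
proof -
  have "bottom_rows z = {(0,1), (0,-1)}"
  proof (intro equalityI subsetI)
    fix x assume "x \<in> bottom_rows z"
    then obtain c d where x: "x = (c,d)" "coprime c d" "(norm (of_int c * z + of_int d))\<^sup>2 < 2 * Im z"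
      by (auto simp: bottom_rows_def)
    have "c = 0"
    proof (rule ccontr)
      assume "c \<noteq> 0"
      then have "1 \<le> \<bar>real_of_int c\<bar>" by linarith
      then have "1 * Im z \<le> \<bar>real_of_int c\<bar> * Im z" using assms by (intro mult_right_mono) auto
      also have "\<dots> \<le> norm (of_int c * z + of_int d)"
        using abs_Im_le_cmod[of "of_int c * z + of_int d"] assms by (simp add: abs_mult)
      finally have "(Im z)\<^sup>2 \<le> (norm (of_int c * z + of_int d))\<^sup>2" using assms by (intro power_mono) auto
      moreover have "2 * Im z \<le> (Im z)\<^sup>2" using assms by (simp add: power2_eq_square)
      ultimately show False using x by simp
    qed
    then show "x \<in> {(0,1), (0,-1)}" using x by auto
  qed (use assms in \<open>auto simp: bottom_rows_def\<close>)
  then show ?thesis using assms by (simp add: orbit_weight_def height_sum_def)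
qed

section \<open>Weighted zeros and poles of a meromorphic function on the unit disc\<close>

lemma finite_zorder_nonzero_compact:
  assumes h: "h meromorphic_on S" and nz: "\<And>z. z \<in> S \<Longrightarrow> eventually (\<lambda>w. h w \<noteq> 0) (at z)"
    and K: "compact K" "K \<subseteq> S"
  shows "finite {z\<in>K. zorder h z \<noteq> 0}"
proof -
  have "eventually (\<lambda>z. \<not> isolated_zero h z \<and> \<not> is_pole h z) (cosparse S)"
    by (intro eventually_conj meromorphic_on_imp_not_zero_cosparse meromorphic_on_imp_not_pole_cosparse h)
  then have "{z. \<not> (\<not> isolated_zero h z \<and> \<not> is_pole h z)} sparse_in S"
    by (simp add: eventually_cosparse)
  then have "{z. \<not> (\<not> isolated_zero h z \<and> \<not> is_pole h z)} sparse_in K"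
    using K(2) by (rule sparse_in_subset)
  then have fin: "finite (K \<inter> {z. \<not> (\<not> isolated_zero h z \<and> \<not> is_pole h z)})"
    using K(1) by (rule sparse_in_compact_finite)
  have "zorder h z = 0" if z: "z \<in> K" "\<not> isolated_zero h z" "\<not> is_pole h z" for z
  proof (rule not_pole_not_isolated_zero_imp_zorder_eq_0)
    show "h meromorphic_on {z}" using h z K meromorphic_on_subset by blast
    show "frequently (\<lambda>w. h w \<noteq> 0) (at z)"
      using nz[of z] z K eventually_frequently[OF at_neq_bot] by blast
  qed (use z in auto)
  then show ?thesis by (intro finite_subset[OF _ fin]) auto
qed

lemma integer_valued_continuous_const:
  fixes N :: "real \<Rightarrow> real"
  assumes "continuous_on {0..1} N" "M > 0" "\<And>t. t \<in> {0..1} \<Longrightarrow> real M * N t \<in> \<int>"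
  shows "N 0 = N 1"
proof -
  have "N constant_on {0..1}"
  proof (rule continuous_discrete_range_constant)
    fix x assume x: "x \<in> {0..1::real}"
    show "\<exists>e>0. \<forall>y. y \<in> {0..1} \<and> N y \<noteq> N x \<longrightarrow> e \<le> norm (N y - N x)"
    proof (rule exI[of _ "1 / real M"], intro conjI allI impI)
      fix y assume y: "y \<in> {0..1} \<and> N y \<noteq> N x"
      have "real M * N y - real M * N x \<in> \<int>" using assms(3)[of y] assms(3)[of x] x y by auto
      moreover have "real M * N y - real M * N x \<noteq> 0" using y assms(2) by auto
      ultimately have "1 \<le> \<bar>real M * N y - real M * N x\<bar>" by (rule Ints_nonzero_abs_ge1)
      also have "\<dots> = real M * \<bar>N y - N x\<bar>" by (simp add: right_diff_distrib[symmetric] abs_mult)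
      finally show "1 / real M \<le> norm (N y - N x)" using assms(2) by (simp add: field_simps)
    qed (use assms in auto)
  qed (use assms in auto)
  then show ?thesis unfolding constant_on_def by force
qed

text \<open>Writing \<open>H = A / B\<close> with holomorphic \<open>A\<close> and \<open>B\<close> without common zeros, the zeros of \<open>(1 - t) A + t B\<close> are
  the zeros of \<open>H + t / (1 - t)\<close> for \<open>t < 1\<close> and the poles of \<open>H\<close> for \<open>t = 1\<close>. Their weighted number is continuous
  in \<open>t\<close> and takes values in a discrete set.\<close>

lemma weighted_degree_zero_disc:
  fixes H :: "complex \<Rightarrow> complex" and \<Psi> :: "complex \<Rightarrow> real"
  assumes mero: "H nicely_meromorphic_on ball 0 1"
    and nconst: "\<not> H constant_on ball 0 1"
    and cont: "continuous_on (ball 0 1) \<Psi>"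
    and r: "0 < r" "r < 1"
    and supp: "\<And>q. q \<in> ball 0 1 \<Longrightarrow> q \<notin> cball 0 r \<Longrightarrow> \<Psi> q = 0"
    and M: "M > 0"
    and zeros_int: "\<And>c::real. c \<ge> 0 \<Longrightarrow> real M * (\<Sum>q\<in>{q\<in>cball 0 r. zorder (\<lambda>z. H z + of_real c) q > 0}.
            real_of_int (zorder (\<lambda>z. H z + of_real c) q) * \<Psi> q) \<in> \<int>"
    and poles_int: "real M * (\<Sum>q\<in>{q\<in>cball 0 r. zorder H q < 0}. real_of_int (- zorder H q) * \<Psi> q) \<in> \<int>"
  shows "finite {q\<in>cball 0 r. zorder H q \<noteq> 0}"
    and "(\<Sum>q\<in>{q\<in>cball 0 r. zorder H q \<noteq> 0}. real_of_int (zorder H q) * \<Psi> q) = 0"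
proof -
  \<comment> \<open>A slightly larger disc whose closure still lies in the unit disc: zeros and
    poles of \<open>H\<close> cannot accumulate on its frontier, as the Weierstrass factorisation
    requires.\<close>
  define r1 where "r1 = (r + 1) / 2"
  have r1: "r < r1" "r1 < 1" "0 < r1" using r by (auto simp: r1_def)
  define S where "S = ball (0::complex) r1"
  have S: "open S" "connected S" "S \<subseteq> ball 0 1" "cball 0 r \<subseteq> S" "S \<noteq> {}" using r1 by (auto simp: S_def)
  have merom: "H meromorphic_on ball 0 1" using mero by (simp add: nicely_meromorphic_on_def)
  have mat: "H meromorphic_on {q}" if "q \<in> ball 0 1" for q
    using merom that meromorphic_on_subset by blast
  have ev: "eventually (\<lambda>w. H w + c \<noteq> 0) (at q)" if "q \<in> ball 0 1" for q c
  proof -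
    have "(\<forall>x\<in>ball 0 1. H x = -c) \<or> (\<forall>\<^sub>\<approx>x\<in>ball 0 1. H x \<noteq> -c)"
      by (rule nicely_meromorphic_imp_constant_or_avoid[OF mero]) auto
    moreover have "\<not> (\<forall>x\<in>ball 0 1. H x = -c)" using nconst by (auto simp: constant_on_def)
    ultimately have "\<forall>\<^sub>\<approx>x\<in>ball 0 1. H x \<noteq> -c" by blast
    then have "eventually (\<lambda>w. H w \<noteq> -c) (at q)"
      by (rule eventually_cosparse_imp_eventually_at) (use that in auto)
    then show ?thesis by eventually_elim (auto simp: add_eq_0_iff)
  qed
  have freq: "frequently (\<lambda>w. H w + c \<noteq> 0) (at q)" if "q \<in> ball 0 1" for q c
    using ev[OF that] eventually_frequently[OF at_neq_bot] by blast
  have ev0: "eventually (\<lambda>w. H w \<noteq> 0) (at q)" if "q \<in> ball 0 1" for q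
    using ev[OF that, of 0] by simp
  have nopole: "eventually (\<lambda>w. \<not> is_pole H w) (at q)" if "q \<in> ball 0 1" for q
    using mat[OF that] eventually_not_pole by (simp add: meromorphic_at_iff)
  obtain h f1 f2 where h: "h holomorphic_on S" and f12: "f1 holomorphic_on UNIV" "f2 holomorphic_on UNIV"
    and f2z: "\<forall>z\<in>S. f2 z = 0 \<longleftrightarrow> is_pole H z"
    and f2o: "\<forall>z\<in>S. is_pole H z \<longrightarrow> zorder f2 z = - zorder H z"
    and Heq: "\<forall>z\<in>S. H z = h z * f1 z / f2 z"
  proof (rule weierstrass_factorization_meromorphic[of H S])
    show "H nicely_meromorphic_on S" using mero S nicely_meromorphic_on_subset by blast
    fix z assume "z \<in> frontier S"
    then have z: "z \<in> ball 0 1" using r1 by (auto simp: S_def)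
    have "eventually (\<lambda>w. w \<notin> {w\<in>S. H w = 0 \<or> is_pole H w}) (at z)"
      using ev0[OF z] nopole[OF z] by eventually_elim auto
    then show "\<not> z islimpt {w\<in>S. H w = 0 \<or> is_pole H w}"
      by (simp add: islimpt_iff_eventually)
  qed (use S in auto)
  define A where "A z = h z * f1 z" for z
  define B where "B = f2"
  have Ah: "A holomorphic_on S" unfolding A_def
    using h f12 by (intro holomorphic_intros) (auto intro: holomorphic_on_subset)
  have Bh: "B holomorphic_on S" unfolding B_def using f12 holomorphic_on_subset by blast
  have Bana: "B analytic_on {q}" for q unfolding B_def
    using f12(2) analytic_at by blast
  have Bev: "eventually (\<lambda>w. B w \<noteq> 0) (at q)" if q: "q \<in> S" for q
  proof -
    have "eventually (\<lambda>w. w \<in> S) (at q)" using S q by (intro eventually_at_in_open') auto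
    have "eventually (\<lambda>w. \<not> is_pole H w) (at q)" using S q by (intro nopole) auto
    with \<open>eventually (\<lambda>w. w \<in> S) (at q)\<close> show ?thesis
      by eventually_elim (use f2z in \<open>auto simp: B_def\<close>)
  qed
  have Bfreq: "frequently (\<lambda>w. B w \<noteq> 0) (at q)" if q: "q \<in> S" for q
    using Bev[OF that] eventually_frequently[OF at_neq_bot] by blast
  have ABana: "(\<lambda>w. A w + of_real c * B w) analytic_on {q}" if "q \<in> S" for q and c :: real
  proof -
    have "(\<lambda>w. A w + of_real c * B w) holomorphic_on S" by (intro holomorphic_intros Ah Bh)
    then show ?thesis using S that analytic_at by blast
  qed
  have u_ev: "eventually (\<lambda>w. A w + of_real c * B w = B w * (H w + of_real c)) (at q)"
    if q: "q \<in> S" for q and c :: real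
  proof -
    have "eventually (\<lambda>w. w \<in> S) (at q)" using S q by (intro eventually_at_in_open') auto
    with Bev[OF q] show ?thesis
      by eventually_elim (use Heq in \<open>auto simp: A_def B_def field_simps\<close>)
  qed
  have u_nz: "eventually (\<lambda>w. A w + of_real c * B w \<noteq> 0) (at q)"
    if q: "q \<in> S" for q and c :: real
  proof -
    have "q \<in> ball 0 1" using S q by auto
    from u_ev[OF q, of c] Bev[OF q] ev[OF this, of "of_real c"] show ?thesis
      by eventually_elim auto
  qed
  have u_freq: "frequently (\<lambda>w. A w + of_real c * B w \<noteq> 0) (at q)"
    if q: "q \<in> S" for q and c :: real
    using u_nz[OF that] eventually_frequently[OF at_neq_bot] by blast
  \<comment> \<open>At a pole of \<open>H\<close> the zero of \<open>B\<close> cancels it exactly,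
    giving order 0; elsewhere \<open>B\<close> does not vanish and the order is that of
    \<open>H\<close> plus the constant, which is then nonnegative.\<close>
  have zord: "zorder (\<lambda>w. A w + of_real c * B w) q = max 0 (zorder (\<lambda>z. H z + of_real c) q)"
    if q: "q \<in> S" for q and c :: real
  proof -
    have qb: "q \<in> ball 0 1" using S q by auto
    have Hc: "(\<lambda>z. H z + of_real c) meromorphic_on {q}"
      by (intro meromorphic_intros mat qb)
    have "zorder (\<lambda>w. A w + of_real c * B w) q = zorder (\<lambda>w. B w * (H w + of_real c)) q"
      by (rule zorder_cong[OF u_ev[OF q] refl])
    also have "\<dots> = zorder B q + zorder (\<lambda>w. H w + of_real c) q"
      using Bana Bfreq[OF q] Hc freq[OF qb] by (intro zorder_mult analytic_on_imp_meromorphic_on[of B]) auto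
    finally have eq: "zorder (\<lambda>w. A w + of_real c * B w) q = \<dots>" .
    show ?thesis
    proof (cases "is_pole H q")
      case True
      have neg: "zorder H q < 0"
        using isolated_pole_imp_neg_zorder[OF _ True] mat[OF qb] by (simp add: meromorphic_at_iff)
      have "zorder (\<lambda>w. H w + of_real c) q = zorder H q"
      proof (cases "c = 0")
        case False
        show ?thesis
          by (rule zorder_add1)
             (use mat[OF qb] freq[OF qb, of 0] neg False in \<open>auto intro!: meromorphic_intros\<close>)
      qed auto
      moreover have "zorder B q = - zorder H q" using f2o q True by (simp add: B_def)
      ultimately show ?thesis using eq neg by simp
    next
      case False
      then have "B q \<noteq> 0" using f2z q by (simp add: B_def)
      then have "zorder B q = 0" using Bana zorder_eq_0I by blast
      moreover have "(\<lambda>w. H w + of_real c) analytic_on {q}"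
        using nicely_meromorphic_on_imp_analytic_at[OF mero qb False] by (intro analytic_intros)
      then have "zorder (\<lambda>w. H w + of_real c) q \<ge> 0" using zorder_ge_0 freq[OF qb] by blast
      ultimately show ?thesis using eq by simp
    qed
  qed
  have zordB: "zorder B q = max 0 (- zorder H q)" if q: "q \<in> S" for q
  proof (cases "is_pole H q")
    case True
    have qb: "q \<in> ball 0 1" using S q by auto
    have neg: "zorder H q < 0"
      using isolated_pole_imp_neg_zorder[OF _ True] mat[OF qb] by (simp add: meromorphic_at_iff)
    then show ?thesis using f2o q True by (simp add: B_def)
  next
    case False
    have qb: "q \<in> ball 0 1" using S q by auto
    have "B q \<noteq> 0" using f2z q False by (simp add: B_def)
    then have "zorder B q = 0" using Bana zorder_eq_0I by blast
    moreover have "zorder H q \<ge> 0"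
      using nicely_meromorphic_on_imp_analytic_at[OF mero qb False] zorder_ge_0 freq[OF qb, of 0] by auto
    ultimately show ?thesis by simp
  qed
  define u where "u = (\<lambda>(t::real) z. (1 - of_real t) * A z + of_real t * B z)"
  have u_eq: "u t = (\<lambda>z. (1 - of_real t) * (A z + of_real (t / (1 - t)) * B z))" if "t < 1" for t
  proof -
    have "1 - complex_of_real t \<noteq> 0" using that by (metis eq_iff_diff_eq_0 less_irrefl of_real_eq_1_iff)
    then show ?thesis unfolding u_def by (auto simp: fun_eq_iff field_simps)
  qed
  have u1: "u 1 = B" by (auto simp: u_def)
  define N where "N t = (\<Sum>z\<in>{z\<in>cball 0 r. u t z = 0}. real_of_int (zorder (u t) z) * \<Psi> z)" for t
  have "continuous_on {0..1} N"
    unfolding N_def u_def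
  proof (rule continuous_on_weighted_zero_count[OF Ah Bh S(1,2) compact_cball S(4)])
    show "continuous_on S \<Psi>" using cont S continuous_on_subset by blast
    show "\<Psi> z = 0" if "z \<in> S" "z \<notin> cball 0 r" for z using supp that S by auto
    fix t :: real assume t: "t \<in> {0..1}"
    have "0 \<in> S" using r1 by (auto simp: S_def)
    show "\<exists>z\<in>S. (1 - of_real t) * A z + of_real t * B z \<noteq> 0"
    proof (cases "t = 1")
      case True
      have "eventually (\<lambda>w. B w \<noteq> 0 \<and> w \<in> S) (at 0)"
        using Bev[OF \<open>0 \<in> S\<close>] S \<open>0 \<in> S\<close> by (intro eventually_conj eventually_at_in_open') auto
      then obtain w where "B w \<noteq> 0" "w \<in> S" using eventually_happens'[OF at_neq_bot] by blast
      then show ?thesis using True by auto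
    next
      case False
      then have t1: "t < 1" using t by auto
      have "eventually (\<lambda>w. A w + of_real (t / (1 - t)) * B w \<noteq> 0 \<and> w \<in> S) (at 0)"
        using S \<open>0 \<in> S\<close> by (intro eventually_conj eventually_at_in_open' u_nz) auto
      then obtain w where w: "A w + of_real (t / (1 - t)) * B w \<noteq> 0" "w \<in> S"
        using eventually_happens'[OF at_neq_bot] by blast
      moreover have "1 - complex_of_real t \<noteq> 0" using t1 by (metis eq_iff_diff_eq_0 less_irrefl of_real_eq_1_iff)
      ultimately have "u t w \<noteq> 0" using u_eq[OF t1] by simp
      then show ?thesis using w by (auto simp: u_def)
    qed
  qed
  have N_lt: "N t = (\<Sum>q\<in>{q\<in>cball 0 r. zorder (\<lambda>z. H z + of_real (t / (1 - t))) q > 0}.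
            real_of_int (zorder (\<lambda>z. H z + of_real (t / (1 - t))) q) * \<Psi> q)" if t: "t < 1" for t
  proof -
    have nz: "1 - complex_of_real t \<noteq> 0" using t by (metis eq_iff_diff_eq_0 less_irrefl of_real_eq_1_iff)
    have z1: "zorder (u t) q = max 0 (zorder (\<lambda>z. H z + of_real (t / (1 - t))) q)" if q: "q \<in> S" for q
      unfolding u_eq[OF t] using zorder_cmult[OF nz] zord[OF q, of "t / (1 - t)"] by simp
    have z2: "u t q = 0 \<longleftrightarrow> zorder (\<lambda>z. H z + of_real (t / (1 - t))) q > 0" if q: "q \<in> S" for q
    proof -
      have "u t q = 0 \<longleftrightarrow> A q + of_real (t / (1 - t)) * B q = 0" unfolding u_eq[OF t] using nz by simp
      also have "\<dots> \<longleftrightarrow> zorder (\<lambda>w. A w + of_real (t / (1 - t)) * B w) q > 0"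
        by (rule zorder_pos_iff'[OF ABana[OF q] u_freq[OF q], symmetric])
      finally show ?thesis unfolding zord[OF q] by (simp add: less_max_iff_disj)
    qed
    show ?thesis unfolding N_def
      by (rule sum.cong) (use S z1 z2 in \<open>auto simp: subset_iff\<close>)
  qed
  have N1: "N 1 = (\<Sum>q\<in>{q\<in>cball 0 r. zorder H q < 0}. real_of_int (- zorder H q) * \<Psi> q)"
  proof -
    have "B q = 0 \<longleftrightarrow> zorder H q < 0" if q: "q \<in> S" for q
      using zorder_pos_iff'[OF Bana Bfreq[OF q]] zordB[OF q] by auto
    then show ?thesis unfolding N_def u1
      by (intro sum.cong) (use S zordB in \<open>auto simp: subset_iff\<close>)
  qed
  have "N 0 = N 1"
  proof (rule integer_valued_continuous_const[OF \<open>continuous_on {0..1} N\<close> M])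
    fix t :: real assume t: "t \<in> {0..1}"
    show "real M * N t \<in> \<int>"
    proof (cases "t = 1")
      case True then show ?thesis using N1 poles_int by simp
    next
      case False
      then have "t < 1" "t / (1 - t) \<ge> 0" using t by auto
      then show ?thesis unfolding N_lt[OF \<open>t < 1\<close>] by (intro zeros_int)
    qed
  qed
  have N0: "N 0 = (\<Sum>q\<in>{q\<in>cball 0 r. zorder H q > 0}. real_of_int (zorder H q) * \<Psi> q)"
    using N_lt[of 0] by simp
  have finP: "finite {q\<in>cball 0 r. zorder H q > 0}"
  proof (rule finite_subset)
    show "{q\<in>cball 0 r. zorder H q > 0} \<subseteq> {q\<in>cball 0 r. A q + of_real 0 * B q = 0}"
    proof safe
      fix q assume q: "q \<in> cball 0 r" "zorder H q > 0"
      then have qS: "q \<in> S" using S by blast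
      have "zorder (\<lambda>w. A w + of_real 0 * B w) q > 0" using zord[OF qS, of 0] q by simp
      then show "A q + of_real 0 * B q = 0" using zorder_pos_iff'[OF ABana[OF qS] u_freq[OF qS]] by blast
    qed
    have "\<exists>z\<in>S. A z + of_real 0 * B z \<noteq> 0"
    proof -
      have "0 \<in> S" using r1 by (auto simp: S_def)
      have "eventually (\<lambda>w. A w + of_real 0 * B w \<noteq> 0 \<and> w \<in> S) (at 0)"
        using S \<open>0 \<in> S\<close> by (intro eventually_conj eventually_at_in_open' u_nz) auto
      then show ?thesis using eventually_happens'[OF at_neq_bot] by blast
    qed
    then show "finite {q\<in>cball 0 r. A q + of_real 0 * B q = 0}"
      by (intro finite_zeros_compact[of _ S] S compact_cball holomorphic_intros Ah Bh)
  qed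
  have finN: "finite {q\<in>cball 0 r. zorder H q < 0}"
  proof (rule finite_subset)
    show "{q\<in>cball 0 r. zorder H q < 0} \<subseteq> {q\<in>cball 0 r. B q = 0}"
    proof safe
      fix q assume q: "q \<in> cball 0 r" "zorder H q < 0"
      then have qS: "q \<in> S" using S by blast
      have "zorder B q > 0" using zordB[OF qS] q by simp
      then show "B q = 0" using zorder_pos_iff'[OF Bana Bfreq[OF qS]] by blast
    qed
    have "\<exists>z\<in>S. B z \<noteq> 0"
    proof -
      have "0 \<in> S" using r1 by (auto simp: S_def)
      have "eventually (\<lambda>w. B w \<noteq> 0 \<and> w \<in> S) (at 0)"
        using Bev[OF \<open>0 \<in> S\<close>] S \<open>0 \<in> S\<close> by (intro eventually_conj eventually_at_in_open') auto
      then show ?thesis using eventually_happens'[OF at_neq_bot] by blast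
    qed
    then show "finite {q\<in>cball 0 r. B q = 0}"
      by (intro finite_zeros_compact[of _ S] S compact_cball Bh)
  qed
  have un: "{q\<in>cball 0 r. zorder H q \<noteq> 0} = {q\<in>cball 0 r. zorder H q > 0} \<union> {q\<in>cball 0 r. zorder H q < 0}"
    by auto
  show "finite {q\<in>cball 0 r. zorder H q \<noteq> 0}" unfolding un using finP finN by simp
  \<comment> \<open>\<open>N 0\<close> counts the zeros and \<open>N 1\<close> the poles, both with
    positive multiplicity, so the signed total is their difference.\<close>
  have "(\<Sum>q\<in>{q\<in>cball 0 r. zorder H q \<noteq> 0}. real_of_int (zorder H q) * \<Psi> q) = N 0 - N 1"
    unfolding un N0 N1 using finP finN by (subst sum.union_disjoint) (auto simp: sum_negf)
  then show "(\<Sum>q\<in>{q\<in>cball 0 r. zorder H q \<noteq> 0}. real_of_int (zorder H q) * \<Psi> q) = 0"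
    using \<open>N 0 = N 1\<close> by simp
qed

text \<open>The index set \<open>bottom_rows z\<close> varies with \<open>z\<close>. Near
  \<open>z0\<close> it stays inside one finite set \<open>X\<close>, and replacing each term by its
  positive part makes exactly the rows outside \<open>bottom_rows z\<close> contribute 0. A row thus
  enters or leaves the sum with the value 0, and locally \<open>height_sum\<close> is a fixed finite
  sum of continuous functions.\<close>

lemma continuous_on_height_sum: "continuous_on UHP height_sum"
  unfolding continuous_on_eq_continuous_at[OF open_UHP]
proof
  fix z0 assume z0: "z0 \<in> UHP"
  then have y0: "Im z0 > 0" by (simp add: UHP_def)
  define C where "C = \<lceil>2 / (Im z0 / 2) + 1\<rceil>"
  define D where "D = \<lceil>(2 / (Im z0 / 2) + 1) * (\<bar>Re z0\<bar> + 1) + 2 * (2 * Im z0) + 1\<rceil>"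
  define X where "X = {(c,d). coprime c d \<and> (c,d) \<in> {-C..C} \<times> {-D..D}}"
  have finX: "finite X" unfolding X_def by (rule finite_subset[of _ "{-C..C} \<times> {-D..D}"]) auto
  define F where "F z = (\<Sum>(c,d)\<in>X. max 0 (Im z / (norm (of_int c * z + of_int d))\<^sup>2 - 1/2)) / 2" for z
  define U where "U = {z. Im z > Im z0 / 2} \<inter> {z. Im z < 2 * Im z0} \<inter> {z. Re z < \<bar>Re z0\<bar> + 1} \<inter> {z. Re z > - (\<bar>Re z0\<bar> + 1)}"
  have U: "open U" unfolding U_def
    by (intro open_Int open_halfspace_Im_gt open_halfspace_Im_lt
        open_halfspace_Re_lt open_halfspace_Re_gt)
  have z0U: "z0 \<in> U" using y0 by (auto simp: U_def)
  have nz: "of_int c * z + of_int d \<noteq> 0" if "(c,d) \<in> X" "z \<in> U" for c d z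
  proof
    assume *: "of_int c * z + of_int d = 0"
    then have "Im (of_int c * z + of_int d) = 0" by simp
    then have "c = 0" using that y0 by (auto simp: U_def)
    with * have "d = 0" by simp
    with \<open>c = 0\<close> that show False by (simp add: X_def)
  qed
  have eq: "height_sum z = F z" if z: "z \<in> U" for z
  proof -
    have sub: "bottom_rows z \<subseteq> X"
    proof
      fix x assume "x \<in> bottom_rows z"
      then obtain c d where x: "x = (c,d)" "coprime c d" "(norm (of_int c * z + of_int d))\<^sup>2 < 2 * Im z"
        by (auto simp: bottom_rows_def)
      have "\<bar>c\<bar> \<le> C" "\<bar>d\<bar> \<le> D" unfolding C_def D_def
        using bottom_rows_bounded[of "Im z0 / 2" z "2 * Im z0" "\<bar>Re z0\<bar> + 1" c d] x z y0
        by (auto simp: U_def)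
      then show "x \<in> X" using x by (auto simp: X_def)
    qed
    have "(\<Sum>(c,d)\<in>bottom_rows z. (Im z / (norm (of_int c * z + of_int d))\<^sup>2 - 1/2))
        = (\<Sum>(c,d)\<in>X. max 0 (Im z / (norm (of_int c * z + of_int d))\<^sup>2 - 1/2))"
    proof (rule sum.mono_neutral_cong_left[OF finX sub])
      show "\<forall>i\<in>X - bottom_rows z. (case i of (c, d) \<Rightarrow> max 0 (Im z / (norm (of_int c * z + of_int d))\<^sup>2 - 1/2)) = 0"
      proof (safe, goal_cases)
        case (1 c d)
        then have "norm (of_int c * z + of_int d) \<noteq> 0" and "\<not> (norm (of_int c * z + of_int d))\<^sup>2 < 2 * Im z"
          using nz[OF _ z] by (auto simp: bottom_rows_def X_def)
        then have "Im z / (norm (of_int c * z + of_int d))\<^sup>2 \<le> 1/2"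
          by (simp add: divide_le_eq)
        then show ?case by simp
      qed
      fix x assume x: "x \<in> bottom_rows z"
      then obtain c d where cd: "x = (c,d)" "(norm (of_int c * z + of_int d))\<^sup>2 < 2 * Im z"
        by (auto simp: bottom_rows_def)
      have "norm (of_int c * z + of_int d) \<noteq> 0" using nz[OF _ z] x sub cd by auto
      then have "Im z / (norm (of_int c * z + of_int d))\<^sup>2 \<ge> 1/2" using cd by (simp add: le_divide_eq)
      then show "(case x of (c, d) \<Rightarrow> Im z / (norm (of_int c * z + of_int d))\<^sup>2 - 1/2)
          = (case x of (c, d) \<Rightarrow> max 0 (Im z / (norm (of_int c * z + of_int d))\<^sup>2 - 1/2))"
        using cd by simp
    qed
    then show ?thesis by (simp add: height_sum_def F_def)
  qed
  have "continuous_on U F"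
    unfolding F_def case_prod_unfold
    by (intro continuous_intros) (use nz in auto)
  then have "isCont F z0" using U z0U continuous_on_eq_continuous_at by blast
  moreover have "eventually (\<lambda>z. height_sum z = F z) (nhds z0)"
    using eventually_nhds_in_open[OF U z0U] by eventually_elim (rule eq)
  ultimately show "isCont height_sum z0" using isCont_cong by blast
qed

lemma continuous_on_orbit_weight: "continuous_on UHP orbit_weight"
  unfolding orbit_weight_def[abs_def]
  by (intro continuous_intros continuous_on_height_sum) (use height_sum_pos in force)

section \<open>The coordinate q = e(\<tau>) and the weight on the q-disc\<close>

lemma ee_norm: "norm (ee z) = exp (- 2 * pi * Im z)"
  by (simp add: ee_def norm_exp_eq_Re)

lemma ee_nz [simp]: "ee z \<noteq> 0" by (simp add: ee_def)

lemma ee_add: "ee (z + w) = ee z * ee w"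
  by (simp add: ee_def algebra_simps exp_add)

lemma ee_of_int [simp]: "ee (of_int n) = 1"
  using exp_integer_2pi[of "of_int n"] by (simp add: ee_def mult_ac)

lemma ee_eq_iff: "ee z = ee w \<longleftrightarrow> (\<exists>n. z = w + of_int n)"
proof
  assume "ee z = ee w"
  then obtain n::int where "2 * of_real pi * \<i> * z = 2 * of_real pi * \<i> * w + (of_int (2 * n) * pi) * \<i>"
    unfolding ee_def exp_eq by blast
  then have "2 * of_real pi * \<i> * z = 2 * of_real pi * \<i> * (w + of_int n)" by (simp add: algebra_simps)
  then have "z = w + of_int n" by simp
  then show "\<exists>n. z = w + of_int n" ..
qed (auto simp: ee_add)

lemma ee_holomorphic [holomorphic_intros]: "ee holomorphic_on S"
  unfolding ee_def[abs_def] by (intro holomorphic_intros)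

lemma norm_ee_less_1: "norm (ee z) < 1 \<longleftrightarrow> z \<in> UHP"
  by (auto simp: ee_norm UHP_def zero_less_mult_iff)

text \<open>Uses the principal logarithm and so jumps across the negative real axis; the functions
  composed with it have period 1 and do not see the jump.\<close>

definition qlift :: "complex \<Rightarrow> complex" where
  "qlift q = Ln q / (2 * of_real pi * \<i>)"

lemma ee_qlift: "q \<noteq> 0 \<Longrightarrow> ee (qlift q) = q"
  by (simp add: ee_def qlift_def)

lemma qlift_UHP: "q \<noteq> 0 \<Longrightarrow> norm q < 1 \<Longrightarrow> qlift q \<in> UHP"
  using norm_ee_less_1[of "qlift q"] by (simp add: ee_qlift)

lemma Im_qlift: assumes "q \<noteq> 0" shows "norm q = exp (- 2 * pi * Im (qlift q))"
  using ee_norm[of "qlift q"] assms by (simp add: ee_qlift)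

lemma periodic_qlift:
  assumes "\<And>z n. z \<in> UHP \<Longrightarrow> F (z + of_int n) = F z" "w \<in> UHP"
  shows "F (qlift (ee w)) = F w"
proof -
  have "ee (qlift (ee w)) = ee w" by (simp add: ee_qlift)
  then obtain n where "qlift (ee w) = w + of_int n" by (auto simp: ee_eq_iff)
  then show ?thesis using assms by simp
qed

text \<open>On the disc around \<open>q0\<close> of radius \<open>norm q0\<close> the quotient
  \<open>q / q0\<close> has positive real part, so its principal logarithm is holomorphic; adding
  \<open>qlift q0\<close> gives a local inverse of \<open>ee\<close>.\<close>

lemma qlift_local_branch:
  assumes "q0 \<noteq> 0" "norm q0 < 1"
  obtains U L where "open U" "q0 \<in> U" "U \<subseteq> ball 0 1 - {0}" "L holomorphic_on U"
    "\<And>q. q \<in> U \<Longrightarrow> L q \<in> UHP" "\<And>q. q \<in> U \<Longrightarrow> ee (L q) = q"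
proof -
  define U where "U = ball q0 (norm q0) \<inter> ball 0 1"
  define L where "L q = Ln (q / q0) / (2 * of_real pi * \<i>) + qlift q0" for q
  have nonpos: "q / q0 \<notin> \<real>\<^sub>\<le>\<^sub>0" if "q \<in> ball q0 (norm q0)" for q
  proof
    assume "q / q0 \<in> \<real>\<^sub>\<le>\<^sub>0"
    then have "Re (q / q0) \<le> 0" by (simp add: complex_nonpos_Reals_iff)
    then have "1 \<le> Re (1 - q / q0)" by simp
    also have "\<dots> \<le> norm (1 - q / q0)" by (rule complex_Re_le_cmod)
    also have "1 - q / q0 = (q0 - q) / q0" using assms by (simp add: field_simps)
    also have "norm \<dots> = norm (q0 - q) / norm q0" by (simp add: norm_divide)
    finally have "norm q0 \<le> norm (q0 - q)" using assms by (simp add: field_simps)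
    then show False using that by (simp add: dist_norm)
  qed
  have eeL: "ee (L q) = q" if "q \<in> U" for q
  proof -
    have "q \<noteq> 0" using that by (auto simp: U_def)
    then show ?thesis unfolding L_def ee_add ee_qlift[OF assms(1)] using assms(1) by (simp add: ee_def)
  qed
  show thesis
  proof (rule that[of U L])
    show "L holomorphic_on U" unfolding L_def
      by (intro holomorphic_intros) (use nonpos assms in \<open>auto simp: U_def\<close>)
    show "L q \<in> UHP" if "q \<in> U" for q
      using eeL[OF that] norm_ee_less_1[of "L q"] that by (simp add: U_def)
  qed (use assms eeL in \<open>auto simp: U_def\<close>)
qed

text \<open>The value 1 at the cusp is the continuous extension, by
  \<open>orbit_weight_eq_1\<close>, and lets the order at \<open>q = 0\<close> count in
  full.\<close>

definition disc_weight :: "complex \<Rightarrow> real" where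
  "disc_weight q = (if q = 0 then 1 else orbit_weight (qlift q))"

lemma orbit_weight_periodic: "z \<in> UHP \<Longrightarrow> orbit_weight (z + of_int n) = orbit_weight z"
  using height_sum_mob[of "Tpow n" z] by (simp add: orbit_weight_def)

lemma disc_weight_ee: "w \<in> UHP \<Longrightarrow> disc_weight (ee w) = orbit_weight w"
  using periodic_qlift[of orbit_weight w] orbit_weight_periodic by (simp add: disc_weight_def)

text \<open>The circle of radius \<open>exp (- pi)\<close> corresponds to height 1/2, where
  \<open>orbit_weight\<close> ends.\<close>

lemma disc_weight_eq_0: assumes "norm q < 1" "norm q \<ge> exp (- pi)" shows "disc_weight q = 0"
proof -
  have q: "q \<noteq> 0" using assms(2) by (metis exp_gt_zero norm_zero not_le)
  have "exp (- pi) \<le> exp (- 2 * pi * Im (qlift q))" using assms(2) Im_qlift[OF q] by simp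
  then have "pi * (2 * Im (qlift q)) \<le> pi * 1" by simp
  then have "Im (qlift q) \<le> 1/2" using pi_gt_zero by (subst (asm) mult_le_cancel_left_pos) auto
  then show ?thesis using q by (simp add: disc_weight_def orbit_weight_eq_0)
qed

lemma continuous_on_disc_weight: "continuous_on (ball 0 1) disc_weight"
  unfolding continuous_on_eq_continuous_at[OF open_ball]
proof
  fix q0 :: complex assume q0: "q0 \<in> ball 0 1"
  show "isCont disc_weight q0"
  proof (cases "q0 = 0")
    case True
    \<comment> \<open>This disc corresponds to heights above 2, where the weight is constantly
      1.\<close>
    have "eventually (\<lambda>q. q \<in> ball 0 (exp (-4 * pi))) (nhds (0::complex))"
      by (rule eventually_nhds_in_open) auto
    then have "eventually (\<lambda>q. disc_weight q = 1) (nhds (0::complex))"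
    proof eventually_elim
      case (elim q)
      show ?case
      proof (cases "q = 0")
        case False
        then have "exp (- 2 * pi * Im (qlift q)) < exp (- 4 * pi)" using elim Im_qlift[OF False] by simp
        then have "pi * 2 < pi * Im (qlift q)" by simp
        then have "Im (qlift q) > 2" using pi_gt_zero by (subst (asm) mult_less_cancel_left_pos) auto
        then show ?thesis using False by (simp add: disc_weight_def orbit_weight_eq_1)
      qed (simp add: disc_weight_def)
    qed
    then have "isCont disc_weight 0 \<longleftrightarrow> isCont (\<lambda>_. 1::real) (0::complex)" by (rule isCont_cong)
    then show ?thesis using True by simp
  next
    case False
    obtain U L where UL: "open U" "q0 \<in> U" "U \<subseteq> ball 0 1 - {0}" "L holomorphic_on U"
      "\<And>q. q \<in> U \<Longrightarrow> L q \<in> UHP" "\<And>q. q \<in> U \<Longrightarrow> ee (L q) = q"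
      using qlift_local_branch[OF False] q0 by auto
    have "continuous_on U (orbit_weight \<circ> L)"
      using UL by (intro continuous_on_compose holomorphic_on_imp_continuous_on
          continuous_on_subset[OF continuous_on_orbit_weight]) auto
    then have "isCont (orbit_weight \<circ> L) q0" using UL continuous_on_eq_continuous_at by blast
    moreover have "eventually (\<lambda>q. disc_weight q = (orbit_weight \<circ> L) q) (nhds q0)"
      using eventually_nhds_in_open[OF UL(1,2)]
      by eventually_elim (metis disc_weight_ee UL(5,6) comp_apply)
    ultimately show ?thesis using isCont_cong by blast
  qed
qed

section \<open>The degree of an invariant function\<close>

text \<open>Dividing the two limits leaves \<open>exp ((R - R') * x n)\<close>, whose logarithm
  would converge although \<open>x\<close> tends to infinity. The order at a cusp is thereby
  determined by growth alone. The filter is left general because some comparisons hold only along a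
  subset of the points near the cusp.\<close>

lemma exp_rate_unique:
  fixes x g :: "'a \<Rightarrow> real"
  assumes F: "F \<noteq> bot" and x: "filterlim x at_top F"
    and 1: "((\<lambda>n. g n * exp (R * x n)) \<longlongrightarrow> C) F" and 2: "((\<lambda>n. g n * exp (R' * x n)) \<longlongrightarrow> C') F"
    and C: "C > 0" "C' > 0"
  shows "R = R'"
proof (rule ccontr)
  assume ne: "R \<noteq> R'"
  have "((\<lambda>n. (g n * exp (R * x n)) / (g n * exp (R' * x n))) \<longlongrightarrow> C / C') F"
    by (intro tendsto_divide 1 2) (use C in auto)
  then have "((\<lambda>n. ln ((g n * exp (R * x n)) / (g n * exp (R' * x n)))) \<longlongrightarrow> ln (C / C')) F"
    by (rule tendsto_ln) (use C in auto)
  moreover have "eventually (\<lambda>n. g n * exp (R * x n) > 0) F"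
    using order_tendstoD(1)[OF 1, of 0] C by simp
  then have "eventually (\<lambda>n. ln ((g n * exp (R * x n)) / (g n * exp (R' * x n))) = (R - R') * x n) F"
  proof eventually_elim
    case (elim n)
    then have "g n \<noteq> 0" by auto
    then have "(g n * exp (R * x n)) / (g n * exp (R' * x n)) = exp ((R - R') * x n)"
      by (simp add: exp_diff left_diff_distrib)
    then show ?case by simp
  qed
  ultimately have "((\<lambda>n. (R - R') * x n) \<longlongrightarrow> ln (C / C')) F"
    by (subst (asm) tendsto_cong)
  then have "((\<lambda>n. 1 / (R - R') * ((R - R') * x n)) \<longlongrightarrow> 1 / (R - R') * ln (C / C')) F"
    by (intro tendsto_intros)
  then have "(x \<longlongrightarrow> 1 / (R - R') * ln (C / C')) F" using ne by simp
  then show False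
    using x F filterlim_at_top_imp_at_infinity not_tendsto_and_filterlim_at_infinity by blast
qed

text \<open>Approach to the cusp with no condition on the real part, so limits along this filter are
  uniform in \<open>Re z\<close>.\<close>

abbreviation at_iinf :: "complex filter" where "at_iinf \<equiv> filtercomap Im at_top"

lemma eventually_at_iinf: "eventually P at_iinf \<longleftrightarrow> (\<exists>Y. \<forall>z. Im z > Y \<longrightarrow> P z)"
  by (simp add: eventually_filtercomap_at_top_dense)

lemma eventually_UHP_at_iinf: "eventually (\<lambda>z. z \<in> UHP) at_iinf"
  unfolding eventually_at_iinf UHP_def by (intro exI[of _ 0]) auto

lemma at_iinf_neq_bot: "at_iinf \<noteq> bot"
proof
  assume "at_iinf = bot"
  then have "eventually (\<lambda>_. False) at_iinf" by simp
  then obtain Y where "\<forall>z. Im z > Y \<longrightarrow> False" unfolding eventually_at_iinf by blast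
  from this[rule_format, of "Complex 0 (Y + 1)"] show False by simp
qed

lemma filterlim_Im_at_iinf: "filterlim Im at_top at_iinf"
  by (rule filterlim_filtercomap)

lemma filterlim_ee: "filterlim ee (at (ee z)) (at z)"
proof (rule filterlim_atI)
  have "isCont ee z" unfolding ee_def[abs_def] by (intro continuous_intros)
  then show "(ee \<longlongrightarrow> ee z) (at z)" by (simp add: isCont_def)
  have "eventually (\<lambda>w. w \<in> ball z 1 - {z}) (at z)" by (intro eventually_at_in_open) auto
  then show "eventually (\<lambda>w. ee w \<noteq> ee z) (at z)"
  proof eventually_elim
    case (elim w)
    show ?case
    proof
      assume "ee w = ee z"
      then obtain n where n: "w = z + of_int n" by (auto simp: ee_eq_iff)
      then have "norm (complex_of_int n) < 1" using elim by (simp add: dist_norm)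
      then have "n = 0" by simp
      then show False using n elim by simp
    qed
  qed
qed

lemma ee_analytic: "ee analytic_on S"
  using ee_holomorphic[of UNIV] by (simp add: analytic_on_open analytic_on_subset[of ee UNIV])

text \<open>The derivative of \<open>ee\<close> never vanishes, so passing to the coordinate q
  preserves orders.\<close>

lemma zorder_ee:
  assumes "F meromorphic_on {ee z}" "eventually (\<lambda>w. F w \<noteq> 0) (at (ee z))"
  shows "zorder (\<lambda>w. F (ee w)) z = zorder F (ee z)"
proof -
  have d: "(ee has_field_derivative 2 * of_real pi * \<i> * ee w) (at w)" for w
    unfolding ee_def[abs_def] by (auto intro!: derivative_eq_intros)
  have "deriv (\<lambda>x. ee x - ee z) z = 2 * of_real pi * \<i> * ee z"
    by (rule DERIV_imp_deriv) (auto intro!: derivative_eq_intros d)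
  then have "zorder (\<lambda>x. ee x - ee z) z = 1"
    by (intro zorder_zero_eqI') (auto intro!: analytic_intros ee_analytic)
  moreover have "zorder (F \<circ> ee) z = zorder F (ee z) * zorder (\<lambda>x. ee x - ee z) z"
    using assms filterlim_ee[of z] ee_analytic
    by (intro zorder_compose') (auto simp: meromorphic_at_iff filterlim_at)
  ultimately show ?thesis by (simp add: o_def)
qed

lemma bij_betw_ee: "bij_betw ee {z\<in>strip. Im z > 1/2} (ball 0 (exp (- pi)) - {0})"
  unfolding bij_betw_def
proof
  show "inj_on ee {z\<in>strip. Im z > 1/2}"
  proof (rule inj_onI)
    fix z w assume z: "z \<in> {z\<in>strip. Im z > 1/2}" and w: "w \<in> {z\<in>strip. Im z > 1/2}" and "ee z = ee w"
    then obtain n where n: "z = w + of_int n" by (auto simp: ee_eq_iff)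
    then have "n = 0" using strip_shift_eq[of w n] z w by auto
    then show "z = w" using n by simp
  qed
  have less: "norm (ee z) < exp (- pi) \<longleftrightarrow> Im z > 1/2" for z
  proof -
    have "norm (ee z) < exp (- pi) \<longleftrightarrow> pi * 1 < pi * (2 * Im z)" by (simp add: ee_norm)
    also have "\<dots> \<longleftrightarrow> 1 < 2 * Im z" using pi_gt_zero by (subst mult_less_cancel_left_pos) auto
    finally show ?thesis by auto
  qed
  show "ee ` {z\<in>strip. Im z > 1/2} = ball 0 (exp (- pi)) - {0}"
  proof (intro equalityI subsetI)
    fix q assume "q \<in> ball 0 (exp (- pi)) - {0::complex}"
    then have q: "q \<noteq> 0" "norm q < exp (- pi)" by auto
    have e1: "exp (- pi) \<le> 1" by simp
    define z where "z = qlift q + of_int (- \<lfloor>Re (qlift q)\<rfloor>)"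
    have ez: "ee z = q" unfolding z_def ee_add by (simp add: ee_qlift q del: of_int_minus)
    have "qlift q \<in> UHP" using qlift_UHP[of q] q e1 by linarith
    then have "z \<in> strip" unfolding z_def by (rule shift_to_strip)
    moreover have "Im z > 1/2" using less[of z] ez q by simp
    ultimately show "q \<in> ee ` {z\<in>strip. Im z > 1/2}" using ez by blast
  qed (use less in auto)
qed

text \<open>The punctured open disc is the part of \<open>strip\<close> above height 1/2; the
  bounding circle has weight 0, and the centre contributes the order at the cusp.\<close>

lemma sum_disc_eq_strip:
  fixes \<nu> :: "complex \<Rightarrow> int"
  assumes fin: "finite {q\<in>cball 0 (exp (- pi)). \<nu> q \<noteq> 0}"
  shows "finite {z\<in>strip. Im z > 1/2 \<and> \<nu> (ee z) \<noteq> 0}"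
    and "(\<Sum>q\<in>{q\<in>cball 0 (exp (- pi)). \<nu> q \<noteq> 0}. real_of_int (\<nu> q) * disc_weight q)
     = real_of_int (\<nu> 0) + (\<Sum>z\<in>{z\<in>strip. Im z > 1/2 \<and> \<nu> (ee z) \<noteq> 0}. real_of_int (\<nu> (ee z)) * orbit_weight z)"
proof -
  let ?r = "exp (- pi)"
  let ?S = "{z\<in>strip. Im z > 1/2 \<and> \<nu> (ee z) \<noteq> 0}"
  have bij: "bij_betw ee ?S {q\<in>ball 0 ?r - {0}. \<nu> q \<noteq> 0}"
    unfolding bij_betw_def
  proof
    show "inj_on ee ?S" using bij_betw_ee unfolding bij_betw_def by (auto intro: inj_on_subset)
    show "ee ` ?S = {q\<in>ball 0 ?r - {0}. \<nu> q \<noteq> 0}"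
      unfolding bij_betw_imp_surj_on[OF bij_betw_ee, symmetric] by auto
  qed
  have fin': "finite {q\<in>ball 0 ?r - {0}. \<nu> q \<noteq> 0}" by (rule finite_subset[OF _ fin]) auto
  then show "finite ?S" using bij bij_betw_finite by blast
  have "(\<Sum>q\<in>{q\<in>cball 0 ?r. \<nu> q \<noteq> 0}. real_of_int (\<nu> q) * disc_weight q)
      = (\<Sum>q\<in>insert 0 {q\<in>ball 0 ?r - {0}. \<nu> q \<noteq> 0}. real_of_int (\<nu> q) * disc_weight q)"
  proof (rule sum.mono_neutral_cong)
    fix q assume q: "q \<in> {q\<in>cball 0 ?r. \<nu> q \<noteq> 0} - insert 0 {q\<in>ball 0 ?r - {0}. \<nu> q \<noteq> 0}"
    then have "norm q = ?r" by auto
    then have "disc_weight q = 0" by (intro disc_weight_eq_0) auto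
    then show "real_of_int (\<nu> q) * disc_weight q = 0" by simp
  qed (use fin fin' in auto)
  also have "\<dots> = real_of_int (\<nu> 0) * disc_weight 0 + (\<Sum>q\<in>{q\<in>ball 0 ?r - {0}. \<nu> q \<noteq> 0}. real_of_int (\<nu> q) * disc_weight q)"
    using fin' by (subst sum.insert) auto
  also have "(\<Sum>q\<in>{q\<in>ball 0 ?r - {0}. \<nu> q \<noteq> 0}. real_of_int (\<nu> q) * disc_weight q)
      = (\<Sum>z\<in>?S. real_of_int (\<nu> (ee z)) * disc_weight (ee z))"
    by (rule sum.reindex_bij_betw[OF bij, symmetric])
  also have "\<dots> = (\<Sum>z\<in>?S. real_of_int (\<nu> (ee z)) * orbit_weight z)"
    by (rule sum.cong) (use strip_UHP in \<open>auto simp: disc_weight_ee subset_iff\<close>)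
  finally show "(\<Sum>q\<in>{q\<in>cball 0 ?r. \<nu> q \<noteq> 0}. real_of_int (\<nu> q) * disc_weight q)
     = real_of_int (\<nu> 0) + (\<Sum>z\<in>?S. real_of_int (\<nu> (ee z)) * orbit_weight z)" by (simp add: disc_weight_def)
qed

lemma strip_orbit_self: "z \<in> strip \<Longrightarrow> Im z > 1/2 \<Longrightarrow> z \<in> strip_orbit z"
  unfolding strip_orbit_def by (auto intro!: bexI[of _ "mat 1"])

lemma strip_orbit_eqI: "w \<in> strip_orbit z \<Longrightarrow> z \<in> UHP \<Longrightarrow> strip_orbit w = strip_orbit z"
  by (auto simp: strip_orbit_def[of z] strip_orbit_mob)

text \<open>The factor \<open>fact 15\<close> clears the denominators because all stabilisers have at most 15 elements.\<close>

lemma orbit_sum_integral: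
  fixes \<nu> :: "complex \<Rightarrow> int"
  assumes inv: "\<And>A z. A \<in> SL2Z \<Longrightarrow> z \<in> UHP \<Longrightarrow> \<nu> (mob A z) = \<nu> z"
    and fin: "finite {z\<in>strip. Im z > 1/2 \<and> \<nu> z \<noteq> 0}"
  shows "fact 15 * (\<Sum>z\<in>{z\<in>strip. Im z > 1/2 \<and> \<nu> z \<noteq> 0}. real_of_int (\<nu> z) * orbit_weight z) \<in> \<int>"
proof -
  let ?F = "{z\<in>strip. Im z > 1/2 \<and> \<nu> z \<noteq> 0}"
  have "(\<Sum>z\<in>?F. real_of_int (\<nu> z) * orbit_weight z)
      = (\<Sum>X\<in>strip_orbit ` ?F. \<Sum>z\<in>{z\<in>?F. strip_orbit z = X}. real_of_int (\<nu> z) * orbit_weight z)"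
    using fin by (rule sum.image_gen)
  then have "fact 15 * (\<Sum>z\<in>?F. real_of_int (\<nu> z) * orbit_weight z)
      = (\<Sum>X\<in>strip_orbit ` ?F. fact 15 * (\<Sum>z\<in>{z\<in>?F. strip_orbit z = X}. real_of_int (\<nu> z) * orbit_weight z))"
    by (simp add: sum_distrib_left)
  also have "\<dots> \<in> \<int>"
  proof (rule Ints_sum)
    fix X assume "X \<in> strip_orbit ` ?F"
    then obtain z0 where z0: "z0 \<in> ?F" "X = strip_orbit z0" by auto
    have z0U: "z0 \<in> UHP" using z0 strip_UHP by auto
    have "{z\<in>?F. strip_orbit z = X} = strip_orbit z0"
    proof (intro equalityI subsetI)
      fix z assume "z \<in> {z\<in>?F. strip_orbit z = X}"
      then show "z \<in> strip_orbit z0" using strip_orbit_self z0 by auto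
    next
      fix z assume z: "z \<in> strip_orbit z0"
      then have "\<nu> z = \<nu> z0" using inv z0U by (auto simp: strip_orbit_def)
      then show "z \<in> {z\<in>?F. strip_orbit z = X}" using z z0 strip_orbit_eqI[OF z z0U] by (auto simp: strip_orbit_def)
    qed
    then have "(\<Sum>z\<in>{z\<in>?F. strip_orbit z = X}. real_of_int (\<nu> z) * orbit_weight z) = (\<Sum>z\<in>strip_orbit z0. real_of_int (\<nu> z0) * orbit_weight z)"
      by (intro sum.cong) (use inv z0U in \<open>auto simp: strip_orbit_def\<close>)
    also have "\<dots> = real_of_int (\<nu> z0) * (2 / card (zstab z0))"
      by (simp add: sum_distrib_left[symmetric] sum_orbit_weight_strip_orbit[OF z0U])
    finally have eq: "fact 15 * (\<Sum>z\<in>{z\<in>?F. strip_orbit z = X}. real_of_int (\<nu> z) * orbit_weight z)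
        = fact 15 / real (card (zstab z0)) * (real_of_int (\<nu> z0) * 2)" by simp
    have "card (zstab z0) dvd fact 15"
      using finite_zstab_bound[OF z0U] by (intro dvd_fact) auto
    then obtain k where "fact 15 = card (zstab z0) * k" by (elim dvdE)
    then have "(fact 15 :: real) = real (card (zstab z0)) * real k"
      by (metis of_nat_fact of_nat_mult)
    then have "(fact 15 :: real) / real (card (zstab z0)) = real k"
      using finite_zstab_bound(3)[OF z0U] by (metis nonzero_mult_div_cancel_left of_nat_0_eq_iff less_irrefl)
    then show "fact 15 * (\<Sum>z\<in>{z\<in>?F. strip_orbit z = X}. real_of_int (\<nu> z) * orbit_weight z) \<in> \<int>"
      unfolding eq by simp
  qed
  finally show ?thesis .
qed

text \<open>Write \<open>f\<close> as \<open>g w * w powi N\<close> with \<open>g 0\<close> nonzero.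
  If \<open>N > R\<close>, the normalised modulus tends to 0 against the lower bound; if
  \<open>N < R\<close>, the upper bound forces \<open>g 0 = 0\<close>. In particular the real
  exponent \<open>R\<close> turns out to be an integer.\<close>

lemma zorder_eq_growth:
  fixes f :: "complex \<Rightarrow> complex"
  assumes f: "f meromorphic_on {0}" and C: "C > 0"
    and bnd: "eventually (\<lambda>w. C / 2 < norm (f w) * norm w powr (- R) \<and> norm (f w) * norm w powr (- R) < 2 * C) (at 0)"
  shows "real_of_int (zorder f 0) = R"
proof -
  define N where "N = zorder f 0"
  define g where "g = zor_poly f 0"
  have "eventually (\<lambda>w. f w \<noteq> 0) (at 0)" using bnd by eventually_elim (use C in auto)
  then have fr: "frequently (\<lambda>w. f w \<noteq> 0) (at 0)" using eventually_frequently[OF at_neq_bot] by blast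
  from zorder_exist[OF _ _ fr] f obtain r where g0: "g 0 \<noteq> 0" and r: "r > 0" "g holomorphic_on cball 0 r"
    "\<forall>w\<in>cball 0 r - {0}. f w = g w * (w - 0) powi N \<and> g w \<noteq> 0"
    unfolding meromorphic_at_iff N_def g_def by blast
  have "eventually (\<lambda>w. w \<in> ball 0 r - {0}) (at 0)" using r by (intro eventually_at_in_open) auto
  then have fg: "eventually (\<lambda>w. norm (f w) * norm w powr (- R) = norm (g w) * norm w powr (N - R)) (at 0)"
  proof eventually_elim
    case (elim w)
    then have "norm (f w) = norm (g w) * norm w powi N" using r(3) by (auto simp: norm_mult norm_power_int)
    also have "norm w powi N = norm w powr N" using elim by (simp add: powr_real_of_int')
    finally show ?case by (simp add: powr_add powr_diff powr_minus field_simps)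
  qed
  have "isCont g 0"
    using r by (meson ball_subset_cball centre_in_ball continuous_on_eq_continuous_at continuous_on_subset holomorphic_on_imp_continuous_on open_ball)
  then have gl: "((\<lambda>w. norm (g w)) \<longlongrightarrow> norm (g 0)) (at 0)" by (intro tendsto_norm) (simp add: isCont_def)
  have pl: "((\<lambda>w::complex. norm w powr a) \<longlongrightarrow> 0) (at 0)" if "a > 0" for a
  proof -
    have "((\<lambda>w::complex. norm w powr a) \<longlongrightarrow> 0 powr a) (at 0)"
      by (rule tendsto_powr') (use that in \<open>auto intro!: tendsto_eq_intros\<close>)
    then show ?thesis by simp
  qed
  consider "N > R" | "N < R" | "N = R" by linarith
  then show ?thesis
  proof cases
    case 1
    have "((\<lambda>w. norm (g w) * norm w powr (N - R)) \<longlongrightarrow> norm (g 0) * 0) (at 0)"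
      by (intro tendsto_mult gl pl) (use 1 in auto)
    then have "eventually (\<lambda>w. norm (g w) * norm w powr (N - R) < C / 2) (at 0)"
      using C by (intro order_tendstoD) auto
    with fg bnd have "eventually (\<lambda>w::complex. False) (at 0)" by eventually_elim auto
    then show ?thesis by simp
  next
    case 2
    have "eventually (\<lambda>w::complex. w \<noteq> 0) (at 0)" by (simp add: eventually_at_filter)
    with fg bnd have "eventually (\<lambda>w. norm (g w) \<le> 2 * C * norm w powr (R - N)) (at 0)"
    proof eventually_elim
      case (elim w)
      have "norm (g w) = (norm (g w) * norm w powr (N - R)) * norm w powr (R - N)"
        using elim by (simp add: mult.assoc flip: powr_add)
      also have "\<dots> \<le> 2 * C * norm w powr (R - N)"
        using elim by (intro mult_right_mono) auto
      finally show ?case .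
    qed
    moreover have "((\<lambda>w::complex. 2 * C * norm w powr (R - N)) \<longlongrightarrow> 2 * C * 0) (at 0)"
      by (intro tendsto_mult tendsto_const pl) (use 2 in auto)
    ultimately have "norm (g 0) \<le> 2 * C * 0" using gl by (intro tendsto_le[OF at_neq_bot]) auto
    then show ?thesis using g0 by simp
  qed (simp add: N_def)
qed

text \<open>By periodicity \<open>J\<close> descends to the q-disc, where the growth rate
  \<open>R\<close> becomes the order at \<open>q = 0\<close>. Invariance under the whole group
  supplies the bounded denominators needed for \<open>weighted_degree_zero_disc\<close>.\<close>

lemma invariant_degree_zero:
  assumes mero: "J nicely_meromorphic_on UHP"
    and inv: "\<And>A z. A \<in> SL2Z \<Longrightarrow> z \<in> UHP \<Longrightarrow> J (mob A z) = J z"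
    and lim: "((\<lambda>z. norm (J z) * exp (2 * pi * R * Im z)) \<longlongrightarrow> C) at_iinf" and C: "C > 0"
  shows "finite {z\<in>strip. Im z > 1/2 \<and> zorder J z \<noteq> 0}"
    and "R + (\<Sum>z\<in>{z\<in>strip. Im z > 1/2 \<and> zorder J z \<noteq> 0}. real_of_int (zorder J z) * orbit_weight z) = 0"
proof -
  have goal: "finite {z\<in>strip. Im z > 1/2 \<and> zorder J z \<noteq> 0} \<and>
     R + (\<Sum>z\<in>{z\<in>strip. Im z > 1/2 \<and> zorder J z \<noteq> 0}. real_of_int (zorder J z) * orbit_weight z) = 0"
  proof (cases "J constant_on UHP")
    case True
    then obtain k where k: "\<And>z. z \<in> UHP \<Longrightarrow> J z = k" by (auto simp: constant_on_def)
    have "eventually (\<lambda>z. norm (J z) * exp (2 * pi * R * Im z) > 0) at_iinf"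
      using order_tendstoD(1)[OF lim, of 0] C by simp
    moreover have evU: "eventually (\<lambda>z. z \<in> UHP) at_iinf"
      by (rule eventually_UHP_at_iinf)
    ultimately have "eventually (\<lambda>z. k \<noteq> 0) at_iinf"
      by eventually_elim (use k in auto)
    then have k0: "k \<noteq> 0" using at_iinf_neq_bot by simp
    have "2 * pi * R = 0"
    proof (rule exp_rate_unique[OF at_iinf_neq_bot filterlim_Im_at_iinf lim _ C])
      have "eventually (\<lambda>z. norm k = norm (J z) * exp (0 * Im z)) at_iinf"
        using evU by eventually_elim (simp add: k)
      then show "((\<lambda>z. norm (J z) * exp (0 * Im z)) \<longlongrightarrow> norm k) at_iinf"
        using tendsto_cong tendsto_const by fast
    qed (use k0 in auto)
    then have "R = 0" by simp
    moreover have "zorder J z = 0" if "z \<in> strip" for z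
    proof -
      have "z \<in> UHP" using that strip_UHP by auto
      from eventually_in_UHP[OF this] have "eventually (\<lambda>w. J w = k) (at z)"
        by eventually_elim (rule k)
      then have "zorder J z = zorder (\<lambda>_. k) z" by (intro zorder_cong) auto
      then show ?thesis using k0 by simp
    qed
    then have "{z\<in>strip. Im z > 1/2 \<and> zorder J z \<noteq> 0} = {}" by auto
    ultimately show ?thesis by (metis (no_types, lifting) add.right_neutral finite.emptyI sum.empty)
  next
    case False
    have merom: "J meromorphic_on UHP" using mero by (simp add: nicely_meromorphic_on_def)
    have per: "J (z + of_int n) = J z" if "z \<in> UHP" for z n
      using inv[of "Tpow n" z] that by simp
    define Hq where "Hq q = J (qlift q)" for q
    have Hq_ee: "Hq (ee w) = J w" if "w \<in> UHP" for w
      unfolding Hq_def using periodic_qlift[of J w] per that by blast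
    have Hq_mero: "Hq meromorphic_on {q0}" and Hq_ana: "\<And>w. w \<in> UHP \<Longrightarrow> ee w = q0 \<Longrightarrow> J analytic_on {w} \<Longrightarrow> Hq analytic_on {q0}"
      if q0: "q0 \<noteq> 0" "norm q0 < 1" for q0
    proof -
      obtain U L where UL: "open U" "q0 \<in> U" "U \<subseteq> ball 0 1 - {0}" "L holomorphic_on U"
        "\<And>q. q \<in> U \<Longrightarrow> L q \<in> UHP" "\<And>q. q \<in> U \<Longrightarrow> ee (L q) = q"
        using qlift_local_branch[OF q0] by blast
      have Lana: "L analytic_on U" using UL by (simp add: analytic_on_open)
      have evn: "eventually (\<lambda>q. Hq q = J (L q)) (nhds q0)"
        using eventually_nhds_in_open[OF UL(1,2)] by eventually_elim (metis Hq_ee UL(5,6))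
      then have "eventually (\<lambda>q. Hq q = J (L q)) (at q0)" by (simp add: eventually_at_filter eventually_mono)
      then have "Hq meromorphic_on {q0} \<longleftrightarrow> (\<lambda>q. J (L q)) meromorphic_on {q0}"
        by (intro meromorphic_on_cong) auto
      moreover have "(\<lambda>q. J (L q)) meromorphic_on {q0}"
        by (rule meromorphic_on_compose[OF merom]) (use UL Lana in \<open>auto intro: analytic_on_subset\<close>)
      ultimately show "Hq meromorphic_on {q0}" by blast
      fix w assume w: "w \<in> UHP" "ee w = q0" "J analytic_on {w}"
      then have "ee (L q0) = ee w" using UL by simp
      then obtain n where n: "L q0 = w + of_int n" by (auto simp: ee_eq_iff)
      have "(\<lambda>z. J (z - of_int n)) analytic_on {L q0}"
        using w(3) n by (intro analytic_on_compose_gen[of "\<lambda>z. z - of_int n" "{L q0}" J "{w}", unfolded o_def] analytic_intros) auto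
      moreover have evJ: "eventually (\<lambda>z. J z = J (z - of_int n)) (nhds (L q0))"
      proof -
        have "eventually (\<lambda>z. z \<in> UHP) (nhds (L q0))" using UL open_UHP by (intro eventually_nhds_in_open) auto
        then show ?thesis
        proof eventually_elim
          case (elim z)
          then show ?case using per[of z "- n"] by simp
        qed
      qed
      ultimately have "J analytic_on {L q0}" using analytic_at_cong[OF evJ refl] by blast
      then have "(\<lambda>q. J (L q)) analytic_on {q0}"
        using Lana UL by (intro analytic_on_compose_gen[of L "{q0}" J "{L q0}", unfolded o_def]) (auto intro: analytic_on_subset)
      then show "Hq analytic_on {q0}" using analytic_at_cong[OF evn refl] by blast
    qed
    have "eventually (\<lambda>z. C / 2 < norm (J z) * exp (2 * pi * R * Im z) \<and> norm (J z) * exp (2 * pi * R * Im z) < 2 * C) at_iinf"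
      using C by (intro eventually_conj order_tendstoD[OF lim]) auto
    then obtain Y0 where Y0: "\<And>z. Im z > Y0 \<Longrightarrow> C / 2 < norm (J z) * exp (2 * pi * R * Im z) \<and> norm (J z) * exp (2 * pi * R * Im z) < 2 * C"
      unfolding eventually_at_iinf by blast
    define Y where "Y = max Y0 0"
    \<comment> \<open>The punctured disc of this radius corresponds to heights above
      \<open>Y\<close>; nonnegativity of \<open>Y\<close> keeps it inside the unit disc.\<close>
    define \<epsilon> where "\<epsilon> = exp (- 2 * pi * Y)"
    have \<epsilon>: "\<epsilon> > 0" "\<epsilon> \<le> 1" by (auto simp: \<epsilon>_def Y_def)
    have small: "qlift q \<in> UHP" "Im (qlift q) > Y" if "q \<noteq> 0" "norm q < \<epsilon>" for q
    proof -
      show "qlift q \<in> UHP" using qlift_UHP[of q] that \<epsilon> by linarith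
      have "exp (- 2 * pi * Im (qlift q)) < exp (- 2 * pi * Y)" using that Im_qlift[of q] by (simp add: \<epsilon>_def)
      then have "pi * Y < pi * Im (qlift q)" by simp
      then show "Im (qlift q) > Y" using pi_gt_zero by (subst (asm) mult_less_cancel_left_pos) auto
    qed
    have bnd: "C / 2 < norm (Hq q) * norm q powr (- R) \<and> norm (Hq q) * norm q powr (- R) < 2 * C"
      if "q \<noteq> 0" "norm q < \<epsilon>" for q
    proof -
      have "norm q powr (- R) = exp (2 * pi * R * Im (qlift q))"
        using Im_qlift[OF that(1)] by (simp add: powr_def)
      then show ?thesis using Y0[of "qlift q"] small(2)[OF that] by (auto simp: Hq_def Y_def)
    qed
    have evb: "eventually (\<lambda>q. C / 2 < norm (Hq q) * norm q powr (- R) \<and> norm (Hq q) * norm q powr (- R) < 2 * C) (at 0)"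
    proof -
      have "eventually (\<lambda>q. q \<in> ball 0 \<epsilon> - {0}) (at (0::complex))" using \<epsilon> by (intro eventually_at_in_open) auto
      then show ?thesis by eventually_elim (rule bnd, auto)
    qed
    have Hq_iso: "isolated_singularity_at Hq 0"
    proof -
      have "Hq analytic_on {q}" if q: "q \<in> ball 0 \<epsilon> - {0}" for q
      proof -
        have q': "q \<noteq> 0" "norm q < \<epsilon>" using q by auto
        have s: "qlift q \<in> UHP" "Im (qlift q) > Y" using small[OF q'] by auto
        have "J (qlift q) \<noteq> 0" using Y0[of "qlift q"] s C by (auto simp: Y_def)
        then have "\<not> is_pole J (qlift q)" using is_pole_zero_at_nicely_mero[OF mero _ s(1)] by blast
        then have "J analytic_on {qlift q}" using nicely_meromorphic_on_imp_analytic_at[OF mero s(1)] by blast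
        then show ?thesis using Hq_ana[of q "qlift q"] q' \<epsilon> s ee_qlift[of q] by auto
      qed
      then have "Hq analytic_on ball 0 \<epsilon> - {0}" using analytic_on_analytic_at by blast
      then show ?thesis unfolding isolated_singularity_at_def using \<epsilon> by blast
    qed
    have Hq_mero0: "Hq meromorphic_on {0}"
    proof -
      \<comment> \<open>Then \<open>n + R\<close> is positive and \<open>q ^ n * Hq q\<close> tends
        to 0, so \<open>Hq\<close> has at worst a pole at the cusp.\<close>
      obtain n where n: "real n > - R" using reals_Archimedean2 by blast
      define P where "P q = q ^ n * Hq q" for q
      have "(P \<longlongrightarrow> 0) (at 0)"
      proof (rule Lim_null_comparison)
        have "eventually (\<lambda>q::complex. q \<noteq> 0) (at 0)" by (simp add: eventually_at_filter)
        with evb show "eventually (\<lambda>q. norm (P q) \<le> 2 * C * norm q powr (n + R)) (at 0)"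
        proof eventually_elim
          case (elim q)
          have "norm (P q) = norm q powr n * norm (Hq q)" using elim by (simp add: P_def norm_mult norm_power powr_realpow)
          also have "\<dots> = (norm (Hq q) * norm q powr (- R)) * norm q powr (n + R)"
            using elim by (simp add: mult.assoc flip: powr_add)
          also have "\<dots> \<le> 2 * C * norm q powr (n + R)" using elim by (intro mult_right_mono) auto
          finally show ?case .
        qed
        have "((\<lambda>q::complex. norm q powr (n + R)) \<longlongrightarrow> 0 powr (n + R)) (at 0)"
          by (rule tendsto_powr') (use n in \<open>auto intro!: tendsto_eq_intros\<close>)
        then show "((\<lambda>q::complex. 2 * C * norm q powr (n + R)) \<longlongrightarrow> 0) (at 0)"
          by (intro tendsto_mult_right_zero) simp
      qed
      then have "not_essential P 0" by (rule tendsto_imp_not_essential)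
      moreover have "isolated_singularity_at P 0" unfolding P_def
        by (intro isolated_singularity_at_times isolated_singularity_at_analytic analytic_intros Hq_iso)
      ultimately have Pm: "P meromorphic_on {0}" by (simp add: meromorphic_at_iff)
      have "eventually (\<lambda>q::complex. q \<noteq> 0) (at 0)" by (simp add: eventually_at_filter)
      then have "eventually (\<lambda>q. Hq q = P q / q ^ n) (at 0)" by eventually_elim (simp add: P_def)
      then have "Hq meromorphic_on {0} \<longleftrightarrow> (\<lambda>q. P q / q ^ n) meromorphic_on {0}"
        by (intro meromorphic_on_cong) auto
      then show ?thesis using Pm by (auto intro!: meromorphic_intros)
    qed
    have Hq_merom: "Hq meromorphic_on ball 0 1"
      unfolding meromorphic_on_meromorphic_at[of _ "ball 0 1"] using Hq_mero Hq_mero0 by (metis mem_ball_0)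
    \<comment> \<open>The value of \<open>Hq\<close> at 0 carries no information; removing
      singularities yields a nicely meromorphic function on the whole disc with the same
      orders.\<close>
    define H where "H = remove_sings Hq"
    have Hnice: "H nicely_meromorphic_on ball 0 1" unfolding H_def
      by (rule remove_sings_nicely_meromorphic[OF Hq_merom])
    have Hm: "H meromorphic_on {q}" if "q \<in> ball 0 1" for q
      using Hnice that by (meson empty_subsetI insert_subset meromorphic_on_subset nicely_meromorphic_on_def)
    have R: "real_of_int (zorder H 0) = R"
      unfolding H_def using zorder_eq_growth[OF Hq_mero0 C evb] Hq_iso by simp
    have Hev: "eventually (\<lambda>w. H (ee w) = J w) (at z)" if z: "z \<in> UHP" for z
    proof -
      have "isolated_singularity_at Hq (ee z)"
        using Hq_mero[of "ee z"] z norm_ee_less_1[of z] by (simp add: meromorphic_at_iff)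
      then have "eventually (\<lambda>q. H q = Hq q) (at (ee z))"
        unfolding H_def by (rule eventually_remove_sings_eq_at)
      then have "eventually (\<lambda>w. H (ee w) = Hq (ee w)) (at z)"
        using filterlim_ee by (rule eventually_compose_filterlim)
      with eventually_in_UHP[OF z] show ?thesis by eventually_elim (simp add: Hq_ee)
    qed
    have Jnc: "eventually (\<lambda>w. J w \<noteq> k) (at z)" if z: "z \<in> UHP" for z k
    proof -
      have "(\<forall>x\<in>UHP. J x = k) \<or> (\<forall>\<^sub>\<approx>x\<in>UHP. J x \<noteq> k)"
        by (rule nicely_meromorphic_imp_constant_or_avoid[OF mero open_UHP connected_UHP])
      then have "\<forall>\<^sub>\<approx>x\<in>UHP. J x \<noteq> k" using False by (auto simp: constant_on_def)
      then show ?thesis by (rule eventually_cosparse_imp_eventually_at) (use z in auto)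
    qed
    have nconst: "\<not> H constant_on ball 0 1"
    proof
      assume "H constant_on ball 0 1"
      then obtain k where k: "\<And>q. q \<in> ball 0 1 \<Longrightarrow> H q = k" by (auto simp: constant_on_def)
      have iU: "\<i> \<in> UHP" by (simp add: UHP_def)
      have "eventually (\<lambda>w::complex. False) (at \<i>)"
        using Hev[OF iU] Jnc[OF iU, of k] eventually_in_UHP[OF iU]
      proof eventually_elim
        case (elim w)
        then show ?case using k[of "ee w"] norm_ee_less_1[of w] by simp
      qed
      then show False by simp
    qed
    have Hnz: "eventually (\<lambda>q. H q + k \<noteq> 0) (at q0)" if q0: "q0 \<in> ball 0 1" for q0 k
    proof -
      have "(\<forall>x\<in>ball 0 1. H x = -k) \<or> (\<forall>\<^sub>\<approx>x\<in>ball 0 1. H x \<noteq> -k)"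
        by (rule nicely_meromorphic_imp_constant_or_avoid[OF Hnice]) auto
      then have "\<forall>\<^sub>\<approx>x\<in>ball 0 1. H x \<noteq> -k" using nconst by (auto simp: constant_on_def)
      then have "eventually (\<lambda>w. H w \<noteq> -k) (at q0)"
        by (rule eventually_cosparse_imp_eventually_at) (use q0 in auto)
      then show ?thesis by eventually_elim (auto simp: add_eq_0_iff)
    qed
    have zH: "zorder (\<lambda>q. H q + k) (ee z) = zorder (\<lambda>w. J w + k) z" if z: "z \<in> UHP" for z k
    proof -
      have eb: "ee z \<in> ball 0 1" using z norm_ee_less_1[of z] by simp
      have "zorder (\<lambda>w. H (ee w) + k) z = zorder (\<lambda>q. H q + k) (ee z)"
        using Hm[OF eb] Hnz[OF eb] by (intro zorder_ee[of "\<lambda>q. H q + k"] meromorphic_intros) auto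
      moreover have "zorder (\<lambda>w. H (ee w) + k) z = zorder (\<lambda>w. J w + k) z"
        using Hev[OF z] by (intro zorder_cong) (auto elim: eventually_mono)
      ultimately show ?thesis by simp
    qed
    have zH0: "zorder H (ee z) = zorder J z" if z: "z \<in> UHP" for z
      using zH[OF z, of 0] by simp
    have zJ: "zorder (\<lambda>w. J w + k) (mob A z) = zorder (\<lambda>w. J w + k) z" if "A \<in> SL2Z" "z \<in> UHP" for A z k
    proof -
      have mz: "mob A z \<in> UHP" using that by simp
      have "eventually (\<lambda>w. J w + k \<noteq> 0) (at (mob A z))"
        using Jnc[OF mz, of "-k"] by eventually_elim (auto simp: add_eq_0_iff)
      then have "zorder (\<lambda>w. J (mob A w) + k) z = zorder (\<lambda>w. J w + k) (mob A z)"
        using merom mz that by (intro zorder_mob[of A z "\<lambda>w. J w + k"] meromorphic_intros)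
          (auto intro: meromorphic_on_subset)
      moreover have "zorder (\<lambda>w. J (mob A w) + k) z = zorder (\<lambda>w. J w + k) z"
        using eventually_in_UHP[OF that(2)] inv[OF that(1)] by (intro zorder_cong) (auto elim: eventually_mono)
      ultimately show ?thesis by simp
    qed
    have zJ0: "zorder J (mob A z) = zorder J z" if "A \<in> SL2Z" "z \<in> UHP" for A z
      using zJ[OF that, of 0] by simp
    let ?r = "exp (- pi)"
    have r1: "norm x < 1" if "norm x \<le> ?r" for x :: complex
    proof -
      have "?r < 1" by simp
      then show ?thesis using that by linarith
    qed
    have sparse: "finite {q\<in>cball 0 ?r. zorder (\<lambda>z. H z + k) q \<noteq> 0}" for k
    proof (rule finite_zorder_nonzero_compact[of _ "ball 0 1"])
      show "(\<lambda>z. H z + k) meromorphic_on ball 0 1"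
        using Hnice by (auto simp: nicely_meromorphic_on_def intro!: meromorphic_intros)
      show "cball 0 ?r \<subseteq> ball (0::complex) 1" using r1 by auto
    qed (use Hnz in auto)
    have fin0: "finite {q\<in>cball 0 ?r. zorder H q \<noteq> 0}" using sparse[of 0] by simp
    have M0: "(0::nat) < fact 15" by simp
    have deg: "(\<Sum>q\<in>{q\<in>cball 0 ?r. zorder H q \<noteq> 0}. real_of_int (zorder H q) * disc_weight q) = 0"
    proof (rule weighted_degree_zero_disc(2)[OF Hnice nconst continuous_on_disc_weight _ _ _ M0])
      show "disc_weight q = 0" if "q \<in> ball 0 1" "q \<notin> cball 0 ?r" for q
        using that by (intro disc_weight_eq_0) auto
      fix c :: real assume "c \<ge> 0"
      \<comment> \<open>Only zeros of the shifted function enter this count. The truncated order is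
        again constant on orbits, so \<open>orbit_sum_integral\<close> applies to it.\<close>
      define \<nu> where "\<nu> q = max 0 (zorder (\<lambda>z. H z + of_real c) q)" for q
      define \<mu> where "\<mu> w = max 0 (zorder (\<lambda>z. J z + of_real c) w)" for w
      have \<nu>\<mu>: "\<nu> (ee z) = \<mu> z" if "z \<in> UHP" for z using zH[OF that] by (simp add: \<nu>_def \<mu>_def)
      have set: "{q\<in>cball 0 ?r. \<nu> q \<noteq> 0} = {q\<in>cball 0 ?r. zorder (\<lambda>z. H z + of_real c) q > 0}"
        by (auto simp: \<nu>_def)
      have fin\<nu>: "finite {q\<in>cball 0 ?r. \<nu> q \<noteq> 0}"
        by (rule finite_subset[OF _ sparse[of "of_real c"]]) (auto simp: \<nu>_def)
      have set2: "{z\<in>strip. Im z > 1/2 \<and> \<nu> (ee z) \<noteq> 0} = {z\<in>strip. Im z > 1/2 \<and> \<mu> z \<noteq> 0}"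
        using \<nu>\<mu> strip_UHP by auto
      have "(\<Sum>q\<in>{q\<in>cball 0 ?r. zorder (\<lambda>z. H z + of_real c) q > 0}.
            real_of_int (zorder (\<lambda>z. H z + of_real c) q) * disc_weight q)
          = (\<Sum>q\<in>{q\<in>cball 0 ?r. \<nu> q \<noteq> 0}. real_of_int (\<nu> q) * disc_weight q)"
        unfolding set by (rule sum.cong) (auto simp: \<nu>_def)
      also have "\<dots> = real_of_int (\<nu> 0) + (\<Sum>z\<in>{z\<in>strip. Im z > 1/2 \<and> \<mu> z \<noteq> 0}. real_of_int (\<nu> (ee z)) * orbit_weight z)"
        using sum_disc_eq_strip(2)[OF fin\<nu>] unfolding set2 .
      also have "\<dots> = real_of_int (\<nu> 0) + (\<Sum>z\<in>{z\<in>strip. Im z > 1/2 \<and> \<mu> z \<noteq> 0}. real_of_int (\<mu> z) * orbit_weight z)"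
        using \<nu>\<mu> strip_UHP by (intro arg_cong[where f = "(+) _"] sum.cong) auto
      finally have eq: "real (fact 15) * (\<Sum>q\<in>{q\<in>cball 0 ?r. zorder (\<lambda>z. H z + of_real c) q > 0}.
            real_of_int (zorder (\<lambda>z. H z + of_real c) q) * disc_weight q)
          = of_int (fact 15 * \<nu> 0) + fact 15 * (\<Sum>z\<in>{z\<in>strip. Im z > 1/2 \<and> \<mu> z \<noteq> 0}. real_of_int (\<mu> z) * orbit_weight z)"
        by (simp add: distrib_left)
      show "real (fact 15) * (\<Sum>q\<in>{q\<in>cball 0 ?r. zorder (\<lambda>z. H z + of_real c) q > 0}.
            real_of_int (zorder (\<lambda>z. H z + of_real c) q) * disc_weight q) \<in> \<int>"
        unfolding eq
        by (intro Ints_add Ints_of_int orbit_sum_integral sum_disc_eq_strip(1)[OF fin\<nu>, unfolded set2])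
           (use zJ in \<open>auto simp: \<mu>_def\<close>)
    next
      define \<nu> where "\<nu> q = max 0 (- zorder H q)" for q
      define \<mu> where "\<mu> w = max 0 (- zorder J w)" for w
      have \<nu>\<mu>: "\<nu> (ee z) = \<mu> z" if "z \<in> UHP" for z using zH0[OF that] by (simp add: \<nu>_def \<mu>_def)
      have set: "{q\<in>cball 0 ?r. \<nu> q \<noteq> 0} = {q\<in>cball 0 ?r. zorder H q < 0}"
        by (auto simp: \<nu>_def)
      have fin\<nu>: "finite {q\<in>cball 0 ?r. \<nu> q \<noteq> 0}"
        by (rule finite_subset[OF _ fin0]) (auto simp: \<nu>_def)
      have set2: "{z\<in>strip. Im z > 1/2 \<and> \<nu> (ee z) \<noteq> 0} = {z\<in>strip. Im z > 1/2 \<and> \<mu> z \<noteq> 0}"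
        using \<nu>\<mu> strip_UHP by auto
      have "(\<Sum>q\<in>{q\<in>cball 0 ?r. zorder H q < 0}. real_of_int (- zorder H q) * disc_weight q)
          = (\<Sum>q\<in>{q\<in>cball 0 ?r. \<nu> q \<noteq> 0}. real_of_int (\<nu> q) * disc_weight q)"
        unfolding set by (rule sum.cong) (auto simp: \<nu>_def)
      also have "\<dots> = real_of_int (\<nu> 0) + (\<Sum>z\<in>{z\<in>strip. Im z > 1/2 \<and> \<mu> z \<noteq> 0}. real_of_int (\<nu> (ee z)) * orbit_weight z)"
        using sum_disc_eq_strip(2)[OF fin\<nu>] unfolding set2 .
      also have "\<dots> = real_of_int (\<nu> 0) + (\<Sum>z\<in>{z\<in>strip. Im z > 1/2 \<and> \<mu> z \<noteq> 0}. real_of_int (\<mu> z) * orbit_weight z)"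
        using \<nu>\<mu> strip_UHP by (intro arg_cong[where f = "(+) _"] sum.cong) auto
      finally have eq: "real (fact 15) * (\<Sum>q\<in>{q\<in>cball 0 ?r. zorder H q < 0}. real_of_int (- zorder H q) * disc_weight q)
          = of_int (fact 15 * \<nu> 0) + fact 15 * (\<Sum>z\<in>{z\<in>strip. Im z > 1/2 \<and> \<mu> z \<noteq> 0}. real_of_int (\<mu> z) * orbit_weight z)"
        by (simp add: distrib_left)
      show "real (fact 15) * (\<Sum>q\<in>{q\<in>cball 0 ?r. zorder H q < 0}. real_of_int (- zorder H q) * disc_weight q) \<in> \<int>"
        unfolding eq
        by (intro Ints_add Ints_of_int orbit_sum_integral sum_disc_eq_strip(1)[OF fin\<nu>, unfolded set2])
           (use zJ0 in \<open>auto simp: \<mu>_def\<close>)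
    qed auto
    have set2: "{z\<in>strip. Im z > 1/2 \<and> zorder H (ee z) \<noteq> 0} = {z\<in>strip. Im z > 1/2 \<and> zorder J z \<noteq> 0}"
      using zH0 strip_UHP by auto
    have "(\<Sum>z\<in>{z\<in>strip. Im z > 1/2 \<and> zorder J z \<noteq> 0}. real_of_int (zorder H (ee z)) * orbit_weight z)
        = (\<Sum>z\<in>{z\<in>strip. Im z > 1/2 \<and> zorder J z \<noteq> 0}. real_of_int (zorder J z) * orbit_weight z)"
      using zH0 strip_UHP by (intro sum.cong) auto
    then show ?thesis
      using sum_disc_eq_strip[OF fin0] deg R unfolding set2 by simp
  qed
  then show "finite {z\<in>strip. Im z > 1/2 \<and> zorder J z \<noteq> 0}" by blast
  from goal show "R + (\<Sum>z\<in>{z\<in>strip. Im z > 1/2 \<and> zorder J z \<noteq> 0}. real_of_int (zorder J z) * orbit_weight z) = 0"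
    by blast
qed

section \<open>The Eisenstein series of weight 4\<close>

text \<open>Telescoping bounds the sum over positive integers by 2, and the two signs give 4. This
  constant feeds the explicit estimates for \<open>G4\<close>.\<close>

lemma finite_sum_inverse_squares:
  assumes "finite A" "(0::int) \<notin> A"
  shows "(\<Sum>m\<in>A. 1 / (real_of_int m)\<^sup>2) \<le> 4"
proof -
  have nat: "(\<Sum>k\<in>{1..N}. 1 / (real k)\<^sup>2) \<le> 2" for N :: nat
  proof -
    have "(\<Sum>k\<in>{1..N}. 1 / (real k)\<^sup>2) \<le> 2 - 1 / real N" if "N > 0"
      using that
    proof (induction N)
      case (Suc N)
      show ?case
      proof (cases "N = 0")
        case False
        have "1 / (real (Suc N))\<^sup>2 \<le> 1 / (real N * real (Suc N))"
          using False by (intro divide_left_mono) (auto simp: power2_eq_square)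
        also have "\<dots> = 1 / real N - 1 / real (Suc N)" using False by (simp add: field_simps)
        finally show ?thesis using Suc False by simp
      qed auto
    qed auto
    then show ?thesis by (cases "N = 0") (auto intro: order.trans)
  qed
  have half: "(\<Sum>m\<in>B. 1 / (real_of_int m)\<^sup>2) \<le> 2" if "finite B" "B \<subseteq> {1..}" for B :: "int set"
  proof -
    have "finite (nat ` B)" using that(1) by simp
    then obtain N where N: "\<forall>k\<in>nat ` B. k \<le> N" unfolding finite_nat_set_iff_bounded_le by blast
    have "(\<Sum>m\<in>B. 1 / (real_of_int m)\<^sup>2) = (\<Sum>k\<in>nat ` B. 1 / (real k)\<^sup>2)"
      using that by (subst sum.reindex) (auto simp: inj_on_def subset_iff intro!: sum.cong)
    also have "\<dots> \<le> (\<Sum>k\<in>{1..N}. 1 / (real k)\<^sup>2)"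
    proof (rule sum_mono2)
      show "nat ` B \<subseteq> {1..N}" using N that(2) by auto
    qed auto
    also have "\<dots> \<le> 2" by (rule nat)
    finally show ?thesis .
  qed
  define P where "P = {m\<in>A. m \<ge> 1}"
  define Q where "Q = {m\<in>A. m \<le> -1}"
  have "m \<ge> 1 \<or> m \<le> -1" if "m \<in> A" for m
  proof -
    have "m \<noteq> 0" using that assms by auto
    then show ?thesis by linarith
  qed
  then have A: "A = P \<union> Q" by (auto simp: P_def Q_def)
  have "finite P" "finite Q" "P \<inter> Q = {}" using assms by (auto simp: P_def Q_def)
  then have "(\<Sum>m\<in>A. 1 / (real_of_int m)\<^sup>2) = (\<Sum>m\<in>P. 1 / (real_of_int m)\<^sup>2) + (\<Sum>m\<in>Q. 1 / (real_of_int m)\<^sup>2)"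
    unfolding A by (rule sum.union_disjoint)
  also have "(\<Sum>m\<in>Q. 1 / (real_of_int m)\<^sup>2) = (\<Sum>m\<in>uminus ` Q. 1 / (real_of_int m)\<^sup>2)"
    by (subst sum.reindex) auto
  also have "(\<Sum>m\<in>P. 1 / (real_of_int m)\<^sup>2) + \<dots> \<le> 2 + 2"
    using assms by (intro add_mono half) (auto simp: P_def Q_def)
  finally show ?thesis by simp
qed

lemma finite_sum_inverse_fourth:
  assumes "finite A" "(0::int) \<notin> A"
  shows "(\<Sum>m\<in>A. 1 / (real_of_int m) ^ 4) \<le> 4"
proof -
  have "(\<Sum>m\<in>A. 1 / (real_of_int m) ^ 4) \<le> (\<Sum>m\<in>A. 1 / (real_of_int m)\<^sup>2)"
  proof (rule sum_mono)
    fix m assume "m \<in> A"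
    then have m: "m \<noteq> 0" using assms by auto
    then have "1 \<le> \<bar>real_of_int m\<bar>" by linarith
    then have "1 \<le> (real_of_int m)\<^sup>2" using one_le_power[of "\<bar>real_of_int m\<bar>" 2] by simp
    then have "(real_of_int m)\<^sup>2 * 1 \<le> (real_of_int m)\<^sup>2 * (real_of_int m)\<^sup>2" by (intro mult_left_mono) auto
    then have "(real_of_int m)\<^sup>2 \<le> (real_of_int m) ^ 4" by (simp flip: power_add)
    then show "1 / (real_of_int m) ^ 4 \<le> 1 / (real_of_int m)\<^sup>2" using m by (intro divide_left_mono) auto
  qed
  also have "\<dots> \<le> 4" by (rule finite_sum_inverse_squares[OF assms])
  finally show ?thesis .
qed

text \<open>Rounding shifts \<open>s\<close> into an interval of half-width 1/2. The central term is
  at most \<open>1 / a ^ 4\<close>; in the others the shifted integer has modulus at least half of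
  that of \<open>n\<close>, and the inequality between arithmetic and geometric mean bounds the
  denominator below by the square of \<open>n * a\<close>.\<close>

lemma lattice_row_sum_le:
  fixes s a :: real
  assumes B: "finite B" and a: "a > 0"
  shows "(\<Sum>n\<in>B. 1 / ((s + real_of_int n)\<^sup>2 + a\<^sup>2)\<^sup>2) \<le> 1 / a ^ 4 + 4 / a\<^sup>2"
proof -
  define r where "r = round s"
  define B' where "B' = (\<lambda>n. n + r) ` B"
  define s' where "s' = s - r"
  have s': "\<bar>s'\<bar> \<le> 1/2" using of_int_round_abs_le[of s] by (simp add: s'_def r_def abs_minus_commute)
  have "(\<Sum>n\<in>B. 1 / ((s + real_of_int n)\<^sup>2 + a\<^sup>2)\<^sup>2) = (\<Sum>n\<in>B'. 1 / ((s' + real_of_int n)\<^sup>2 + a\<^sup>2)\<^sup>2)"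
    unfolding B'_def by (subst sum.reindex) (auto simp: s'_def)
  also have "\<dots> \<le> (\<Sum>n\<in>insert 0 B'. 1 / ((s' + real_of_int n)\<^sup>2 + a\<^sup>2)\<^sup>2)"
    using B by (intro sum_mono2) (auto simp: B'_def)
  also have "\<dots> = 1 / ((s' + real_of_int 0)\<^sup>2 + a\<^sup>2)\<^sup>2 + (\<Sum>n\<in>B' - {0}. 1 / ((s' + real_of_int n)\<^sup>2 + a\<^sup>2)\<^sup>2)"
    using B by (subst sum.insert_remove) (auto simp: B'_def)
  also have "\<dots> \<le> 1 / a ^ 4 + (\<Sum>n\<in>B' - {0}. (1 / a\<^sup>2) * (1 / (real_of_int n)\<^sup>2))"
  proof (intro add_mono sum_mono)
    have "(a\<^sup>2)\<^sup>2 \<le> ((s' + real_of_int 0)\<^sup>2 + a\<^sup>2)\<^sup>2" by (intro power_mono) auto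
    then have "a ^ 4 \<le> ((s' + real_of_int 0)\<^sup>2 + a\<^sup>2)\<^sup>2" by (simp flip: power_mult)
    then show "1 / ((s' + real_of_int 0)\<^sup>2 + a\<^sup>2)\<^sup>2 \<le> 1 / a ^ 4"
      using a by (intro divide_left_mono mult_pos_pos) (auto simp: add_nonneg_pos)
  next
    fix n assume "n \<in> B' - {0}"
    then have n: "\<bar>real_of_int n\<bar> \<ge> 1" by auto
    have "\<bar>real_of_int n\<bar> / 2 \<le> \<bar>s' + real_of_int n\<bar>" using s' n by linarith
    then have "(\<bar>real_of_int n\<bar> / 2)\<^sup>2 \<le> \<bar>s' + real_of_int n\<bar>\<^sup>2" by (intro power_mono) auto
    moreover have "0 \<le> (\<bar>real_of_int n\<bar> / 2 - a)\<^sup>2" by simp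
    ultimately have "\<bar>real_of_int n\<bar> * a \<le> (s' + real_of_int n)\<^sup>2 + a\<^sup>2"
      by (simp add: power2_diff)
    then have "(\<bar>real_of_int n\<bar> * a)\<^sup>2 \<le> ((s' + real_of_int n)\<^sup>2 + a\<^sup>2)\<^sup>2"
      using a by (intro power_mono) auto
    then have "1 / ((s' + real_of_int n)\<^sup>2 + a\<^sup>2)\<^sup>2 \<le> 1 / (\<bar>real_of_int n\<bar> * a)\<^sup>2"
      using a n by (intro divide_left_mono mult_pos_pos) (auto simp: add_nonneg_pos)
    then show "1 / ((s' + real_of_int n)\<^sup>2 + a\<^sup>2)\<^sup>2 \<le> (1 / a\<^sup>2) * (1 / (real_of_int n)\<^sup>2)"
      by (simp add: power_mult_distrib mult.commute)
  qed
  also have "(\<Sum>n\<in>B' - {0}. (1 / a\<^sup>2) * (1 / (real_of_int n)\<^sup>2)) \<le> 1 / a\<^sup>2 * 4"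
    unfolding sum_distrib_left[symmetric]
    using B by (intro mult_left_mono finite_sum_inverse_squares) (auto simp: B'_def)
  finally show ?thesis by simp
qed

definition Lat :: "(int \<times> int) set" where "Lat = UNIV - {(0,0)}"
text \<open>The row \<open>m = 0\<close> does not depend on \<open>z\<close> and gives the constant
  term of \<open>G4\<close>; the other rows, \<open>Lat1\<close>, form the part that decays at the
  cusp.\<close>

definition Lat0 :: "(int \<times> int) set" where "Lat0 = {(0, n) |n. n \<noteq> 0}"
definition Lat1 :: "(int \<times> int) set" where "Lat1 = {(m, n). m \<noteq> 0}"

lemma Lat_split: "Lat = Lat0 \<union> Lat1" "Lat0 \<inter> Lat1 = {}"
  by (auto simp: Lat_def Lat0_def Lat1_def)

definition Lterm :: "complex \<Rightarrow> int \<times> int \<Rightarrow> complex" where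
  "Lterm z = (\<lambda>(m,n). 1 / (of_int m * z + of_int n) ^ 4)"

lemma norm_Lterm: "norm (Lterm z (m,n)) = 1 / ((m * Re z + n)\<^sup>2 + (m * Im z)\<^sup>2)\<^sup>2"
proof -
  have "norm (of_int m * z + of_int n) ^ 4 = ((norm (of_int m * z + of_int n))\<^sup>2)\<^sup>2"
    by (simp flip: power_mult)
  also have "(norm (of_int m * z + of_int n))\<^sup>2 = (m * Re z + n)\<^sup>2 + (m * Im z)\<^sup>2"
    by (simp add: cmod_power2)
  finally show ?thesis by (simp add: Lterm_def norm_divide norm_power)
qed

text \<open>Each row is bounded by \<open>lattice_row_sum_le\<close> with \<open>a\<close> the
  modulus of \<open>m * Im z\<close>; summing over \<open>m\<close> costs a factor 4 in both terms,
  whence 4 and 16.\<close>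

lemma Lat1_finite_sum_le:
  assumes z: "z \<in> UHP" and F: "finite F" "F \<subseteq> Lat1"
  shows "(\<Sum>p\<in>F. norm (Lterm z p)) \<le> 4 / Im z ^ 4 + 16 / (Im z)\<^sup>2"
proof -
  have y: "Im z > 0" using z by (simp add: UHP_def)
  have "(\<Sum>p\<in>F. norm (Lterm z p)) \<le> (\<Sum>p\<in>fst ` F \<times> snd ` F. norm (Lterm z p))"
  proof (rule sum_mono2)
    show "F \<subseteq> fst ` F \<times> snd ` F" by (auto intro: rev_image_eqI)
  qed (use F in auto)
  also have "\<dots> = (\<Sum>m\<in>fst ` F. \<Sum>n\<in>snd ` F. norm (Lterm z (m,n)))"
    by (simp add: sum.cartesian_product)
  also have "\<dots> \<le> (\<Sum>m\<in>fst ` F. 1 / Im z ^ 4 * (1 / real_of_int m ^ 4) + 4 / (Im z)\<^sup>2 * (1 / (real_of_int m)\<^sup>2))"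
  proof (rule sum_mono)
    fix m assume "m \<in> fst ` F"
    then have m: "m \<noteq> 0" using F by (auto simp: Lat1_def)
    define a where "a = \<bar>m * Im z\<bar>"
    have a: "a > 0" using m y by (simp add: a_def)
    have "(\<Sum>n\<in>snd ` F. norm (Lterm z (m,n))) = (\<Sum>n\<in>snd ` F. 1 / ((m * Re z + real_of_int n)\<^sup>2 + a\<^sup>2)\<^sup>2)"
      by (simp add: norm_Lterm a_def)
    also have "\<dots> \<le> 1 / a ^ 4 + 4 / a\<^sup>2" using F a by (intro lattice_row_sum_le) auto
    also have "a ^ 4 = (m * Im z) ^ 4" by (simp add: a_def power_even_abs)
    also have "a\<^sup>2 = (m * Im z)\<^sup>2" by (simp add: a_def)
    finally show "(\<Sum>n\<in>snd ` F. norm (Lterm z (m,n)))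
        \<le> 1 / Im z ^ 4 * (1 / real_of_int m ^ 4) + 4 / (Im z)\<^sup>2 * (1 / (real_of_int m)\<^sup>2)"
      by (simp add: power_mult_distrib mult.commute)
  qed
  also have "\<dots> = 1 / Im z ^ 4 * (\<Sum>m\<in>fst ` F. 1 / real_of_int m ^ 4) + 4 / (Im z)\<^sup>2 * (\<Sum>m\<in>fst ` F. 1 / (real_of_int m)\<^sup>2)"
    by (simp add: sum.distrib sum_distrib_left)
  also have "\<dots> \<le> 1 / Im z ^ 4 * 4 + 4 / (Im z)\<^sup>2 * 4"
    using y F by (intro add_mono mult_left_mono finite_sum_inverse_fourth finite_sum_inverse_squares)
       (auto simp: Lat1_def)
  finally show ?thesis by simp
qed

lemma Lat0_finite_sum_le:
  assumes F: "finite F" "F \<subseteq> Lat0"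
  shows "(\<Sum>p\<in>F. norm (Lterm z p)) \<le> 4"
proof -
  have "inj_on snd F" using F by (auto simp: inj_on_def Lat0_def)
  then have "(\<Sum>n\<in>snd ` F. 1 / real_of_int n ^ 4) = (\<Sum>p\<in>F. 1 / real_of_int (snd p) ^ 4)"
    by (subst sum.reindex) auto
  also have "\<dots> = (\<Sum>p\<in>F. norm (Lterm z p))"
  proof (rule sum.cong[OF refl])
    fix p assume "p \<in> F"
    then obtain n where "p = (0, n)" using F by (auto simp: Lat0_def)
    then show "1 / real_of_int (snd p) ^ 4 = norm (Lterm z p)"
      by (simp add: Lterm_def norm_divide norm_power power_even_abs)
  qed
  finally have eq: "(\<Sum>n\<in>snd ` F. 1 / real_of_int n ^ 4) = (\<Sum>p\<in>F. norm (Lterm z p))" .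
  have "0 \<notin> snd ` F" using F by (auto simp: Lat0_def)
  from finite_sum_inverse_fourth[OF _ this] show ?thesis unfolding eq using F by simp
qed

lemma Lterm_abs_summable_i: "(\<lambda>p. norm (Lterm \<i> p)) summable_on Lat"
proof (rule nonneg_bdd_above_summable_on)
  show "bdd_above (sum (\<lambda>p. norm (Lterm \<i> p)) ` {F. F \<subseteq> Lat \<and> finite F})"
  proof (rule bdd_aboveI2)
    fix F assume F: "F \<in> {F. F \<subseteq> Lat \<and> finite F}"
    have "(\<Sum>p\<in>F. norm (Lterm \<i> p)) = (\<Sum>p\<in>F \<inter> Lat0. norm (Lterm \<i> p)) + (\<Sum>p\<in>F \<inter> Lat1. norm (Lterm \<i> p))"
      using F Lat_split by (subst sum.union_disjoint[symmetric]) (auto intro!: sum.cong)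
    also have "\<dots> \<le> 4 + (4 / Im \<i> ^ 4 + 16 / (Im \<i>)\<^sup>2)"
      using F by (intro add_mono Lat0_finite_sum_le Lat1_finite_sum_le) (auto simp: UHP_def)
    finally show "(\<Sum>p\<in>F. norm (Lterm \<i> p)) \<le> 24" by simp
  qed
qed auto

text \<open>The quadratic forms given by the squared moduli of \<open>m * z + n\<close> and
  \<open>m * \<i> + n\<close> are comparable, with a constant depending only on bounds for
  \<open>z\<close>. The single series at \<i> therefore dominates all others, uniformly on compact
  sets.\<close>

lemma Lterm_majorant:
  assumes "y > 0" "y \<le> Im z" "\<bar>Re z\<bar> \<le> X" "p \<in> Lat"
  shows "norm (Lterm z p) \<le> (2 + (2 * X\<^sup>2 + 1) / y\<^sup>2)\<^sup>2 * norm (Lterm \<i> p)"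
proof -
  obtain m n where p: "p = (m,n)" by (cases p)
  define Q where "Q = (m * Re z + n)\<^sup>2 + (m * Im z)\<^sup>2"
  define K where "K = 2 + (2 * X\<^sup>2 + 1) / y\<^sup>2"
  have K: "K > 0" using assms by (auto simp: K_def intro!: add_pos_nonneg)
  have s: "(real_of_int m)\<^sup>2 + (real_of_int n)\<^sup>2 > 0"
    using assms(4) p by (auto simp: Lat_def sum_power2_gt_zero_iff)
  have "(real_of_int m)\<^sup>2 * y\<^sup>2 \<le> (real_of_int m)\<^sup>2 * (Im z)\<^sup>2" using assms by (intro mult_left_mono power_mono) auto
  also have "\<dots> \<le> Q" by (simp add: Q_def power_mult_distrib)
  finally have m: "(real_of_int m)\<^sup>2 \<le> Q / y\<^sup>2" using assms by (simp add: field_simps)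
  have "(real_of_int n)\<^sup>2 = ((m * Re z + n) + (- (m * Re z)))\<^sup>2" by simp
  also have "\<dots> \<le> 2 * (m * Re z + n)\<^sup>2 + 2 * (m * Re z)\<^sup>2"
    using zero_le_power2[of "(m * Re z + n) - (- (m * Re z))"] by (simp add: power2_eq_square algebra_simps)
  also have "\<dots> \<le> 2 * Q + 2 * (X\<^sup>2 * (Q / y\<^sup>2))"
  proof -
    have "(m * Re z)\<^sup>2 = (Re z)\<^sup>2 * (real_of_int m)\<^sup>2" by (simp add: power_mult_distrib)
    also have "\<dots> \<le> X\<^sup>2 * (Q / y\<^sup>2)"
      using m assms by (intro mult_mono) (auto simp: abs_le_square_iff[symmetric])
    finally have "2 * (m * Re z)\<^sup>2 \<le> 2 * (X\<^sup>2 * (Q / y\<^sup>2))" by simp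
    moreover have "2 * (m * Re z + n)\<^sup>2 \<le> 2 * Q" by (simp add: Q_def)
    ultimately show ?thesis by linarith
  qed
  finally have "(real_of_int m)\<^sup>2 + (real_of_int n)\<^sup>2 \<le> K * Q"
    using m by (simp add: K_def algebra_simps add_divide_distrib)
  then have le: "((real_of_int m)\<^sup>2 + (real_of_int n)\<^sup>2)\<^sup>2 \<le> (K * Q)\<^sup>2" using s by (intro power_mono) auto
  have "Q > 0"
  proof -
    have "K * Q > 0" using s \<open>(real_of_int m)\<^sup>2 + (real_of_int n)\<^sup>2 \<le> K * Q\<close> by linarith
    then show ?thesis using K by (simp add: zero_less_mult_iff)
  qed
  have "1 / Q\<^sup>2 = K\<^sup>2 * (1 / (K * Q)\<^sup>2)" using K by (simp add: power_mult_distrib)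
  also have "\<dots> \<le> K\<^sup>2 * (1 / ((real_of_int m)\<^sup>2 + (real_of_int n)\<^sup>2)\<^sup>2)"
    using le s K \<open>Q > 0\<close> by (intro mult_left_mono divide_left_mono mult_pos_pos zero_less_power) auto
  finally show ?thesis by (simp add: p norm_Lterm Q_def K_def add.commute)
qed

lemma Lterm_abs_summable:
  assumes "z \<in> UHP" shows "(\<lambda>p. norm (Lterm z p)) summable_on Lat"
proof -
  define K where "K = (2 + (2 * \<bar>Re z\<bar>\<^sup>2 + 1) / (Im z)\<^sup>2)\<^sup>2"
  have "(\<lambda>p. K * norm (Lterm \<i> p)) summable_on Lat"
    using Lterm_abs_summable_i by (rule summable_on_cmult_right)
  moreover have "norm (Lterm z p) \<le> K * norm (Lterm \<i> p)" if "p \<in> Lat" for p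
    using Lterm_majorant[of "Im z" z "\<bar>Re z\<bar>" p] assms that by (simp add: UHP_def K_def)
  ultimately show ?thesis by (rule Infinite_Sum.abs_summable_on_comparison_test')
qed

definition G4 :: "complex \<Rightarrow> complex" where "G4 z = infsum (Lterm z) Lat"

lemma G4_holomorphic: "G4 holomorphic_on UHP"
proof -
  have "\<exists>r>0. G4 holomorphic_on ball z0 r" if z0: "z0 \<in> UHP" for z0
  proof -
    define r where "r = Im z0 / 2"
    have r: "r > 0" using z0 by (simp add: r_def UHP_def)
    have bd: "r \<le> Im z \<and> \<bar>Re z\<bar> \<le> \<bar>Re z0\<bar> + r" if "z \<in> cball z0 r" for z
    proof -
      have "norm (z0 - z) \<le> r" using that by (simp add: dist_norm)
      then have "\<bar>Im (z0 - z)\<bar> \<le> r" "\<bar>Re (z0 - z)\<bar> \<le> r"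
        using abs_Im_le_cmod[of "z0 - z"] abs_Re_le_cmod[of "z0 - z"] by linarith+
      moreover have "r = Im z0 / 2" by (simp add: r_def)
      ultimately show ?thesis unfolding minus_complex.simps by linarith
    qed
    define K where "K = (2 + (2 * (\<bar>Re z0\<bar> + r)\<^sup>2 + 1) / r\<^sup>2)\<^sup>2"
    \<comment> \<open>The M-test with a multiple of the series at \<i> as majorant; finite partial
      sums are holomorphic, and so is their locally uniform limit.\<close>
    have ul: "uniform_limit (cball z0 r) (\<lambda>X z. \<Sum>p\<in>X. Lterm z p) (\<lambda>z. \<Sum>\<^sub>\<infinity>p\<in>Lat. Lterm z p) (finite_subsets_at_top Lat)"
    proof (rule Weierstrass_m_test_general)
      show "(\<lambda>p. K * norm (Lterm \<i> p)) summable_on Lat"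
        using Lterm_abs_summable_i by (rule summable_on_cmult_right)
      show "norm (Lterm z p) \<le> K * norm (Lterm \<i> p)" if "p \<in> Lat" "z \<in> cball z0 r" for p z
        unfolding K_def using Lterm_majorant[OF r _ _ that(1)] bd[OF that(2)] by blast
    qed
    have hol: "(\<lambda>z. \<Sum>p\<in>X. Lterm z p) holomorphic_on cball z0 r" if "X \<subseteq> Lat" for X
      unfolding Lterm_def case_prod_unfold
    proof (intro holomorphic_intros)
      fix z p assume z: "z \<in> cball z0 r" and p: "p \<in> X"
      show "(of_int (fst p) * z + of_int (snd p)) ^ 4 \<noteq> 0"
      proof
        assume "(of_int (fst p) * z + of_int (snd p)) ^ 4 = 0"
        then have eq: "of_int (fst p) * z + of_int (snd p) = 0" by simp
        then have "Im (of_int (fst p) * z + of_int (snd p)) = 0" by simp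
        then have "fst p = 0" using bd[OF z] r by auto
        moreover from this have "snd p = 0" using eq by simp
        ultimately show False using p that by (auto simp: Lat_def prod_eq_iff)
      qed
    qed
    have "eventually (\<lambda>X. continuous_on (cball z0 r) (\<lambda>z. \<Sum>p\<in>X. Lterm z p) \<and>
        (\<lambda>z. \<Sum>p\<in>X. Lterm z p) holomorphic_on ball z0 r) (finite_subsets_at_top Lat)"
      using hol by (intro eventually_finite_subsets_at_top_weakI)
        (auto intro: holomorphic_on_imp_continuous_on holomorphic_on_subset[OF _ ball_subset_cball])
    from holomorphic_uniform_limit[OF this ul] have "(\<lambda>z. \<Sum>\<^sub>\<infinity>p\<in>Lat. Lterm z p) holomorphic_on ball z0 r"
      by auto
    then show ?thesis using r unfolding G4_def[abs_def] by blast
  qed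
  then have "G4 analytic_on UHP" by (simp add: analytic_on_def)
  then show ?thesis by (rule analytic_imp_holomorphic)
qed

text \<open>The cusp value of \<open>G4\<close>, that is 2 zeta(4); the point \<i> is immaterial,
  since these terms do not involve the variable.\<close>

definition c4 :: complex where "c4 = infsum (Lterm \<i>) Lat0"

lemma Lterm_Lat0: "p \<in> Lat0 \<Longrightarrow> Lterm z p = of_real (norm (Lterm \<i> p))"
  by (auto simp: Lat0_def Lterm_def norm_divide norm_power power_even_abs)

text \<open>The terms \<open>n = 1\<close> and \<open>n = -1\<close> alone give 2. These two bounds
  replace the exact value; the lower one is what a second zero of \<open>G4D\<close> would
  violate.\<close>

lemma c4_bounds: "norm c4 \<ge> 2" "norm c4 \<le> 4"
proof -
  have sm: "(\<lambda>p. norm (Lterm \<i> p)) summable_on Lat0"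
    by (rule summable_on_subset_banach[OF Lterm_abs_summable_i]) (simp add: Lat_split)
  have "c4 = infsum (\<lambda>p. complex_of_real (norm (Lterm \<i> p))) Lat0"
    unfolding c4_def by (intro infsum_cong Lterm_Lat0)
  also have "\<dots> = complex_of_real (infsum (\<lambda>p. norm (Lterm \<i> p)) Lat0)"
    by (rule infsum_comm_additive[unfolded o_def]) (use sm in \<open>auto simp: Modules.additive_def\<close>)
  finally have c: "c4 = of_real (infsum (\<lambda>p. norm (Lterm \<i> p)) Lat0)" .
  have "(\<Sum>p\<in>{(0,1),(0,-1)}. norm (Lterm \<i> p)) \<le> infsum (\<lambda>p. norm (Lterm \<i> p)) Lat0"
    by (rule finite_sum_le_infsum[OF sm]) (auto simp: Lat0_def)
  then have ge: "infsum (\<lambda>p. norm (Lterm \<i> p)) Lat0 \<ge> 2" by (simp add: Lterm_def)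
  have "infsum (\<lambda>p. norm (Lterm \<i> p)) Lat0 \<le> 4"
    by (rule infsum_le_finite_sums[OF sm]) (rule Lat0_finite_sum_le)
  with ge show "norm c4 \<ge> 2" "norm c4 \<le> 4" unfolding c by simp_all
qed

lemma G4_bound:
  assumes z: "z \<in> UHP"
  shows "norm (G4 z - c4) \<le> 4 / Im z ^ 4 + 16 / (Im z)\<^sup>2"
proof -
  have abs0: "(\<lambda>p. norm (Lterm z p)) summable_on Lat0"
    by (rule summable_on_subset_banach[OF Lterm_abs_summable[OF z]]) (simp add: Lat_split)
  have abs1: "(\<lambda>p. norm (Lterm z p)) summable_on Lat1"
    by (rule summable_on_subset_banach[OF Lterm_abs_summable[OF z]]) (simp add: Lat_split)
  have s0: "Lterm z summable_on Lat0" by (rule abs_summable_summable[OF abs0])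
  have s1: "Lterm z summable_on Lat1" by (rule abs_summable_summable[OF abs1])
  have "G4 z = infsum (Lterm z) Lat0 + infsum (Lterm z) Lat1"
    unfolding G4_def Lat_split(1) by (rule infsum_Un_disjoint[OF s0 s1 Lat_split(2)])
  also have "infsum (Lterm z) Lat0 = c4"
    unfolding c4_def by (intro infsum_cong) (metis Lterm_Lat0)
  finally have "norm (G4 z - c4) = norm (infsum (Lterm z) Lat1)" by (simp only: add_diff_cancel_left')
  also have "\<dots> \<le> infsum (\<lambda>p. norm (Lterm z p)) Lat1" by (rule norm_infsum_bound[OF abs1])
  also have "\<dots> \<le> 4 / Im z ^ 4 + 16 / (Im z)\<^sup>2"
    by (rule infsum_le_finite_sums[OF abs1]) (rule Lat1_finite_sum_le[OF z])
  finally show ?thesis .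
qed

text \<open>Multiplying row vectors by \<open>A\<close> on the right permutes the nonzero lattice
  points, and each term picks up the fourth power of the automorphy factor.\<close>

lemma G4_modular:
  assumes A: "A \<in> SL2Z" and z: "z \<in> UHP"
  shows "G4 (mob A z) = autfac A z ^ 4 * G4 z"
proof -
  obtain a b c d where m: "A = imat a b c d" "a * d - b * c = 1" using A SL2Z_E by metis
  define h where "h = (\<lambda>(m,n). (m * a + n * c, m * b + n * d))"
  define h' where "h' = (\<lambda>(m,n). (m * d - n * c, n * a - m * b))"
  have jz: "autfac A z \<noteq> 0" using autfac_nonzero[OF SL2Z_det[OF A] z] .
  have hh: "h' (h p) = p" "h (h' p) = p" for p
  proof -
    obtain x y where p: "p = (x,y)" by (cases p)
    have "(x * a + y * c) * d - (x * b + y * d) * c = x * (a * d - b * c)"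
      "(x * b + y * d) * a - (x * a + y * c) * b = y * (a * d - b * c)"
      "(x * d - y * c) * a + (y * a - x * b) * c = x * (a * d - b * c)"
      "(x * d - y * c) * b + (y * a - x * b) * d = y * (a * d - b * c)" by (simp_all add: algebra_simps)
    note * = this[unfolded m(2) mult_1_right]
    show "h' (h p) = p" "h (h' p) = p" by (simp_all only: p h_def h'_def prod.case *)
  qed
  have h0: "h (0,0) = (0,0)" "h' (0,0) = (0,0)" by (simp_all add: h_def h'_def)
  have bij: "bij_betw h Lat Lat"
  proof (rule bij_betw_byWitness[where f' = h'])
    show "h ` Lat \<subseteq> Lat"
    proof
      fix q assume "q \<in> h ` Lat"
      then obtain p where p: "q = h p" "p \<noteq> (0,0)" by (auto simp: Lat_def)
      then have "q \<noteq> (0,0)" using hh(1)[of p] h0 by auto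
      then show "q \<in> Lat" by (simp add: Lat_def)
    qed
    show "h' ` Lat \<subseteq> Lat"
    proof
      fix q assume "q \<in> h' ` Lat"
      then obtain p where p: "q = h' p" "p \<noteq> (0,0)" by (auto simp: Lat_def)
      then have "q \<noteq> (0,0)" using hh(2)[of p] h0 by auto
      then show "q \<in> Lat" by (simp add: Lat_def)
    qed
  qed (use hh in auto)
  have "Lterm (mob A z) p = autfac A z ^ 4 * Lterm z (h p)" for p
  proof -
    obtain x y where p: "p = (x,y)" by (cases p)
    have "of_int x * mob A z + of_int y = (of_int (x * a + y * c) * z + of_int (x * b + y * d)) / autfac A z"
    proof -
      have "of_int x * mob A z + of_int y = (of_int x * (of_real (A$1$1) * z + of_real (A$1$2)) + of_int y * autfac A z) / autfac A z"
        using jz unfolding mob_autfac by (simp add: add_divide_distrib[of _ "of_int y * autfac A z"])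
      also have "of_int x * (of_real (A$1$1) * z + of_real (A$1$2)) + of_int y * autfac A z
          = of_int (x * a + y * c) * z + of_int (x * b + y * d)"
        by (simp add: m(1) autfac_imat distrib_left distrib_right mult.assoc)
      finally show ?thesis .
    qed
    then show ?thesis unfolding p Lterm_def h_def by (simp add: power_divide)
  qed
  then have "G4 (mob A z) = (\<Sum>\<^sub>\<infinity>p\<in>Lat. autfac A z ^ 4 * Lterm z (h p))"
    unfolding G4_def by (intro infsum_cong)
  also have "\<dots> = autfac A z ^ 4 * (\<Sum>\<^sub>\<infinity>p\<in>Lat. Lterm z (h p))" by (rule infsum_cmult_right')
  also have "(\<Sum>\<^sub>\<infinity>p\<in>Lat. Lterm z (h p)) = G4 z" unfolding G4_def by (rule infsum_reindex_bij_betw[OF bij])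
  finally show ?thesis .
qed

lemma G4_periodic: "z \<in> UHP \<Longrightarrow> G4 (z + of_int n) = G4 z"
  using G4_modular[of "Tpow n" z] by simp

lemma G4_tendsto: "(G4 \<longlongrightarrow> c4) at_iinf"
proof -
  have "((\<lambda>z. G4 z - c4) \<longlongrightarrow> 0) at_iinf"
  proof (rule Lim_null_comparison)
    show "eventually (\<lambda>z. norm (G4 z - c4) \<le> 4 / Im z ^ 4 + 16 / (Im z)\<^sup>2) at_iinf"
      unfolding eventually_at_iinf by (intro exI[of _ 0]) (auto intro!: G4_bound simp: UHP_def)
    have "((\<lambda>y::real. 4 / y ^ 4 + 16 / y\<^sup>2) \<longlongrightarrow> 0 + 0) at_top"
      by (intro tendsto_add real_tendsto_divide_at_top[OF tendsto_const] filterlim_pow_at_top filterlim_ident) auto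
    then show "((\<lambda>z. 4 / Im z ^ 4 + 16 / (Im z)\<^sup>2) \<longlongrightarrow> 0) at_iinf"
      using filterlim_compose[of "\<lambda>y::real. 4 / y ^ 4 + 16 / y\<^sup>2", OF _ filterlim_Im_at_iinf] by simp
  qed
  then show ?thesis by (simp add: LIM_zero_iff)
qed

section \<open>The zeros of G4, located in the q-disc\<close>

definition G4D :: "complex \<Rightarrow> complex" where "G4D q = (if q = 0 then c4 else G4 (qlift q))"

lemma G4D_ee: "z \<in> UHP \<Longrightarrow> G4D (ee z) = G4 z"
  using periodic_qlift[of G4 z] G4_periodic by (simp add: G4D_def)

lemma G4D_holomorphic: "G4D holomorphic_on ball 0 1"
proof (rule no_isolated_singularity'[where K = "{0}"])
  show "G4D holomorphic_on ball 0 1 - {0}"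
  proof -
    have "G4D analytic_on {q0}" if "q0 \<in> ball 0 1 - {0}" for q0
    proof -
      have "q0 \<noteq> 0" "norm q0 < 1" using that by auto
      from qlift_local_branch[OF this] obtain U L where UL: "open U" "q0 \<in> U" "U \<subseteq> ball 0 1 - {0}"
        "L holomorphic_on U" "\<And>q. q \<in> U \<Longrightarrow> L q \<in> UHP" "\<And>q. q \<in> U \<Longrightarrow> ee (L q) = q"
        by blast
      have "(G4 \<circ> L) holomorphic_on U"
        using UL by (intro holomorphic_on_compose_gen[OF _ G4_holomorphic]) auto
      moreover have "G4D q = (G4 \<circ> L) q" if "q \<in> U" for q
        using G4D_ee[of "L q"] UL that by simp
      ultimately have "G4D holomorphic_on U" by (simp cong: holomorphic_cong)
      then show ?thesis using UL analytic_at by blast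
    qed
    then have "G4D analytic_on ball 0 1 - {0}" using analytic_on_analytic_at by blast
    then show ?thesis by (rule analytic_imp_holomorphic)
  qed
  fix z :: complex assume "z \<in> {0}"
  have "(G4D \<longlongrightarrow> c4) (at 0)"
  proof (rule tendstoI)
    fix e :: real assume "e > 0"
    then have "eventually (\<lambda>z. dist (G4 z) c4 < e) at_iinf" using G4_tendsto tendstoD by blast
    then obtain Y where Y: "\<And>z. Im z > Y \<Longrightarrow> dist (G4 z) c4 < e" unfolding eventually_at_iinf by blast
    have "eventually (\<lambda>q. q \<in> ball 0 (exp (- 2 * pi * Y)) - {0}) (at (0::complex))"
      by (intro eventually_at_in_open) auto
    then show "eventually (\<lambda>q. dist (G4D q) c4 < e) (at 0)"
    proof eventually_elim
      case (elim q)
      then have q: "q \<noteq> 0" by auto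
      have "exp (- 2 * pi * Im (qlift q)) < exp (- 2 * pi * Y)" using elim Im_qlift[OF q] by simp
      then have "pi * Y < pi * Im (qlift q)" by simp
      then have "Im (qlift q) > Y" using pi_gt_zero by (subst (asm) mult_less_cancel_left_pos) auto
      then show ?case using Y q by (simp add: G4D_def)
    qed
  qed
  then show "(G4D \<longlongrightarrow> G4D z) (at z within ball 0 1)"
    using \<open>z \<in> {0}\<close> tendsto_within_subset[of G4D "nhds c4" 0 UNIV "ball 0 1"] by (simp add: G4D_def)
qed auto

lemma holomorphic_factor_linear:
  assumes "f holomorphic_on ball 0 1" "f a = 0" 
  obtains g where "g holomorphic_on ball 0 1" "\<And>z. f z = (z - a) * g z"
proof
  show "(\<lambda>z. if z = a then deriv f a else (f z - f a) / (z - a)) holomorphic_on ball 0 1"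
    by (rule pole_lemma_open[OF assms(1) open_ball])
  show "f z = (z - a) * (if z = a then deriv f a else (f z - f a) / (z - a))" for z
    using assms(2) by (cases "z = a") simp_all
qed

text \<open>The claim is that exp (pi (sqrt 3 - 1/2)) is at least 28. The bounds 1.7 for
  \<open>sqrt 3\<close> and 3 for \<open>pi\<close> make the exponent at least 3.6, and
  \<open>exp 3.6\<close> is the fourth power of \<open>exp 0.9\<close>, which is at least 1 + 0.9 +
  0.405. The number 28 leaves a gap of 27 inner radii between the two circles in
  \<open>G4D_zero_unique\<close>.\<close>

lemma exp_ratio_bound: "28 * exp (- pi * sqrt 3) \<le> exp (- pi / 2)"
proof -
  have s: "sqrt 3 \<ge> 1.7" by (rule real_le_rsqrt) (simp add: power2_eq_square)
  have "3 * 1.2 \<le> pi * (sqrt 3 - 1 / 2)" using s pi_gt3 by (intro mult_mono) auto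
  then have le: "exp 3.6 \<le> exp (pi * (sqrt 3 - 1 / 2))" by simp
  have "2.305 \<le> exp (0.9::real)" using exp_lower_Taylor_quadratic[of "0.9"] by (simp add: power2_eq_square)
  then have "2.305 ^ 4 \<le> exp (0.9::real) ^ 4" by (intro power_mono) auto
  also have "exp (0.9::real) ^ 4 = exp 3.6" using exp_of_nat_mult[of 4 "0.9::real"] by simp
  finally have "28 \<le> exp (3.6::real)" by (simp add: power4_eq_xxxx)
  with le have "28 \<le> exp (pi * (sqrt 3 - 1 / 2))" by linarith
  then have "28 * exp (- pi * sqrt 3) \<le> exp (pi * (sqrt 3 - 1 / 2)) * exp (- pi * sqrt 3)"
    by (intro mult_right_mono) auto
  also have "\<dots> = exp (pi * (sqrt 3 - 1 / 2) + - pi * sqrt 3)" by (rule exp_add[symmetric])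
  also have "pi * (sqrt 3 - 1 / 2) + - pi * sqrt 3 = - pi / 2" by (simp add: right_diff_distrib)
  finally show ?thesis .
qed

text \<open>The disc \<open>|q| \<le> exp (- pi * sqrt 3)\<close> is \<open>Im \<tau> \<ge> sqrt 3 / 2\<close>. Dividing out two zeros there and applying the
  maximum principle on \<open>|q| = exp (- pi / 2)\<close>, i.e. \<open>Im \<tau> = 1/4\<close>, would make the value at the cusp
  smaller than 2.\<close>

lemma G4D_zero_unique:
  assumes q1: "norm q1 \<le> exp (- pi * sqrt 3)" "G4D q1 = 0"
  shows "zorder G4D q1 = 1" "\<And>q2. norm q2 \<le> exp (- pi * sqrt 3) \<Longrightarrow> G4D q2 = 0 \<Longrightarrow> q2 = q1"
proof -
  let ?r = "exp (- pi * sqrt 3)" and ?R = "exp (- pi / 2)"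
  have r1: "?r < 1" and R1: "?R < 1" by simp_all
  have rR: "28 * ?r \<le> ?R" by (rule exp_ratio_bound)
  have rp: "?r > 0" by simp
  have rR': "27 * ?r \<le> ?R - ?r" using rR by simp
  obtain g where g: "g holomorphic_on ball 0 1" "\<And>z. G4D z = (z - q1) * g z"
    using holomorphic_factor_linear[OF G4D_holomorphic q1(2)] by blast
  \<comment> \<open>Taking \<open>q2 = q1\<close> gives simplicity of the zero, and other
    \<open>q2\<close> give uniqueness.\<close>
  have gnz: "g q2 \<noteq> 0" if q2: "norm q2 \<le> ?r" for q2
  proof
    assume "g q2 = 0"
    then obtain w where w: "w holomorphic_on ball 0 1" "\<And>z. g z = (z - q2) * w z"
      using holomorphic_factor_linear[OF g(1)] by blast
    have G: "G4D z = (z - q1) * (z - q2) * w z" for z using g(2) w(2) by simp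
    have sub: "cball 0 ?R \<subseteq> ball (0::complex) 1" using R1 by (meson mem_ball_0 mem_cball_0 order.strict_trans1 subsetI)
    \<comment> \<open>At height 1/4 the estimate \<open>G4_bound\<close> is 1024 + 256, and the cusp
      value adds at most 4. On this circle both linear factors are at least the difference of the
      radii.\<close>
    have "norm (w 0) \<le> 1284 / (?R - ?r)\<^sup>2"
    proof (rule maximum_modulus_frontier[of w "cball 0 ?R"])
      show "w holomorphic_on interior (cball (0::complex) ?R)"
        by (rule holomorphic_on_subset[OF w(1)]) (use sub interior_subset in blast)
      show "continuous_on (closure (cball 0 ?R)) w"
        using holomorphic_on_imp_continuous_on[OF holomorphic_on_subset[OF w(1) sub]] by simp
      fix q :: complex assume "q \<in> frontier (cball 0 ?R)"
      then have nq: "norm q = ?R" by simp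
      then have q0: "q \<noteq> 0" using exp_gt_zero[of "- pi / 2"] by (metis norm_zero less_irrefl)
      have "exp (- 2 * pi * Im (qlift q)) = exp (- pi / 2)" using Im_qlift[OF q0] nq by simp
      then have Im: "Im (qlift q) = 1/4" by simp
      then have U: "qlift q \<in> UHP" by (simp add: UHP_def)
      have "norm (G4D q) \<le> norm (G4 (qlift q) - c4) + norm c4"
        using q0 norm_triangle_ineq[of "G4 (qlift q) - c4" c4] by (simp add: G4D_def)
      also have "\<dots> \<le> 1280 + 4"
        using G4_bound[OF U] c4_bounds(2) unfolding Im by (simp add: power_divide)
      finally have "norm (G4D q) \<le> 1284" by simp
      then have "norm (q - q1) * norm (q - q2) * norm (w q) \<le> 1284" using G by (simp add: norm_mult)
      moreover have "(?R - ?r) * (?R - ?r) * norm (w q) \<le> norm (q - q1) * norm (q - q2) * norm (w q)"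
      proof (intro mult_right_mono mult_mono)
        show "?R - ?r \<le> norm (q - q1)" using norm_triangle_ineq2[of q q1] nq q1 by linarith
        show "?R - ?r \<le> norm (q - q2)" using norm_triangle_ineq2[of q q2] nq q2 by linarith
        show "0 \<le> ?R - ?r" using rR' rp by linarith
      qed auto
      ultimately have "(?R - ?r)\<^sup>2 * norm (w q) \<le> 1284" by (simp add: power2_eq_square)
      moreover have "(?R - ?r)\<^sup>2 > 0" using rR' rp by (smt (verit) zero_less_power)
      ultimately show "norm (w q) \<le> 1284 / (?R - ?r)\<^sup>2" by (simp add: field_simps)
    qed auto
    moreover have "norm c4 = norm q1 * norm q2 * norm (w 0)"
      using G[of 0] by (simp add: G4D_def flip: norm_mult)
    ultimately have "norm c4 \<le> ?r * ?r * (1284 / (?R - ?r)\<^sup>2)"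
      using q1 q2 by (simp only:) (intro mult_mono, auto)
    \<comment> \<open>With the gap at least \<open>27 * ?r\<close> the radii cancel, leaving 1284 /
      729, which is less than 2.\<close>
    also have "\<dots> \<le> ?r * ?r * (1284 / (27 * ?r)\<^sup>2)"
    proof (intro mult_left_mono divide_left_mono power_mono)
      have "0 < ?R - ?r" using rR' rp by linarith
      then show "0 < (?R - ?r)\<^sup>2 * (27 * ?r)\<^sup>2" using rp by (intro mult_pos_pos zero_less_power) simp_all
    qed (use rR' in simp_all)
    also have "\<dots> = 1284 / 729" using rp by (simp add: power2_eq_square)
    finally show False using c4_bounds(1) by simp
  qed
  have qb: "q1 \<in> ball 0 1" using order.strict_trans1[OF q1(1) r1] by simp
  show "zorder G4D q1 = 1"
    by (rule zorder_eqI[OF open_ball qb g(1)]) (use gnz[OF q1(1)] g(2) in auto)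
  show "q2 = q1" if "norm q2 \<le> ?r" "G4D q2 = 0" for q2
    using gnz[OF that(1)] g(2)[of q2] that by simp
qed

lemma G4_analytic: "z \<in> UHP \<Longrightarrow> G4 analytic_on {z}"
  using G4_holomorphic open_UHP analytic_at by blast

lemma G4_eventually_nonzero: assumes "z \<in> UHP" shows "eventually (\<lambda>w. G4 w \<noteq> 0) (at z)"
proof -
  have "eventually (\<lambda>w. G4 w \<noteq> 0 \<and> w \<in> UHP) at_iinf"
  proof (rule eventually_conj)
    have "c4 \<noteq> 0" using c4_bounds(1) by auto
    then show "eventually (\<lambda>w. G4 w \<noteq> 0) at_iinf" using tendsto_imp_eventually_ne[OF G4_tendsto] by blast
    show "eventually (\<lambda>w. w \<in> UHP) at_iinf" unfolding eventually_at_iinf UHP_def by (intro exI[of _ 0]) auto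
  qed
  then have "\<exists>w\<in>UHP. G4 w \<noteq> 0" using eventually_happens'[OF at_iinf_neq_bot] by blast
  from holomorphic_eventually_nonzero[OF G4_holomorphic open_UHP connected_UHP this assms] show ?thesis .
qed

lemma G4_meromorphic: "G4 meromorphic_on UHP"
  using G4_analytic analytic_on_analytic_at analytic_on_imp_meromorphic_on by blast

lemma zorder_G4_mob:
  assumes A: "A \<in> SL2Z" and z: "z \<in> UHP"
  shows "zorder G4 (mob A z) = zorder G4 z"
proof -
  have mz: "mob A z \<in> UHP" using assms by simp
  have "zorder G4 (mob A z) = zorder (\<lambda>w. G4 (mob A w)) z"
    using G4_meromorphic mz by (intro zorder_mob[symmetric] A z G4_eventually_nonzero)
      (auto intro: meromorphic_on_subset)
  also have "\<dots> = zorder (\<lambda>w. autfac A w ^ 4 * G4 w) z"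
    using eventually_in_UHP[OF z] A by (intro zorder_cong) (auto elim!: eventually_mono simp: G4_modular)
  also have "\<dots> = zorder (\<lambda>w. autfac A w ^ 4) z + zorder G4 z"
  proof (rule zorder_times_analytic)
    show "(\<lambda>w. autfac A w ^ 4) analytic_on {z}" unfolding autfac_def by (intro analytic_intros)
    have "eventually (\<lambda>w. autfac A w \<noteq> 0) (at z)"
      using eventually_in_UHP[OF z] by eventually_elim (use autfac_nonzero[OF SL2Z_det[OF A]] in auto)
    with G4_eventually_nonzero[OF z] show "eventually (\<lambda>w. autfac A w ^ 4 * G4 w \<noteq> 0) (at z)"
      by eventually_elim auto
  qed (rule G4_analytic[OF z])
  also have "zorder (\<lambda>w. autfac A w ^ 4) z = 0"
  proof (rule zorder_eq_0I)
    show "(\<lambda>w. autfac A w ^ 4) analytic_on {z}" unfolding autfac_def by (intro analytic_intros)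
    show "autfac A z ^ 4 \<noteq> 0" using autfac_nonzero[OF SL2Z_det[OF A] z] by simp
  qed
  finally show ?thesis by simp
qed

definition rho :: complex where "rho = Complex (-1/2) (sqrt 3 / 2)"

lemma rho_UHP: "rho \<in> UHP" by (simp add: rho_def UHP_def)

lemma rho_sq: "rho * rho = - 1 - rho"
  by (simp add: rho_def complex_eq_iff)

lemma rho_nz: "rho \<noteq> 0" by (simp add: rho_def complex_eq_iff)

lemma mob_Smat_rho: "mob Smat rho = rho + 1"
proof -
  have "rho * (rho + 1) = -1" using rho_sq by (simp add: distrib_left)
  then have "mob Smat rho = rho * (rho + 1) / rho" by simp
  then show ?thesis using rho_nz by simp
qed

text \<open>\<open>Smat\<close> and the translation by 1 agree at \<open>rho\<close>, so modularity
  gives \<open>G4 rho = rho ^ 4 * G4 rho\<close>, where \<open>rho ^ 4 = rho\<close> differs from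
  1.\<close>

lemma G4_rho: "G4 rho = 0"
proof -
  have "G4 rho = G4 (mob Smat rho)" unfolding mob_Smat_rho using G4_periodic[OF rho_UHP, of 1] by simp
  also have "\<dots> = rho ^ 4 * G4 rho" using G4_modular[OF Smat_SL2Z rho_UHP] by simp
  also have "rho ^ 4 = (rho * rho) * (rho * rho)" by (simp add: power4_eq_xxxx)
  also have "\<dots> = (- 1 - rho) * (- 1 - rho)" by (simp only: rho_sq)
  also have "\<dots> = 1 + rho + rho + rho * rho" by (simp add: algebra_simps)
  also have "\<dots> = rho" unfolding rho_sq by simp
  finally have "(1 - rho) * G4 rho = 0" by (simp add: algebra_simps)
  moreover have "1 - rho \<noteq> 0" by (simp add: rho_def complex_eq_iff)
  ultimately show ?thesis by simp
qed

lemma norm_ee_le_iff: "norm (ee z) \<le> exp (- pi * sqrt 3) \<longleftrightarrow> Im z \<ge> sqrt 3 / 2"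
proof -
  have "norm (ee z) \<le> exp (- pi * sqrt 3) \<longleftrightarrow> pi * sqrt 3 \<le> pi * (2 * Im z)" by (simp add: ee_norm)
  also have "\<dots> \<longleftrightarrow> sqrt 3 \<le> 2 * Im z" using pi_gt_zero by (subst mult_le_cancel_left_pos) auto
  finally show ?thesis by auto
qed

text \<open>Reduction moves any zero to height at least \<open>sqrt 3 / 2\<close>, where
  \<open>G4D\<close> has at most one zero; \<open>rho\<close> lies exactly at this height.\<close>

lemma G4_zero_imp_rho_orbit:
  assumes z: "z \<in> UHP" and "G4 z = 0"
  shows "\<exists>A\<in>SL2Z. z = mob A rho"
proof -
  obtain B where B: "B \<in> SL2Z" "mob B z \<in> strip" "Im (mob B z) \<ge> sqrt 3 / 2" using reduction[OF z] .
  have mz: "mob B z \<in> UHP" using B z by simp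
  have "G4 (mob B z) = 0" using G4_modular[OF B(1) z] assms by simp
  then have 1: "G4D (ee (mob B z)) = 0" using G4D_ee[OF mz] by simp
  have 2: "norm (ee (mob B z)) \<le> exp (- pi * sqrt 3)" using norm_ee_le_iff B by blast
  have 3: "G4D (ee rho) = 0" using G4D_ee[OF rho_UHP] G4_rho by simp
  have 4: "norm (ee rho) \<le> exp (- pi * sqrt 3)" using norm_ee_le_iff by (simp add: rho_def)
  have "ee (mob B z) = ee rho" using G4D_zero_unique(2)[OF 4 3 2 1] .
  then obtain n where n: "mob B z = rho + of_int n" by (auto simp: ee_eq_iff)
  then have "mob B z = mob (Tpow n) rho" by simp
  then have "z = mob (matrix_inv B ** Tpow n) rho"
    using mob_inv_cancel(2)[OF B(1) z] B rho_UHP by (simp add: mob_SL2Z_mult SL2Z_inv del: mob_Tpow)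
  then show ?thesis using B by (intro bexI[of _ "matrix_inv B ** Tpow n"]) (auto simp: SL2Z_inv)
qed

lemma zorder_G4_rho: "zorder G4 rho = 1"
proof -
  have 3: "G4D (ee rho) = 0" using G4D_ee[OF rho_UHP] G4_rho by simp
  have 4: "norm (ee rho) \<le> exp (- pi * sqrt 3)" using norm_ee_le_iff by (simp add: rho_def)
  have b: "ee rho \<in> ball 0 1" using norm_ee_less_1 rho_UHP by simp
  have "\<exists>z\<in>ball 0 1. G4D z \<noteq> 0" using c4_bounds(1) by (intro bexI[of _ 0]) (auto simp: G4D_def)
  then have "eventually (\<lambda>w. G4D w \<noteq> 0) (at (ee rho))"
    by (intro holomorphic_eventually_nonzero[OF G4D_holomorphic] b) auto
  moreover have "G4D meromorphic_on {ee rho}"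
    using G4D_holomorphic b analytic_at[of G4D "ee rho"] by (intro analytic_on_imp_meromorphic_on) blast
  ultimately have "zorder (\<lambda>w. G4D (ee w)) rho = zorder G4D (ee rho)" by (intro zorder_ee)
  also have "\<dots> = 1" using G4D_zero_unique(1)[OF 4 3] .
  finally have "zorder (\<lambda>w. G4D (ee w)) rho = 1" .
  moreover have "zorder (\<lambda>w. G4D (ee w)) rho = zorder G4 rho"
    using eventually_in_UHP[OF rho_UHP] by (intro zorder_cong) (auto elim!: eventually_mono simp: G4D_ee)
  ultimately show ?thesis by simp
qed

lemma zorder_G4:
  assumes z: "z \<in> UHP"
  shows "zorder G4 z = (if \<exists>A\<in>SL2Z. z = mob A rho then 1 else 0)"
proof (cases "\<exists>A\<in>SL2Z. z = mob A rho")
  case True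
  then show ?thesis using zorder_G4_mob[OF _ rho_UHP] zorder_G4_rho by auto
next
  case False
  then have "G4 z \<noteq> 0" using G4_zero_imp_rho_orbit[OF z] by blast
  then have "zorder G4 z = 0" using zorder_eq_0I[OF G4_analytic[OF z]] by blast
  then show ?thesis using False by simp
qed

text \<open>Comparing real and imaginary parts in the fixed point equation expresses the upper row
  by \<open>c\<close> and \<open>d\<close>, and the determinant becomes the norm form of the
  Eisenstein integers, which represents 1 in six ways.\<close>

lemma zstab_rho: "zstab rho = (\<lambda>(c,d). imat (d - c) (- c) c d) ` {(1,0),(-1,0),(0,1),(0,-1),(1,1),(-1,-1)}"
proof (intro equalityI subsetI)
  fix A assume "A \<in> zstab rho"
  then have A: "A \<in> SL2Z" "mob A rho = rho" by (auto simp: zstab_def)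
  obtain a b c d where m: "A = imat a b c d" "a * d - b * c = 1" using A(1) SL2Z_E by metis
  have "autfac A rho \<noteq> 0" using autfac_nonzero[OF SL2Z_det[OF A(1)] rho_UHP] .
  then have "of_real (A$1$1) * rho + of_real (A$1$2) = rho * autfac A rho"
    using A(2) unfolding mob_autfac by (simp add: divide_eq_eq)
  then have "of_int a * rho + of_int b = rho * (of_int c * rho + of_int d)"
    by (simp add: m(1) autfac_imat)
  also have "\<dots> = of_int c * (rho * rho) + of_int d * rho" by (simp add: algebra_simps)
  also have "\<dots> = of_int (d - c) * rho - of_int c" unfolding rho_sq by (simp add: algebra_simps)
  finally have eq: "of_int a * rho + of_int b = of_int (d - c) * rho - of_int c" .
  from arg_cong[OF eq, of Im] have "real_of_int a = real_of_int (d - c)" by (simp add: rho_def)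
  then have a: "a = d - c" by linarith
  with eq have "complex_of_int b = complex_of_int (- c)" by simp
  then have b: "b = - c" by (simp only: of_int_eq_iff)
  have q: "d * d - c * d + c * c = 1" using m(2) unfolding a b by (simp add: left_diff_distrib)
  \<comment> \<open>Completing the square in either variable bounds the other one by 1 in
    modulus.\<close>
  have "(2 * d - c)\<^sup>2 + 3 * c\<^sup>2 = 4 * (d * d - c * d + c * c)"
    "(2 * c - d)\<^sup>2 + 3 * d\<^sup>2 = 4 * (d * d - c * d + c * c)"
    by (simp_all add: power2_eq_square algebra_simps)
  note this[unfolded q]
  then have "3 * c\<^sup>2 \<le> 4" "3 * d\<^sup>2 \<le> 4" by (smt (verit) zero_le_power2)+
  then have "c\<^sup>2 \<le> 1" "d\<^sup>2 \<le> 1" by linarith+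
  then have "\<bar>c\<bar> \<le> 1" "\<bar>d\<bar> \<le> 1" by (simp_all add: abs_square_le_1)
  then have "c = -1 \<or> c = 0 \<or> c = 1" "d = -1 \<or> d = 0 \<or> d = 1" by linarith+
  then have mem: "(c,d) \<in> {(1,0),(-1,0),(0,1),(0,-1),(1,1),(-1,-1)}" using q by (elim disjE) simp_all
  show "A \<in> (\<lambda>(c,d). imat (d - c) (- c) c d) ` {(1,0),(-1,0),(0,1),(0,-1),(1,1),(-1,-1)}"
    by (rule image_eqI[OF _ mem]) (simp only: m(1) a b prod.case)
next
  fix A assume "A \<in> (\<lambda>(c,d). imat (d - c) (- c) c d) ` {(1,0),(-1,0),(0,1),(0,-1),(1,1),(-1,-1)}"
  then obtain p where p: "A = (\<lambda>(c,d). imat (d - c) (- c) c d) p" "p \<in> {(1,0),(-1,0),(0,1),(0,-1),(1,1),(-1,-1)}"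
    by (rule imageE)
  obtain c d where cd': "p = (c,d)" by (cases p)
  have cd: "(c,d) \<in> {(1,0),(-1,0),(0,1),(0,-1),(1,1),(-1,-1)}" and A: "A = imat (d - c) (- c) c d"
    using p unfolding cd' by simp_all
  have S: "A \<in> SL2Z" unfolding A imat_in_SL2Z using cd by auto
  have jz: "autfac A rho \<noteq> 0" using autfac_nonzero[OF SL2Z_det[OF S] rho_UHP] .
  have "rho * autfac A rho = of_int c * (rho * rho) + of_int d * rho" by (simp add: A autfac_imat algebra_simps)
  also have "\<dots> = of_real (A$1$1) * rho + of_real (A$1$2)"
    unfolding rho_sq by (simp add: A right_diff_distrib left_diff_distrib)
  finally have "mob A rho = rho * autfac A rho / autfac A rho" by (simp only: mob_autfac)
  then have "mob A rho = rho" using jz by simp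
  then show "A \<in> zstab rho" using S by (simp add: zstab_def)
qed

lemma card_zstab_rho: "card (zstab rho) = 6"
proof -
  have inj: "inj (\<lambda>(c,d). imat (d - c) (- c) c d)" by (auto simp: inj_on_def imat_inject)
  have "card (zstab rho) = card {(1,0),(-1,0),(0,1),(0,-1),(1,1),(-1::int,-1::int)}"
    unfolding zstab_rho by (rule card_image[OF inj_on_subset[OF inj subset_UNIV]])
  also have "\<dots> = 6" by simp
  finally show ?thesis .
qed

lemma G4_weighted_zeros:
  shows "finite {z\<in>strip. Im z > 1/2 \<and> zorder G4 z \<noteq> 0}"
    and "(\<Sum>z\<in>{z\<in>strip. Im z > 1/2 \<and> zorder G4 z \<noteq> 0}. real_of_int (zorder G4 z) * orbit_weight z) = 1 / 3"
proof -
  have set: "{z\<in>strip. Im z > 1/2 \<and> zorder G4 z \<noteq> 0} = strip_orbit rho"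
  proof (intro equalityI subsetI)
    fix z assume z: "z \<in> {z\<in>strip. Im z > 1/2 \<and> zorder G4 z \<noteq> 0}"
    then have "z \<in> UHP" using strip_UHP by auto
    from zorder_G4[OF this] z have "\<exists>A\<in>SL2Z. z = mob A rho" by (auto split: if_splits)
    then show "z \<in> strip_orbit rho" using z by (simp add: strip_orbit_def)
  next
    fix z assume z: "z \<in> strip_orbit rho"
    then have "z \<in> UHP" "\<exists>A\<in>SL2Z. z = mob A rho" using strip_UHP by (auto simp: strip_orbit_def)
    then show "z \<in> {z\<in>strip. Im z > 1/2 \<and> zorder G4 z \<noteq> 0}" using z zorder_G4[of z] by (simp add: strip_orbit_def)
  qed
  show "finite {z\<in>strip. Im z > 1/2 \<and> zorder G4 z \<noteq> 0}" unfolding set by (rule finite_strip_orbit[OF rho_UHP])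
  have "(\<Sum>z\<in>strip_orbit rho. real_of_int (zorder G4 z) * orbit_weight z) = (\<Sum>z\<in>strip_orbit rho. orbit_weight z)"
    using zorder_G4_mob[OF _ rho_UHP] zorder_G4_rho by (intro sum.cong) (auto simp: strip_orbit_def)
  also have "\<dots> = 2 / card (zstab rho)" by (rule sum_orbit_weight_strip_orbit[OF rho_UHP])
  also have "\<dots> = 1 / 3" unfolding card_zstab_rho by simp
  finally show "(\<Sum>z\<in>{z\<in>strip. Im z > 1/2 \<and> zorder G4 z \<noteq> 0}. real_of_int (zorder G4 z) * orbit_weight z) = 1 / 3"
    unfolding set .
qed

section \<open>Growth at the cusp\<close>

lemma has_least_int:
  fixes S :: "int set"
  assumes "j1 \<in> S" "finite {j\<in>S. j < L}"
  shows "\<exists>j0\<in>S. \<forall>j\<in>S. j0 \<le> j"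
proof -
  define X where "X = {j\<in>S. j \<le> j1}"
  have "X \<subseteq> {j\<in>S. j < L} \<union> {L..j1}" by (auto simp: X_def)
  then have fin: "finite X" using assms(2) finite_subset by blast
  have ne: "j1 \<in> X" using assms by (simp add: X_def)
  show ?thesis
  proof (intro bexI[of _ "Min X"] ballI)
    show "Min X \<in> S" using Min_in[OF fin] ne by (auto simp: X_def)
    show "Min X \<le> j" if "j \<in> S" for j
    proof (cases "j \<le> j1")
      case True then show ?thesis using fin that by (simp add: X_def)
    next
      case False then show ?thesis using Min_le[OF fin ne] by linarith
    qed
  qed
qed

text \<open>The term with the least exponent dominates at the cusp, so \<open>ord_inf\<close> is the
  exact exponential rate. This frees the rest of the proof from the choice of expansion made in
  \<open>ord_inf\<close>; nonvanishing arbitrarily high up ensures that some coefficient is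
  nonzero.\<close>

lemma ord_inf_growth:
  assumes q: "has_qexp g" and nz: "frequently (\<lambda>z. g z \<noteq> 0) at_iinf"
  obtains C where "C > 0" "((\<lambda>z. norm (g z) * exp (2 * pi * ord_inf g * Im z)) \<longlongrightarrow> C) at_iinf"
proof -
  \<comment> \<open>The argument is run with the very expansion that the definition of
    \<open>ord_inf\<close> selects.\<close>
  define X where "X = (SOME (\<kappa>, h, c). qexp_rep g \<kappa> h c)"
  obtain \<kappa> h c where X: "X = (\<kappa>, h, c)" by (cases X)
  obtain \<kappa>' h' c' where "qexp_rep g \<kappa>' h' c'" using q unfolding has_qexp_def by (elim exE)
  then have "(\<lambda>(\<kappa>, h, c). qexp_rep g \<kappa> h c) (\<kappa>', h', c')" by simp
  then have "(\<lambda>(\<kappa>, h, c). qexp_rep g \<kappa> h c) X" unfolding X_def by (rule someI)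
  then have rep: "qexp_rep g \<kappa> h c" by (simp add: X)
  have oi: "ord_inf g = Inf {\<kappa> + real_of_int j / real h | j. c j \<noteq> 0}"
    unfolding ord_inf_def X_def[symmetric] X by simp
  have h: "h > 0" using rep by (simp add: qexp_rep_def)
  from rep have "\<exists>y0. \<forall>z. Im z > y0 \<longrightarrow> \<not> is_pole g z \<and>
      ((\<lambda>j. c j * ee (of_real (\<kappa> + real_of_int j / real h) * z)) has_sum g z) UNIV"
    unfolding qexp_rep_def by (elim conjE)
  then obtain y0 where y0: "\<And>z. Im z > y0 \<Longrightarrow> ((\<lambda>j. c j * ee (of_real (\<kappa> + real_of_int j / real h) * z)) has_sum g z) UNIV"
    by metis
  have "\<exists>j1. c j1 \<noteq> 0"
  proof (rule ccontr)
    assume "\<not> (\<exists>j1. c j1 \<noteq> 0)"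
    then have c0: "c j = 0" for j by blast
    have "g z = 0" if "Im z > y0" for z
    proof -
      have "((\<lambda>_::int. 0::complex) has_sum g z) UNIV" using y0[OF that] by (simp add: c0)
      then show ?thesis by (rule has_sum_unique[OF _ has_sum_0]) simp
    qed
    then have "eventually (\<lambda>z. g z = 0) at_iinf" unfolding eventually_at_iinf by blast
    then show False using nz by (simp add: frequently_def)
  qed
  then obtain j1 where j1: "j1 \<in> {j. c j \<noteq> 0}" by blast
  \<comment> \<open>Indices below this floor have negative exponent, so finiteness of the negative
    part yields a least index with nonzero coefficient.\<close>
  have "{j\<in>{j. c j \<noteq> 0}. j < \<lfloor>- \<kappa> * h\<rfloor>} \<subseteq> {j. \<kappa> + real_of_int j / real h < 0 \<and> c j \<noteq> 0}"
  proof safe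
    fix j assume "j < \<lfloor>- \<kappa> * h\<rfloor>"
    then have "real_of_int j < - \<kappa> * h" by linarith
    then show "\<kappa> + real_of_int j / real h < 0" using h by (simp add: field_simps)
  qed
  then have "finite {j\<in>{j. c j \<noteq> 0}. j < \<lfloor>- \<kappa> * h\<rfloor>}"
    by (rule finite_subset) (use rep in \<open>simp add: qexp_rep_def\<close>)
  from has_least_int[OF j1 this] obtain j0 where "j0 \<in> {j. c j \<noteq> 0}" "\<forall>j\<in>{j. c j \<noteq> 0}. j0 \<le> j"
    by (rule bexE)
  then have j0: "c j0 \<noteq> 0" "\<And>j. c j \<noteq> 0 \<Longrightarrow> j0 \<le> j" by simp_all
  define r where "r = \<kappa> + real_of_int j0 / real h"
  have "ord_inf g = r" unfolding oi
  proof (rule cInf_eq_minimum)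
    show "r \<in> {\<kappa> + real_of_int j / real h | j. c j \<noteq> 0}" using j0(1) unfolding r_def by blast
    fix x assume "x \<in> {\<kappa> + real_of_int j / real h | j. c j \<noteq> 0}"
    then obtain j where j: "x = \<kappa> + real_of_int j / real h" "c j \<noteq> 0" by blast
    have "real_of_int j0 / real h \<le> real_of_int j / real h"
      using j0(2)[OF j(2)] by (intro divide_right_mono) simp_all
    then show "r \<le> x" by (simp add: r_def j(1))
  qed
  \<comment> \<open>A reference height strictly inside the range of convergence: the absolute sum
    \<open>T\<close> taken there controls all larger heights.\<close>
  define y1 where "y1 = y0 + 1"
  define t where "t z j = c j * ee (of_real ((j - j0) / h) * z)" for z j
  have hs: "(t z has_sum (g z * ee (- of_real r * z))) UNIV" if "Im z > y0" for z
  proof -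
    have "((\<lambda>j. c j * ee (of_real (\<kappa> + real_of_int j / real h) * z) * ee (- of_real r * z)) has_sum (g z * ee (- of_real r * z))) UNIV"
      using y0[OF that] by (rule has_sum_cmult_left)
    moreover have "c j * ee (of_real (\<kappa> + real_of_int j / real h) * z) * ee (- of_real r * z) = t z j" for j
    proof -
      have "of_real (\<kappa> + real_of_int j / real h) * z + - of_real r * z = of_real ((j - j0) / h) * z"
        by (simp add: r_def diff_divide_distrib algebra_simps)
      then show ?thesis unfolding t_def by (simp add: mult.assoc flip: ee_add)
    qed
    ultimately show ?thesis by simp
  qed
  have hs1: "(t z has_sum (g z * ee (- of_real r * z) - c j0)) (UNIV - {j0})" if "Im z > y0" for z
  proof -
    have "(t z has_sum (\<Sum>j\<in>{j0}. t z j)) {j0}" by (rule has_sum_finite) auto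
    then have "(t z has_sum c j0) {j0}" by (simp add: t_def ee_def)
    from has_sum_Diff[OF hs[OF that] this] show ?thesis by simp
  qed
  have nt: "norm (t z j) = norm (c j) * exp (- 2 * pi * ((j - j0) / h) * Im z)" for z j
    by (simp add: t_def norm_mult ee_norm)
  define z1 where "z1 = Complex 0 y1"
  have z1: "Im z1 > y0" by (simp add: z1_def y1_def)
  have "t z1 summable_on (UNIV - {j0})" using hs1[OF z1] by (auto simp: summable_on_def)
  then have "(\<lambda>j. norm (t z1 j)) summable_on (UNIV - {j0})" by (simp add: summable_on_iff_abs_summable_on_complex)
  then obtain T where T: "((\<lambda>j. norm (t z1 j)) has_sum T) (UNIV - {j0})" by (auto simp: summable_on_def)
  \<comment> \<open>After division by the leading exponential every other exponent is at least
    \<open>1 / h\<close>, so passing from height \<open>y1\<close> to \<open>Im z\<close> shrinks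
    each term by at least this common factor.\<close>
  have bound: "norm (g z * ee (- of_real r * z) - c j0) \<le> T * exp (- 2 * pi * (1 / h) * (Im z - y1))" if z: "Im z > y1" for z
  proof (rule norm_infsum_le)
    show "(t z has_sum (g z * ee (- of_real r * z) - c j0)) (UNIV - {j0})" using z by (intro hs1) (simp add: y1_def)
    show "((\<lambda>j. norm (t z1 j) * exp (- 2 * pi * (1 / h) * (Im z - y1))) has_sum (T * exp (- 2 * pi * (1 / h) * (Im z - y1)))) (UNIV - {j0})"
      using T by (rule has_sum_cmult_left)
    fix j assume j: "j \<in> UNIV - {j0}"
    show "norm (t z j) \<le> norm (t z1 j) * exp (- 2 * pi * (1 / h) * (Im z - y1))"
    proof (cases "c j = 0")
      case False
      then have "j > j0" using j0(2)[of j] j by auto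
      then have autfac: "1 / h \<le> (j - j0) / h" using h by (intro divide_right_mono) auto
      have "exp (- 2 * pi * ((j - j0) / h) * Im z)
          = exp (- 2 * pi * ((j - j0) / h) * y1) * exp (- 2 * pi * ((j - j0) / h) * (Im z - y1))"
        unfolding exp_add[symmetric] distrib_left[symmetric] by simp
      also have "\<dots> \<le> exp (- 2 * pi * ((j - j0) / h) * y1) * exp (- 2 * pi * (1 / h) * (Im z - y1))"
      proof (rule mult_left_mono)
        have "2 * pi * (1 / h) * (Im z - y1) \<le> 2 * pi * ((j - j0) / h) * (Im z - y1)"
          using autfac z by (intro mult_right_mono mult_left_mono) auto
        then show "exp (- 2 * pi * ((j - j0) / h) * (Im z - y1)) \<le> exp (- 2 * pi * (1 / h) * (Im z - y1))" by simp
      qed simp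
      finally have "norm (c j) * exp (- 2 * pi * ((j - j0) / h) * Im z)
          \<le> norm (c j) * (exp (- 2 * pi * ((j - j0) / h) * y1) * exp (- 2 * pi * (1 / h) * (Im z - y1)))"
        by (intro mult_left_mono) auto
      then show ?thesis unfolding nt by (simp add: z1_def mult.assoc)
    qed (simp add: nt)
  qed
  have "((\<lambda>z. g z * ee (- of_real r * z) - c j0) \<longlongrightarrow> 0) at_iinf"
  proof (rule Lim_null_comparison)
    show "eventually (\<lambda>z. norm (g z * ee (- of_real r * z) - c j0) \<le> T * exp (- 2 * pi * (1 / h) * (Im z - y1))) at_iinf"
      unfolding eventually_at_iinf using bound by blast
    have "filterlim (\<lambda>z. Im z - y1) at_top at_iinf"
      using filterlim_tendsto_add_at_top[OF tendsto_const[of "- y1"] filterlim_Im_at_iinf] by simp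
    then have "filterlim (\<lambda>z. 2 * pi * (1 / h) * (Im z - y1)) at_top at_iinf"
      using h by (intro filterlim_tendsto_pos_mult_at_top[OF tendsto_const]) auto
    then have "filterlim (\<lambda>z. - (2 * pi * (1 / h) * (Im z - y1))) at_bot at_iinf"
      by (simp add: filterlim_uminus_at_top)
    then have "((\<lambda>z. exp (- (2 * pi * (1 / h) * (Im z - y1)))) \<longlongrightarrow> 0) at_iinf"
      by (rule filterlim_compose[OF exp_at_bot])
    then show "((\<lambda>z. T * exp (- 2 * pi * (1 / h) * (Im z - y1))) \<longlongrightarrow> 0) at_iinf"
      by (intro tendsto_mult_right_zero) simp
  qed
  then have "((\<lambda>z. g z * ee (- of_real r * z)) \<longlongrightarrow> c j0) at_iinf" by (simp add: LIM_zero_iff)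
  then have "((\<lambda>z. norm (g z * ee (- of_real r * z))) \<longlongrightarrow> norm (c j0)) at_iinf" by (rule tendsto_norm)
  moreover have "norm (g z * ee (- of_real r * z)) = norm (g z) * exp (2 * pi * ord_inf g * Im z)" for z
    by (simp add: norm_mult ee_norm \<open>ord_inf g = r\<close>)
  ultimately show thesis using that[of "norm (c j0)"] j0 by simp
qed

section \<open>Cosets, orbits and stabilisers\<close>

text \<open>Homogeneous coordinates: in them the action is linear, which spares the case
  distinctions at \<open>Infty\<close> when checking that \<open>mob_pt\<close> is an
  action.\<close>

definition pt_of :: "complex \<Rightarrow> complex \<Rightarrow> pt" where
  "pt_of u v = (if v = 0 then Infty else Fin (u / v))"

lemma mob_pt_pt_of:
  assumes "u \<noteq> 0 \<or> v \<noteq> 0" "M \<in> SL2Z"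
  shows "mob_pt M (pt_of u v) = pt_of (of_real (M$1$1) * u + of_real (M$1$2) * v) (of_real (M$2$1) * u + of_real (M$2$2) * v)"
proof (cases "v = 0")
  case True
  then show ?thesis using assms by (simp add: pt_of_def mob_pt_def)
next
  case False
  have 1: "of_real (M$2$1) * (u / v) + of_real (M$2$2) = (of_real (M$2$1) * u + of_real (M$2$2) * v) / v"
    using False by (simp add: add_divide_distrib)
  have 2: "of_real (M$1$1) * (u / v) + of_real (M$1$2) = (of_real (M$1$1) * u + of_real (M$1$2) * v) / v"
    using False by (simp add: add_divide_distrib)
  show ?thesis using False unfolding pt_of_def mob_pt_def mob_def by (simp only: pt.case 1 2 if_False) simp
qed

lemma pt_of_exhaust:
  obtains u v where "p = pt_of u v" "u \<noteq> 0 \<or> v \<noteq> 0"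
proof (cases p)
  case (Fin z) then show thesis using that[of z 1] by (simp add: pt_of_def)
next
  case Infty then show thesis using that[of 1 0] by (simp add: pt_of_def)
qed

lemma mob_pt_mult:
  assumes "A \<in> SL2Z" "B \<in> SL2Z"
  shows "mob_pt (A ** B) p = mob_pt A (mob_pt B p)"
proof -
  obtain u v where p: "p = pt_of u v" "u \<noteq> 0 \<or> v \<noteq> 0" by (rule pt_of_exhaust)
  define u' where "u' = of_real (B$1$1) * u + of_real (B$1$2) * v"
  define v' where "v' = of_real (B$2$1) * u + of_real (B$2$2) * v"
  have d: "of_real (B$1$1) * of_real (B$2$2) - of_real (B$1$2) * of_real (B$2$1) = (1::complex)"
  proof -
    have "complex_of_real (det B) = 1" using SL2Z_det[OF assms(2)] by simp
    then show ?thesis by (simp add: det_2)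
  qed
  have "u' \<noteq> 0 \<or> v' \<noteq> 0"
  proof (rule ccontr)
    assume "\<not> (u' \<noteq> 0 \<or> v' \<noteq> 0)"
    then have uv: "u' = 0" "v' = 0" by auto
    have "of_real (B$2$2) * u' - of_real (B$1$2) * v' = (of_real (B$1$1) * of_real (B$2$2) - of_real (B$1$2) * of_real (B$2$1)) * u"
      "of_real (B$1$1) * v' - of_real (B$2$1) * u' = (of_real (B$1$1) * of_real (B$2$2) - of_real (B$1$2) * of_real (B$2$1)) * v"
      by (simp_all add: u'_def v'_def algebra_simps)
    then have "u = 0" "v = 0" unfolding d uv by simp_all
    then show False using p by simp
  qed
  then have "mob_pt A (pt_of u' v') = pt_of (of_real (A$1$1) * u' + of_real (A$1$2) * v') (of_real (A$2$1) * u' + of_real (A$2$2) * v')"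
    using assms by (intro mob_pt_pt_of)
  moreover have "mob_pt B p = pt_of u' v'" unfolding p(1) u'_def v'_def using p(2) assms by (intro mob_pt_pt_of)
  moreover have "mob_pt (A ** B) p = pt_of (of_real (A$1$1) * u' + of_real (A$1$2) * v') (of_real (A$2$1) * u' + of_real (A$2$2) * v')"
    unfolding p(1) using mob_pt_pt_of[OF p(2), of "A ** B"] assms
    by (simp add: mat2_mult_nth u'_def v'_def algebra_simps)
  ultimately show ?thesis by simp
qed

lemma mob_pt_mat1 [simp]: "mob_pt (mat 1) p = p"
  by (cases p) (simp_all add: mob_pt_def)

lemma mob_pt_uminus [simp]: "mob_pt (- A) p = mob_pt A p"
proof (cases p)
  case (Fin z)
  have "of_real ((-A)$2$1) * z + of_real ((-A)$2$2) = - (of_real (A$2$1) * z + of_real (A$2$2))" by simp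
  then show ?thesis unfolding Fin mob_pt_def by (simp only: pt.case neg_equal_0_iff_equal mob_uminus)
qed (simp add: mob_pt_def)

lemma mob_pt_inv:
  assumes "A \<in> SL2Z"
  shows "mob_pt (matrix_inv A) (mob_pt A p) = p" "mob_pt A (mob_pt (matrix_inv A) p) = p"
  using assms by (simp_all flip: mob_pt_mult add: SL2Z_inv)

lemma mob_pt_Fin: 
  assumes "A \<in> SL2Z" "z \<in> UHP" shows "mob_pt A (Fin z) = Fin (mob A z)"
  using autfac_nonzero[OF SL2Z_det[OF assms(1)] assms(2)] by (simp add: mob_pt_def autfac_def)

lemma subgroupD:
  assumes "subgroup_SL2Z G"
  shows "G \<subseteq> SL2Z" "mat 1 \<in> G" "\<And>g h. g \<in> G \<Longrightarrow> h \<in> G \<Longrightarrow> g ** h \<in> G" "\<And>g. g \<in> G \<Longrightarrow> matrix_inv g \<in> G"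
    "\<And>g. g \<in> G \<Longrightarrow> g \<in> SL2Z"
  using assms by (auto simp: subgroup_SL2Z_def)

lemma subgroup_SL2Z_SL2Z: "subgroup_SL2Z SL2Z"
  by (simp add: subgroup_SL2Z_def SL2Z_inv)

lemma subgroup_pm:
  assumes "subgroup_SL2Z G" shows "subgroup_SL2Z (G \<union> uminus ` G)"
  unfolding subgroup_SL2Z_def
proof (intro conjI ballI)
  note G = subgroupD[OF assms]
  show "G \<union> uminus ` G \<subseteq> SL2Z" using G by auto
  show "mat 1 \<in> G \<union> uminus ` G" using G by auto
  show "g ** h \<in> G \<union> uminus ` G" if "g \<in> G \<union> uminus ` G" "h \<in> G \<union> uminus ` G" for g h
    using that G(3) by (auto simp: mat2_uminus_mult)
  show "matrix_inv g \<in> G \<union> uminus ` G" if "g \<in> G \<union> uminus ` G" for g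
    using that G by (auto simp: matrix_inv_uminus)
qed

lemma subgroup_stab:
  assumes "subgroup_SL2Z G" shows "subgroup_SL2Z (stab G x)"
  unfolding subgroup_SL2Z_def
proof (intro conjI ballI)
  note G = subgroupD[OF assms]
  show "stab G x \<subseteq> SL2Z" using G by (auto simp: stab_def)
  show "mat 1 \<in> stab G x" using G by (auto simp: stab_def)
  show "g ** h \<in> stab G x" if "g \<in> stab G x" "h \<in> stab G x" for g h
    using that G(3,5) by (auto simp: stab_def mob_pt_mult)
  show "matrix_inv g \<in> stab G x" if "g \<in> stab G x" for g
    using that G(4,5) mob_pt_inv(1)[of g x] by (auto simp: stab_def)
qed

section \<open>Coset representatives and counting of cosets\<close>

lemma card_image_same_fibres:
  assumes "\<And>a b. a \<in> A \<Longrightarrow> b \<in> A \<Longrightarrow> f a = f b \<longleftrightarrow> g a = g b"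
  shows "card (f ` A) = card (g ` A)" "finite (f ` A) \<longleftrightarrow> finite (g ` A)"
proof -
  have key: "g (inv_into A f (f a)) = g a" if "a \<in> A" for a
  proof -
    have "f (inv_into A f (f a)) = f a" using that by (simp add: f_inv_into_f)
    moreover have "inv_into A f (f a) \<in> A" using that by (simp add: inv_into_into)
    ultimately show ?thesis using assms that by blast
  qed
  have "bij_betw (\<lambda>y. g (inv_into A f y)) (f ` A) (g ` A)"
    unfolding bij_betw_def
  proof
    show "inj_on (\<lambda>y. g (inv_into A f y)) (f ` A)"
    proof (rule inj_onI)
      fix x y assume "x \<in> f ` A" "y \<in> f ` A" and eq: "g (inv_into A f x) = g (inv_into A f y)"
      then obtain a b where "a \<in> A" "x = f a" "b \<in> A" "y = f b" by blast
      then show "x = y" using eq key assms by simp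
    qed
    show "(\<lambda>y. g (inv_into A f y)) ` f ` A = g ` A" using key by (simp add: image_image)
  qed
  then show "card (f ` A) = card (g ` A)" "finite (f ` A) \<longleftrightarrow> finite (g ` A)"
    using bij_betw_same_card bij_betw_finite by blast+
qed

text \<open>The choice is made from the right coset as a set, so equivalent matrices get the same
  representative. Right cosets are needed because \<open>G\<close> acts on values of
  \<open>mob \<gamma>\<close> from the left, whereas the index in the statement counts left
  cosets.\<close>

definition right_rep :: "mat2 set \<Rightarrow> mat2 \<Rightarrow> mat2" where
  "right_rep H \<gamma> = (SOME \<delta>. \<delta> \<in> (\<lambda>h. h ** \<gamma>) ` H)"

lemma right_rep_in:
  assumes "subgroup_SL2Z H"
  obtains h where "h \<in> H" "right_rep H \<gamma> = h ** \<gamma>"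
proof -
  have "mat 1 ** \<gamma> \<in> (\<lambda>h. h ** \<gamma>) ` H" using subgroupD(2)[OF assms] by blast
  then have "right_rep H \<gamma> \<in> (\<lambda>h. h ** \<gamma>) ` H" unfolding right_rep_def by (rule someI)
  then show thesis using that by blast
qed

lemma right_rep_SL2Z:
  assumes "subgroup_SL2Z H" "\<gamma> \<in> SL2Z" shows "right_rep H \<gamma> \<in> SL2Z"
proof -
  obtain h where h: "h \<in> H" "right_rep H \<gamma> = h ** \<gamma>" using right_rep_in[OF assms(1)] .
  then show ?thesis using subgroupD(5)[OF assms(1)] assms by simp
qed

lemma right_rep_eq_iff:
  assumes H: "subgroup_SL2Z H" and \<gamma>: "\<gamma> \<in> SL2Z" "\<gamma>' \<in> SL2Z"
  shows "right_rep H \<gamma> = right_rep H \<gamma>' \<longleftrightarrow> \<gamma>' ** matrix_inv \<gamma> \<in> H"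
proof
  assume eq: "right_rep H \<gamma> = right_rep H \<gamma>'"
  obtain h where h: "h \<in> H" "right_rep H \<gamma> = h ** \<gamma>" using right_rep_in[OF H] .
  obtain h' where h': "h' \<in> H" "right_rep H \<gamma>' = h' ** \<gamma>'" using right_rep_in[OF H] .
  have hS: "h' \<in> SL2Z" using h' subgroupD(5)[OF H] by blast
  have "h' ** \<gamma>' = h ** \<gamma>" using eq h h' by simp
  then have "matrix_inv h' ** (h' ** \<gamma>') ** matrix_inv \<gamma> = matrix_inv h' ** (h ** \<gamma>) ** matrix_inv \<gamma>" by simp
  then have "\<gamma>' ** matrix_inv \<gamma> = matrix_inv h' ** (h ** (\<gamma> ** matrix_inv \<gamma>))"
    by (simp add: SL2Z_inv(3)[OF hS] matrix_mul_assoc)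
  then have "\<gamma>' ** matrix_inv \<gamma> = matrix_inv h' ** h" using SL2Z_inv(2)[OF \<gamma>(1)] by simp
  then show "\<gamma>' ** matrix_inv \<gamma> \<in> H" using subgroupD[OF H] h h' by simp
next
  assume k: "\<gamma>' ** matrix_inv \<gamma> \<in> H"
  define k where "k = \<gamma>' ** matrix_inv \<gamma>"
  have kH: "k \<in> H" using k by (simp add: k_def)
  have kS: "k \<in> SL2Z" using kH subgroupD(5)[OF H] by blast
  have \<gamma>': "\<gamma>' = k ** \<gamma>" unfolding k_def using SL2Z_mult_inv_cancel(4)[OF \<gamma>(1)] by simp
  have "(\<lambda>h. h ** \<gamma>') ` H = (\<lambda>h. h ** \<gamma>) ` H"
  proof (intro equalityI subsetI)
    fix x assume "x \<in> (\<lambda>h. h ** \<gamma>') ` H"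
    then obtain h where h: "h \<in> H" "x = h ** \<gamma>'" by blast
    then have "x = (h ** k) ** \<gamma>" by (simp add: \<gamma>' matrix_mul_assoc)
    then show "x \<in> (\<lambda>h. h ** \<gamma>) ` H" using subgroupD(3)[OF H h(1) kH] by blast
  next
    fix x assume "x \<in> (\<lambda>h. h ** \<gamma>) ` H"
    then obtain h where h: "h \<in> H" "x = h ** \<gamma>" by blast
    have "(h ** matrix_inv k) ** \<gamma>' = h ** (matrix_inv k ** (k ** \<gamma>))" unfolding \<gamma>' by (simp add: matrix_mul_assoc)
    also have "\<dots> = x" using h SL2Z_mult_inv_cancel(2)[OF kS] by simp
    finally show "x \<in> (\<lambda>h. h ** \<gamma>') ` H"
      using subgroupD(3)[OF H h(1) subgroupD(4)[OF H kH]] by blast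
  qed
  then show "right_rep H \<gamma> = right_rep H \<gamma>'" unfolding right_rep_def by simp
qed

lemma right_rep_right_rep:
  assumes H: "subgroup_SL2Z H" and \<gamma>: "\<gamma> \<in> SL2Z" shows "right_rep H (right_rep H \<gamma>) = right_rep H \<gamma>"
proof -
  obtain h where h: "h \<in> H" "right_rep H \<gamma> = h ** \<gamma>" using right_rep_in[OF H] .
  have hS: "h \<in> SL2Z" using h subgroupD(5)[OF H] by blast
  have "right_rep H \<gamma> = right_rep H (h ** \<gamma>)"
    using h right_rep_eq_iff[OF H \<gamma>, of "h ** \<gamma>"] hS \<gamma> by (simp add: SL2Z_mult_inv_cancel(3)[OF \<gamma>])
  then show ?thesis using h by simp
qed

lemma lcoset_eq_iff:
  assumes K: "subgroup_SL2Z K" and s: "\<sigma> \<in> SL2Z" "\<sigma>' \<in> SL2Z"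
  shows "(\<lambda>h. \<sigma> ** h) ` K = (\<lambda>h. \<sigma>' ** h) ` K \<longleftrightarrow> matrix_inv \<sigma>' ** \<sigma> \<in> K"
proof
  assume eq: "(\<lambda>h. \<sigma> ** h) ` K = (\<lambda>h. \<sigma>' ** h) ` K"
  have "\<sigma> ** mat 1 \<in> (\<lambda>h. \<sigma> ** h) ` K" using subgroupD(2)[OF K] by blast
  then obtain h where h: "h \<in> K" "\<sigma> = \<sigma>' ** h" unfolding eq by auto
  then show "matrix_inv \<sigma>' ** \<sigma> \<in> K" using SL2Z_mult_inv_cancel(2)[OF s(2)] by simp
next
  assume k: "matrix_inv \<sigma>' ** \<sigma> \<in> K"
  define k where "k = matrix_inv \<sigma>' ** \<sigma>"
  have kK: "k \<in> K" using k by (simp add: k_def)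
  have kS: "k \<in> SL2Z" using kK subgroupD(5)[OF K] by blast
  have \<sigma>: "\<sigma> = \<sigma>' ** k" unfolding k_def using SL2Z_mult_inv_cancel(1)[OF s(2)] by simp
  show "(\<lambda>h. \<sigma> ** h) ` K = (\<lambda>h. \<sigma>' ** h) ` K"
  proof (intro equalityI subsetI)
    fix x assume "x \<in> (\<lambda>h. \<sigma> ** h) ` K"
    then obtain h where h: "h \<in> K" "x = \<sigma> ** h" by blast
    then have "x = \<sigma>' ** (k ** h)" by (simp add: \<sigma> matrix_mul_assoc)
    then show "x \<in> (\<lambda>h. \<sigma>' ** h) ` K" using subgroupD(3)[OF K kK h(1)] by blast
  next
    fix x assume "x \<in> (\<lambda>h. \<sigma>' ** h) ` K"
    then obtain h where h: "h \<in> K" "x = \<sigma>' ** h" by blast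
    have "\<sigma> ** (matrix_inv k ** h) = \<sigma>' ** (k ** (matrix_inv k ** h))" unfolding \<sigma> by (simp add: matrix_mul_assoc)
    also have "\<dots> = x" using h SL2Z_mult_inv_cancel(1)[OF kS] by simp
    finally show "x \<in> (\<lambda>h. \<sigma> ** h) ` K"
      using subgroupD(3)[OF K subgroupD(4)[OF K kK] h(1)] by blast
  qed
qed

text \<open>Inversion turns right cosets of \<open>H\<close> into left cosets of \<open>K\<close>.
  Allowing a subgroup \<open>A\<close> with \<open>A \<inter> H = K\<close> covers the index in the
  whole group as well as the stabiliser indices behind the widths.\<close>

lemma card_right_rep_image:
  assumes H: "subgroup_SL2Z H" and A: "subgroup_SL2Z A" and K: "subgroup_SL2Z K"
    and AHK: "A \<inter> H = K" and g0: "\<gamma>0 \<in> SL2Z"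
  shows "card ((\<lambda>\<sigma>. right_rep H (\<sigma> ** \<gamma>0)) ` A) = card (lcosets A K)"
    "finite ((\<lambda>\<sigma>. right_rep H (\<sigma> ** \<gamma>0)) ` A) \<longleftrightarrow> finite (lcosets A K)"
proof -
  have lc: "lcosets A K = (\<lambda>\<sigma>. (\<lambda>h. matrix_inv \<sigma> ** h) ` K) ` A"
  proof (intro equalityI subsetI)
    fix X assume "X \<in> lcosets A K"
    then obtain g where g: "g \<in> A" "X = (\<lambda>h. g ** h) ` K" by (auto simp: lcosets_def)
    then have "X = (\<lambda>h. matrix_inv (matrix_inv g) ** h) ` K"
      using matrix_inv_matrix_inv subgroupD(5)[OF A] by simp
    then show "X \<in> (\<lambda>\<sigma>. (\<lambda>h. matrix_inv \<sigma> ** h) ` K) ` A" using subgroupD(4)[OF A g(1)] by blast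
  next
    fix X assume "X \<in> (\<lambda>\<sigma>. (\<lambda>h. matrix_inv \<sigma> ** h) ` K) ` A"
    then show "X \<in> lcosets A K" using subgroupD(4)[OF A] by (auto simp: lcosets_def)
  qed
  have "right_rep H (a ** \<gamma>0) = right_rep H (b ** \<gamma>0) \<longleftrightarrow> (\<lambda>h. matrix_inv a ** h) ` K = (\<lambda>h. matrix_inv b ** h) ` K"
    if ab: "a \<in> A" "b \<in> A" for a b
  proof -
    have S: "a \<in> SL2Z" "b \<in> SL2Z" using ab subgroupD(5)[OF A] by auto
    have "right_rep H (a ** \<gamma>0) = right_rep H (b ** \<gamma>0) \<longleftrightarrow> (b ** \<gamma>0) ** matrix_inv (a ** \<gamma>0) \<in> H"
      using S g0 by (intro right_rep_eq_iff[OF H]) auto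
    also have "(b ** \<gamma>0) ** matrix_inv (a ** \<gamma>0) = b ** matrix_inv a"
      using S g0 by (simp add: matrix_inv_mult matrix_mul_assoc SL2Z_mult_inv_cancel(3)[OF g0])
    also have "b ** matrix_inv a \<in> H \<longleftrightarrow> b ** matrix_inv a \<in> K"
      using AHK subgroupD(3,4)[OF A] ab by blast
    also have "b ** matrix_inv a = matrix_inv (matrix_inv b) ** matrix_inv a"
      using matrix_inv_matrix_inv[OF S(2)] by simp
    also have "\<dots> \<in> K \<longleftrightarrow> (\<lambda>h. matrix_inv a ** h) ` K = (\<lambda>h. matrix_inv b ** h) ` K"
      using S by (intro lcoset_eq_iff[OF K, symmetric]) (auto simp: SL2Z_inv)
    finally show ?thesis .
  qed
  from card_image_same_fibres[of A "\<lambda>\<sigma>. right_rep H (\<sigma> ** \<gamma>0)" "\<lambda>\<sigma>. (\<lambda>h. matrix_inv \<sigma> ** h) ` K", OF this]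
  show "card ((\<lambda>\<sigma>. right_rep H (\<sigma> ** \<gamma>0)) ` A) = card (lcosets A K)"
    "finite ((\<lambda>\<sigma>. right_rep H (\<sigma> ** \<gamma>0)) ` A) \<longleftrightarrow> finite (lcosets A K)" unfolding lc by auto
qed

text \<open>For a subgroup \<open>G\<close>, the preimage in \<open>SL2Z\<close> of its image in
  PSL2(Z).\<close>

definition pm :: "mat2 set \<Rightarrow> mat2 set" where "pm G = G \<union> uminus ` G"

definition Reps :: "mat2 set \<Rightarrow> mat2 set" where "Reps G = right_rep (pm G) ` SL2Z"

lemma subgroup_pm': "subgroup_SL2Z G \<Longrightarrow> subgroup_SL2Z (pm G)"
  unfolding pm_def by (rule subgroup_pm)

lemma card_Reps:
  assumes G: "subgroup_SL2Z G" and fin: "finite (lcosets SL2Z G)"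
  shows "finite (Reps G)" "card (Reps G) = pindex SL2Z G"
proof -
  have sub: "SL2Z \<inter> pm G = pm G" using subgroupD(1)[OF subgroup_pm'[OF G]] by blast
  note * = card_right_rep_image[OF subgroup_pm'[OF G] subgroup_SL2Z_SL2Z subgroup_pm'[OF G] sub SL2Z_mat1]
  show "card (Reps G) = pindex SL2Z G" unfolding Reps_def pindex_def using *(1) by (simp add: pm_def)
  have "lcosets SL2Z (pm G) \<subseteq> (\<lambda>X. X \<union> uminus ` X) ` lcosets SL2Z G"
  proof
    fix X assume "X \<in> lcosets SL2Z (pm G)"
    then obtain g where g: "g \<in> SL2Z" "X = (\<lambda>h. g ** h) ` pm G" by (auto simp: lcosets_def)
    have "X = (\<lambda>h. g ** h) ` G \<union> uminus ` (\<lambda>h. g ** h) ` G"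
      unfolding g pm_def by (simp add: image_Un image_image mat2_uminus_mult)
    then show "X \<in> (\<lambda>X. X \<union> uminus ` X) ` lcosets SL2Z G" using g(1) by (auto simp: lcosets_def)
  qed
  then have "finite (lcosets SL2Z (pm G))" using fin finite_surj by blast
  then show "finite (Reps G)" unfolding Reps_def using *(2) by simp
qed

lemma Reps_SL2Z: "subgroup_SL2Z G \<Longrightarrow> \<delta> \<in> Reps G \<Longrightarrow> \<delta> \<in> SL2Z"
  using right_rep_SL2Z[OF subgroup_pm'] by (auto simp: Reps_def)

lemma stab_pm: 
  shows "stab (pm G) x = pm (stab G x)"
  by (auto simp: stab_def pm_def)

text \<open>The representatives in question are exactly those of
  \<open>\<sigma> ** \<gamma>0\<close> with \<sigma> in the stabiliser of \<open>x\<close>. With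
  \<open>p = Infty\<close> the count is the width of a cusp; with \<open>p\<close> in the upper half
  plane it is the index of stabilisers.\<close>

lemma coset_count:
  assumes G: "subgroup_SL2Z G" and g0: "\<gamma>0 \<in> SL2Z" and x: "x = mob_pt \<gamma>0 p"
  shows "card {\<delta>\<in>Reps G. mob_pt \<delta> p \<in> orbit G x} = pindex (stab SL2Z x) (stab G x)"
proof -
  let ?H = "pm G"
  have H: "subgroup_SL2Z ?H" by (rule subgroup_pm'[OF G])
  have A: "subgroup_SL2Z (stab SL2Z x)" by (rule subgroup_stab[OF subgroup_SL2Z_SL2Z])
  have K: "subgroup_SL2Z (pm (stab G x))" by (rule subgroup_pm'[OF subgroup_stab[OF G]])
  have AHK: "stab SL2Z x \<inter> ?H = pm (stab G x)"
    using subgroupD(5)[OF H] unfolding stab_pm[symmetric] by (auto simp: stab_def)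
  have "{\<delta>\<in>Reps G. mob_pt \<delta> p \<in> orbit G x} = (\<lambda>\<sigma>. right_rep ?H (\<sigma> ** \<gamma>0)) ` stab SL2Z x"
  proof (intro equalityI subsetI)
    fix \<delta> assume d: "\<delta> \<in> {\<delta>\<in>Reps G. mob_pt \<delta> p \<in> orbit G x}"
    then obtain g where g: "g \<in> G" "mob_pt \<delta> p = mob_pt g x" by (auto simp: orbit_def)
    have gS: "g \<in> SL2Z" using g subgroupD(5)[OF G] by blast
    have dS: "\<delta> \<in> SL2Z" using d Reps_SL2Z[OF G] by blast
    define \<sigma> where "\<sigma> = matrix_inv g ** \<delta> ** matrix_inv \<gamma>0"
    have sS: "\<sigma> \<in> SL2Z" using gS dS g0 by (simp add: \<sigma>_def SL2Z_inv)
    have "mob_pt \<sigma> x = mob_pt (matrix_inv g) (mob_pt \<delta> p)"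
      unfolding \<sigma>_def x using gS dS g0 by (simp add: mob_pt_mult SL2Z_inv mob_pt_inv)
    then have "mob_pt \<sigma> x = x" using g mob_pt_inv(1)[OF gS] by simp
    then have s: "\<sigma> \<in> stab SL2Z x" using sS by (simp add: stab_def)
    have sg: "\<sigma> ** \<gamma>0 = matrix_inv g ** \<delta>" unfolding \<sigma>_def by (simp add: SL2Z_mult_inv_cancel(4)[OF g0])
    obtain \<gamma> where \<gamma>: "\<gamma> \<in> SL2Z" "\<delta> = right_rep ?H \<gamma>" using d by (auto simp: Reps_def)
    have "\<delta> ** matrix_inv (matrix_inv g ** \<delta>) = g"
      using gS dS by (simp add: matrix_inv_mult SL2Z_inv matrix_inv_matrix_inv matrix_mul_assoc)
    moreover have "g \<in> ?H" using g by (simp add: pm_def)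
    ultimately have "right_rep ?H (matrix_inv g ** \<delta>) = right_rep ?H \<delta>"
      using right_rep_eq_iff[OF H, of "matrix_inv g ** \<delta>" \<delta>] gS dS by (simp add: SL2Z_inv)
    also have "\<dots> = \<delta>" using right_rep_right_rep[OF H \<gamma>(1)] \<gamma>(2) by simp
    finally show "\<delta> \<in> (\<lambda>\<sigma>. right_rep ?H (\<sigma> ** \<gamma>0)) ` stab SL2Z x" using s sg by (intro image_eqI[of _ _ \<sigma>]) auto
  next
    fix \<delta> assume "\<delta> \<in> (\<lambda>\<sigma>. right_rep ?H (\<sigma> ** \<gamma>0)) ` stab SL2Z x"
    then obtain \<sigma> where s: "\<sigma> \<in> SL2Z" "mob_pt \<sigma> x = x" "\<delta> = right_rep ?H (\<sigma> ** \<gamma>0)" by (auto simp: stab_def)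
    have 1: "\<delta> \<in> Reps G" unfolding s Reps_def using s g0 by (intro imageI) simp
    obtain h where h: "h \<in> ?H" "\<delta> = h ** (\<sigma> ** \<gamma>0)" using right_rep_in[OF H, of "\<sigma> ** \<gamma>0"] s by blast
    have hS: "h \<in> SL2Z" using h subgroupD(5)[OF H] by blast
    have "mob_pt \<delta> p = mob_pt h x" unfolding h using s hS g0 x by (simp add: mob_pt_mult)
    moreover have "mob_pt h x \<in> orbit G x" using h(1) by (auto simp: pm_def orbit_def)
    ultimately show "\<delta> \<in> {\<delta>\<in>Reps G. mob_pt \<delta> p \<in> orbit G x}" using 1 by simp
  qed
  then show ?thesis using card_right_rep_image(1)[OF H A K AHK g0] by (simp add: pindex_def pm_def)
qed

lemma stab_Fin: "z \<in> UHP \<Longrightarrow> stab SL2Z (Fin z) = zstab z"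
  by (auto simp: stab_def zstab_def mob_pt_Fin)

lemma SL2Z_ne_uminus: "A \<in> SL2Z \<Longrightarrow> A \<noteq> - A"
proof
  assume "A \<in> SL2Z" "A = - A"
  then have "A$1$1 = - A$1$1" "A$1$2 = - A$1$2" by (metis vector_uminus_component)+
  then have "A$1$1 = 0" "A$1$2 = 0" by auto
  then show False using SL2Z_det[OF \<open>A \<in> SL2Z\<close>] by (simp add: det_2)
qed

lemma card_pm:
  assumes "finite S" "S \<subseteq> SL2Z"
  shows "card (pm S) = 2 * card (proj ` S)"
proof -
  have un: "pm S = \<Union> (proj ` S)" by (auto simp: pm_def proj_def)
  have "2 * card (proj ` S) = card (\<Union> (proj ` S))"
  proof (rule card_partition)
    show "finite (proj ` S)" "finite (\<Union> (proj ` S))" using assms by (auto simp: proj_def)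
    show "card c = 2" if "c \<in> proj ` S" for c
      using that assms SL2Z_ne_uminus by (auto simp: proj_def)
    show "c1 \<inter> c2 = {}" if "c1 \<in> proj ` S" "c2 \<in> proj ` S" "c1 \<noteq> c2" for c1 c2
      using that by (auto simp: proj_def)
  qed
  then show ?thesis using un by simp
qed

text \<open>Lagrange's theorem for the cosets as sets of matrices.\<close>

lemma card_lcosets:
  assumes A: "subgroup_SL2Z A" "finite A" and K: "subgroup_SL2Z K" "K \<subseteq> A"
  shows "card K * card (lcosets A K) = card A"
proof -
  have un: "\<Union> (lcosets A K) = A"
  proof (intro equalityI subsetI)
    fix x assume "x \<in> \<Union> (lcosets A K)"
    then show "x \<in> A" using subgroupD(3)[OF A(1)] K(2) by (auto simp: lcosets_def)
  next
    fix x assume x: "x \<in> A"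
    have "x \<in> (\<lambda>h. x ** h) ` K" using subgroupD(2)[OF K(1)] by (intro image_eqI[of _ _ "mat 1"]) auto
    then show "x \<in> \<Union> (lcosets A K)" using x by (auto simp: lcosets_def)
  qed
  have "card K * card (lcosets A K) = card (\<Union> (lcosets A K))"
  proof (rule card_partition)
    show "finite (\<Union> (lcosets A K))" unfolding un by (rule A(2))
    have "lcosets A K = (\<lambda>g. (\<lambda>h. g ** h) ` K) ` A" by (auto simp: lcosets_def)
    then show "finite (lcosets A K)" using A(2) by simp
    show "card c = card K" if c: "c \<in> lcosets A K" for c
    proof -
      obtain g where g: "g \<in> A" "c = (\<lambda>h. g ** h) ` K" using c by (auto simp: lcosets_def)
      have gS: "g \<in> SL2Z" using g subgroupD(5)[OF A(1)] by blast
      have "inj_on (\<lambda>h. g ** h) K" by (rule inj_onI) (metis SL2Z_mult_inv_cancel(2)[OF gS])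
      then show ?thesis unfolding g by (rule card_image)
    qed
    show "c1 \<inter> c2 = {}" if c: "c1 \<in> lcosets A K" "c2 \<in> lcosets A K" "c1 \<noteq> c2" for c1 c2
    proof (rule ccontr)
      assume "c1 \<inter> c2 \<noteq> {}"
      then obtain x where x: "x \<in> c1" "x \<in> c2" by blast
      obtain g1 where g1: "g1 \<in> A" "c1 = (\<lambda>h. g1 ** h) ` K" using c(1) by (auto simp: lcosets_def)
      obtain g2 where g2: "g2 \<in> A" "c2 = (\<lambda>h. g2 ** h) ` K" using c(2) by (auto simp: lcosets_def)
      obtain h1 where h1: "h1 \<in> K" "x = g1 ** h1" using x g1 by blast
      obtain h2 where h2: "h2 \<in> K" "x = g2 ** h2" using x g2 by blast
      have S: "g1 \<in> SL2Z" "g2 \<in> SL2Z" "h1 \<in> SL2Z" "h2 \<in> SL2Z"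
        using g1 g2 h1 h2 subgroupD(5)[OF A(1)] subgroupD(5)[OF K(1)] by auto
      have "g1 = g2 ** h2 ** matrix_inv h1"
        using h1 h2 SL2Z_mult_inv_cancel(3)[OF S(3), of g1] by simp
      then have "matrix_inv g2 ** g1 = h2 ** matrix_inv h1"
        using SL2Z_mult_inv_cancel(2)[OF S(2)] by (simp add: matrix_mul_assoc[symmetric])
      then have "matrix_inv g2 ** g1 \<in> K" using subgroupD(3,4)[OF K(1)] h1 h2 by simp
      then have "c1 = c2" unfolding g1 g2 using lcoset_eq_iff[OF K(1) S(1,2)] by blast
      then show False using c by simp
    qed
  qed
  then show ?thesis using un by simp
qed

text \<open>Lagrange in the finite stabiliser of \<open>z\<close>, where adding signs doubles the
  image in PSL2(Z). Multiplied by the orbit weight \<open>2 / card (zstab z)\<close>, the index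
  becomes the reciprocal of the order of the stabiliser of \<open>G\<close> in PSL2(Z).\<close>

lemma pindex_stab_Fin:
  assumes G: "subgroup_SL2Z G" and z: "z \<in> UHP"
  shows "real (pindex (stab SL2Z (Fin z)) (stab G (Fin z))) * real (card (proj ` stab G (Fin z)))
    = real (card (zstab z)) / 2" "card (proj ` stab G (Fin z)) > 0"
proof -
  let ?A = "stab SL2Z (Fin z)" and ?S = "stab G (Fin z)"
  have A: "subgroup_SL2Z ?A" by (rule subgroup_stab[OF subgroup_SL2Z_SL2Z])
  have finA: "finite ?A" unfolding stab_Fin[OF z] by (rule finite_zstab_bound(1)[OF z])
  have SA: "?S \<subseteq> ?A" using subgroupD(1)[OF G] by (auto simp: stab_def)
  have finS: "finite ?S" using finA SA finite_subset by blast
  have SS: "?S \<subseteq> SL2Z" using SA by (auto simp: stab_def)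
  have K: "subgroup_SL2Z (pm ?S)" by (rule subgroup_pm'[OF subgroup_stab[OF G]])
  have KA: "pm ?S \<subseteq> ?A" using SA by (auto simp: pm_def stab_def)
  have "card (pm ?S) * card (lcosets ?A (pm ?S)) = card ?A" by (rule card_lcosets[OF A finA K KA])
  then have "2 * card (proj ` ?S) * pindex ?A ?S = card (zstab z)"
    unfolding card_pm[OF finS SS] stab_Fin[OF z] by (simp add: pindex_def pm_def stab_Fin[OF z])
  from arg_cong[OF this, of real] show "real (pindex ?A ?S) * real (card (proj ` ?S)) = real (card (zstab z)) / 2"
    by (simp add: mult_ac)
  have "mat 1 \<in> ?S" using subgroupD(2)[OF subgroup_stab[OF G]] .
  then show "card (proj ` ?S) > 0" using finS by (auto simp: card_gt_0_iff)
qed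

section \<open>Meromorphic functions with prescribed growth at the cusp\<close>

lemma zorder_eq_0_bounded:
  assumes k: "k meromorphic_on {z}" and "a > 0"
    and bd: "eventually (\<lambda>w. a \<le> norm (k w) \<and> norm (k w) \<le> B) (at z)"
  shows "zorder k z = 0"
proof (rule not_pole_not_isolated_zero_imp_zorder_eq_0[OF k])
  show "\<not> is_pole k z"
  proof
    assume "is_pole k z"
    then have "filterlim k at_infinity (at z)" by (simp add: is_pole_def)
    then have "eventually (\<lambda>w. norm (k w) \<ge> B + 1) (at z)"
      using filterlim_at_infinity_imp_norm_at_top[of k "at z"] by (simp add: filterlim_at_top)
    with bd have "eventually (\<lambda>w. False) (at z)" by eventually_elim linarith
    then show False by simp
  qed
  show "\<not> isolated_zero k z"
  proof
    assume "isolated_zero k z"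
    then have "(k \<longlongrightarrow> 0) (at z)" by (simp add: isolated_zero_def)
    then have "((\<lambda>w. norm (k w)) \<longlongrightarrow> 0) (at z)" by (rule tendsto_norm_zero)
    then have "eventually (\<lambda>w. norm (k w) < a) (at z)" using \<open>a > 0\<close> order_tendstoD(2) by blast
    with bd have "eventually (\<lambda>w. False) (at z)" by eventually_elim linarith
    then show False by simp
  qed
  have "eventually (\<lambda>w. k w \<noteq> 0) (at z)" using bd by eventually_elim (use \<open>a > 0\<close> in auto)
  then show "frequently (\<lambda>w. k w \<noteq> 0) (at z)" using eventually_frequently[OF at_neq_bot] by blast
qed

text \<open>A limit with positive value bounds the function from both sides near every sufficiently
  high point, so no zeros or poles remain there.\<close>

lemma growth_near:
  assumes lim: "((\<lambda>z. norm (F z) * exp (R * Im z)) \<longlongrightarrow> C) at_iinf" and C: "C > 0"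
  obtains Y where "Y > 0" "\<And>z. Im z > Y \<Longrightarrow> \<exists>a B. a > 0 \<and> eventually (\<lambda>w. a \<le> norm (F w) \<and> norm (F w) \<le> B) (at z)"
proof -
  have "eventually (\<lambda>z. C / 2 < norm (F z) * exp (R * Im z) \<and> norm (F z) * exp (R * Im z) < 2 * C) at_iinf"
    using C by (intro eventually_conj order_tendstoD[OF lim]) auto
  then obtain Y0 where Y0: "\<And>z. Im z > Y0 \<Longrightarrow> C / 2 < norm (F z) * exp (R * Im z) \<and> norm (F z) * exp (R * Im z) < 2 * C"
    unfolding eventually_at_iinf by blast
  define Y where "Y = max Y0 1"
  have "\<exists>a B. a > 0 \<and> eventually (\<lambda>w. a \<le> norm (F w) \<and> norm (F w) \<le> B) (at z)" if z: "Im z > Y" for z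
  proof -
    have cont: "((\<lambda>w. exp (- R * Im w)) \<longlongrightarrow> exp (- R * Im z)) (at z)" by (intro tendsto_intros)
    have e1: "eventually (\<lambda>w. exp (- R * Im w) > exp (- R * Im z) / 2) (at z)"
      by (rule order_tendstoD(1)[OF cont]) simp
    have e2: "eventually (\<lambda>w. exp (- R * Im w) < 2 * exp (- R * Im z)) (at z)"
      by (rule order_tendstoD(2)[OF cont]) simp
    have e3: "eventually (\<lambda>w. w \<in> {w. Im w > Y}) (at z)"
      using z by (intro eventually_at_in_open' open_halfspace_Im_gt) auto
    have "eventually (\<lambda>w. C / 2 * (exp (- R * Im z) / 2) \<le> norm (F w) \<and> norm (F w) \<le> 2 * C * (2 * exp (- R * Im z))) (at z)"
      using e1 e2 e3
    proof eventually_elim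
      case (elim w)
      have w: "C / 2 < norm (F w) * exp (R * Im w)" "norm (F w) * exp (R * Im w) < 2 * C"
        using Y0[of w] elim by (auto simp: Y_def)
      have n: "norm (F w) = (norm (F w) * exp (R * Im w)) * exp (- R * Im w)"
        by (simp add: exp_minus)
      have "C / 2 * (exp (- R * Im z) / 2) \<le> (norm (F w) * exp (R * Im w)) * exp (- R * Im w)"
        by (rule mult_mono) (use w elim C in auto)
      moreover have "(norm (F w) * exp (R * Im w)) * exp (- R * Im w) \<le> 2 * C * (2 * exp (- R * Im z))"
        by (rule mult_mono) (use w elim C in auto)
      ultimately show ?case unfolding n[symmetric] by blast
    qed
    moreover have "C / 2 * (exp (- R * Im z) / 2) > 0" using C by simp
    ultimately show ?thesis by blast
  qed
  then show thesis using that[of Y] by (simp add: Y_def)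
qed

text \<open>The limit speaks of every value, and \<open>remove_sings\<close> may change values at
  isolated points. The new value is a limit of nearby old ones, so it satisfies the non-strict bound
  \<open>e / 2\<close> and hence the strict bound \<open>e\<close>.\<close>

lemma growth_remove_sings:
  assumes mero: "F meromorphic_on UHP"
    and lim: "((\<lambda>z. norm (F z) * exp (R * Im z)) \<longlongrightarrow> C) at_iinf" and C: "C > 0"
  shows "((\<lambda>z. norm (remove_sings F z) * exp (R * Im z)) \<longlongrightarrow> C) at_iinf"
proof (rule tendstoI)
  fix e :: real assume e: "e > 0"
  obtain Y where Y: "Y > 0" "\<And>z. Im z > Y \<Longrightarrow> \<exists>a B. a > 0 \<and> eventually (\<lambda>w. a \<le> norm (F w) \<and> norm (F w) \<le> B) (at z)"
    using growth_near[OF lim C] by blast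
  have "eventually (\<lambda>z. dist (norm (F z) * exp (R * Im z)) C < e / 2) at_iinf"
    using tendstoD[OF lim, of "e / 2"] e by simp
  then obtain Y2 where Y2: "\<And>z. Im z > Y2 \<Longrightarrow> dist (norm (F z) * exp (R * Im z)) C < e / 2"
    unfolding eventually_at_iinf by blast
  have "dist (norm (remove_sings F z) * exp (R * Im z)) C < e" if z: "Im z > max Y Y2" for z
  proof -
    have zU: "z \<in> UHP" using z Y(1) by (simp add: UHP_def)
    obtain a B where aB: "eventually (\<lambda>w. a \<le> norm (F w) \<and> norm (F w) \<le> B) (at z)" using Y(2)[of z] z by auto
    have "\<not> is_pole F z"
    proof
      assume "is_pole F z"
      then have "filterlim F at_infinity (at z)" by (simp add: is_pole_def)
      then have "eventually (\<lambda>w. norm (F w) \<ge> B + 1) (at z)"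
        using filterlim_at_infinity_imp_norm_at_top[of F "at z"] by (simp add: filterlim_at_top)
      with aB have "eventually (\<lambda>w. False) (at z)" by eventually_elim linarith
      then show False by simp
    qed
    moreover have "not_essential F z" using mero zU by (simp add: meromorphic_on_altdef)
    ultimately obtain c where c: "(F \<longlongrightarrow> c) (at z)" by (auto simp: not_essential_def)
    then have r: "remove_sings F z = c" by (rule remove_sings_eqI)
    have "((\<lambda>w. dist (norm (F w) * exp (R * Im w)) C) \<longlongrightarrow> dist (norm c * exp (R * Im z)) C) (at z)"
      by (intro tendsto_intros c)
    moreover have "eventually (\<lambda>w. w \<in> {w. Im w > Y2}) (at z)"
      using z by (intro eventually_at_in_open' open_halfspace_Im_gt) auto
    then have "eventually (\<lambda>w. dist (norm (F w) * exp (R * Im w)) C \<le> e / 2) (at z)"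
      by eventually_elim (use Y2 in \<open>auto intro: less_imp_le\<close>)
    ultimately have "dist (norm c * exp (R * Im z)) C \<le> e / 2"
      using tendsto_upperbound[OF _ _ at_neq_bot] by blast
    then show ?thesis using r e by simp
  qed
  then show "eventually (\<lambda>z. dist (norm (remove_sings F z) * exp (R * Im z)) C < e) at_iinf"
    unfolding eventually_at_iinf by blast
qed

text \<open>Identities of meromorphic functions hold near each point but may fail at isolated points
  of any height, so towards the cusp they are available only frequently.\<close>

lemma frequently_at_iinf:
  assumes "\<And>z. z \<in> UHP \<Longrightarrow> eventually P (at z)"
  shows "frequently P at_iinf"
proof -
  have False if ev: "eventually (\<lambda>z. \<not> P z) at_iinf"
  proof -
    obtain Y where Y: "\<And>z. Im z > Y \<Longrightarrow> \<not> P z" using ev unfolding eventually_at_iinf by blast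
    define z where "z = Complex 0 (max Y 0 + 1)"
    have "eventually (\<lambda>w. w \<in> {w. Im w > Y}) (at z)"
      by (intro eventually_at_in_open' open_halfspace_Im_gt) (auto simp: z_def)
    moreover have "eventually P (at z)" by (rule assms) (simp add: UHP_def z_def)
    ultimately have "eventually (\<lambda>w. False) (at z)" by eventually_elim (use Y in auto)
    then show False by simp
  qed
  then show ?thesis unfolding frequently_def by blast
qed

lemma filterlim_shift_at_iinf: "filterlim (\<lambda>z. z + of_int n) at_iinf at_iinf"
  unfolding filterlim_iff eventually_at_iinf
proof (intro allI impI)
  fix P :: "complex \<Rightarrow> bool" assume "\<exists>Y. \<forall>z. Y < Im z \<longrightarrow> P z"
  then obtain Y where "\<forall>z. Y < Im z \<longrightarrow> P z" ..
  then have "\<forall>z. Y < Im z \<longrightarrow> P (z + of_int n)" by simp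
  then show "\<exists>Y. \<forall>z. Y < Im z \<longrightarrow> P (z + of_int n)" ..
qed

section \<open>Orbits of interior points and cusps\<close>

lemma orbit_refl: "subgroup_SL2Z G \<Longrightarrow> p \<in> orbit G p"
  using subgroupD(2)[of G] mob_pt_mat1[of p] unfolding orbit_def by (metis (mono_tags, lifting) mem_Collect_eq)

lemma orbit_eq:
  assumes G: "subgroup_SL2Z G" and "y \<in> orbit G x" shows "orbit G y = orbit G x"
proof -
  obtain g where g: "g \<in> G" "y = mob_pt g x" using assms(2) by (auto simp: orbit_def)
  have gS: "g \<in> SL2Z" using g subgroupD(5)[OF G] by blast
  show ?thesis
  proof (intro equalityI subsetI)
    fix z assume "z \<in> orbit G y"
    then obtain h where h: "h \<in> G" "z = mob_pt h y" by (auto simp: orbit_def)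
    then have "z = mob_pt (h ** g) x" using g gS subgroupD(5)[OF G] by (simp add: mob_pt_mult)
    then show "z \<in> orbit G x" using subgroupD(3)[OF G h(1) g(1)] by (auto simp: orbit_def)
  next
    fix z assume "z \<in> orbit G x"
    then obtain h where h: "h \<in> G" "z = mob_pt h x" by (auto simp: orbit_def)
    have iS: "matrix_inv g \<in> SL2Z" "h \<in> SL2Z" using SL2Z_inv[OF gS] subgroupD(5)[OF G] h by auto
    have "z = mob_pt (h ** matrix_inv g) y" using iS h g mob_pt_inv(1)[OF gS] by (simp add: mob_pt_mult)
    then show "z \<in> orbit G y" using subgroupD(3)[OF G h(1) subgroupD(4)[OF G g(1)]] by (auto simp: orbit_def)
  qed
qed

lemma orbit_eq_iff: "subgroup_SL2Z G \<Longrightarrow> orbit G y = orbit G x \<longleftrightarrow> y \<in> orbit G x"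
  using orbit_eq orbit_refl by metis

lemma stab_Infty:
  assumes "A \<in> SL2Z" "mob_pt A Infty = Infty"
  obtains n where "A = Tpow n \<or> A = - Tpow n"
proof -
  have "A $ 2 $ 1 = 0" using assms(2) by (auto simp: mob_pt_def split: if_splits)
  then show thesis using SL2Z_c0[OF assms(1)] that by blast
qed

lemma cusp_transitive:
  fixes q :: rat
  obtains \<gamma> where "\<gamma> \<in> SL2Z" "mob_pt \<gamma> Infty = Fin (of_real (of_rat q))"
proof -
  obtain a c where ac: "quotient_of q = (a, c)" by (cases "quotient_of q")
  have c: "c > 0" using quotient_of_denom_pos[OF ac] .
  have "coprime a c" using quotient_of_coprime[OF ac] .
  obtain u v where "u * a + v * c = gcd a c" using bezout_int by blast
  then have uv: "a * u - (- v) * c = 1" using \<open>coprime a c\<close> by (simp add: coprime_iff_gcd_eq_1 mult.commute)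
  have q: "q = of_int a / of_int c" using quotient_of_div[OF ac] .
  show thesis
  proof (rule that[of "imat a (- v) c u"])
    show "imat a (- v) c u \<in> SL2Z" unfolding imat_in_SL2Z by (rule uv)
    show "mob_pt (imat a (- v) c u) Infty = Fin (of_real (of_rat q))"
      using c by (simp add: mob_pt_def q of_rat_divide)
  qed
qed

section \<open>The valence formula\<close>

text \<open>The integer \<open>b = D * k\<close> is fixed as a parameter so that powers with
  integral exponent can replace the fractional weight.\<close>

locale modform =
  fixes G :: "mat2 set" and D :: nat and k :: real and chi :: "mat2 \<times> complex \<Rightarrow> complex"
    and f :: "complex \<Rightarrow> complex" and b :: int
  assumes G: "subgroup_SL2Z G" and fin: "finite (lcosets SL2Z G)" and D: "D \<ge> 1"
    and b: "real D * k = of_int b"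
    and mult: "multiplier_system D k G chi" and form: "mero_modular_form D k G chi f"
    and nz: "nonzero_mero f"
begin

lemma f_mero: "f meromorphic_on UHP" using form by (simp add: mero_modular_form_def)

lemma f_mero_at: "z \<in> UHP \<Longrightarrow> f meromorphic_on {z}"
  using f_mero meromorphic_on_subset by blast

lemma f_eventually_nonzero: assumes "z \<in> UHP" shows "eventually (\<lambda>w. f w \<noteq> 0) (at z)"
proof -
  obtain z0 where z0: "z0 \<in> UHP" "\<not> (\<forall>\<^sub>F w in at z0. f w = 0)" using nz by (auto simp: nonzero_mero_def)
  have "(\<forall>\<^sub>\<approx>x\<in>UHP. f x = 0) \<or> (\<forall>\<^sub>\<approx>x\<in>UHP. f x \<noteq> 0)"
    by (rule meromorphic_imp_constant_or_avoid[OF f_mero open_UHP connected_UHP])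
  moreover have "\<not> (\<forall>\<^sub>\<approx>x\<in>UHP. f x = 0)" using eventually_cosparse_imp_eventually_at z0 by blast
  ultimately show ?thesis using eventually_cosparse_imp_eventually_at assms by blast
qed

text \<open>\<open>Phi \<gamma>\<close> is the \<open>4 * D\<close>-th power of the slash of \<open>f\<close> by the lift of \<open>\<gamma>\<close>: this power removes the choice of the
  \<open>D\<close>-th root of the automorphy factor and makes the weight \<open>4 * b\<close>, that of \<open>G4 powi b\<close>.\<close>

definition Phi :: "mat2 \<Rightarrow> complex \<Rightarrow> complex" where
  "Phi \<gamma> z = f (mob \<gamma> z) ^ (4 * D) * autfac \<gamma> z powi (- 4 * b)"

text \<open>The \<open>D\<close>-th power of the root in the slash operator is the automorphy factor
  itself, and the exponent \<open>- D * k\<close> is an integer, so no branch of the logarithm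
  survives.\<close>

lemma slash_power:
  assumes "\<gamma> \<in> SL2Z" "z \<in> UHP"
  shows "slash D k f (tilde \<gamma>) z ^ (4 * D) = Phi \<gamma> z"
proof -
  have j: "autfac \<gamma> z \<noteq> 0" using autfac_nonzero[OF SL2Z_det[OF assms(1)] assms(2)] .
  define w where "w = cphi D (tilde \<gamma>) z"
  have w: "w = autfac \<gamma> z powr (1 / of_nat D)"
    by (simp add: w_def cphi_def tilde_def SL2Z_det[OF assms(1)] autfac_def)
  have w0: "w \<noteq> 0" using j by (simp add: w)
  have wD: "w ^ D = autfac \<gamma> z"
  proof -
    have "w ^ D = exp (of_nat D * (1 / of_nat D * Ln (autfac \<gamma> z)))"
      unfolding w powr_def using j by (simp only: if_False exp_of_nat_mult)
    also have "\<dots> = autfac \<gamma> z" using D j by simp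
    finally show ?thesis .
  qed
  have "- complex_of_real (real D * k) = of_int (- b)" using b by simp
  then have "w powr (- of_real (real D * k)) = w powr of_int (- b)" by (rule arg_cong)
  also have "\<dots> = w powi (- b)" using w0 by (intro complex_powr_of_int) simp
  finally have "w powr (- of_real (real D * k)) = w powi (- b)" .
  then have "slash D k f (tilde \<gamma>) z = w powi (- b) * f (mob \<gamma> z)"
    unfolding slash_def w_def[symmetric] by (simp add: tilde_def)
  then have "slash D k f (tilde \<gamma>) z ^ (4 * D) = (w powi (- b)) ^ (4 * D) * f (mob \<gamma> z) ^ (4 * D)"
    by (simp add: power_mult_distrib)
  also have "(w powi (- b)) ^ (4 * D) = w powi ((- b) * int (4 * D))"
    by (simp only: power_int_mult power_int_of_nat)
  also have "(- b) * int (4 * D) = int D * (- 4 * b)" by simp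
  also have "w powi (int D * (- 4 * b)) = (w ^ D) powi (- 4 * b)"
    by (simp only: power_int_mult power_int_of_nat)
  finally show ?thesis by (simp add: wD Phi_def)
qed

text \<open>The scalar is a power of a character value. Orders and growth rates see nothing of it
  beyond its being nonzero.\<close>

lemma Phi_G:
  assumes g: "g \<in> G"
  obtains v where "v \<noteq> 0" "\<And>z. z \<in> UHP \<Longrightarrow> eventually (\<lambda>w. Phi g w = v * f w ^ (4 * D)) (at z)"
proof
  have gS: "g \<in> SL2Z" using g subgroupD(5)[OF G] by blast
  have cov: "tilde g \<in> cover D G" using g SL2Z_det[OF gS] by (simp add: tilde_def cover_def GL2plus_def)
  have "norm (chi (tilde g)) = 1" using mult cov by (simp add: multiplier_system_def)
  then show "chi (tilde g) ^ (4 * D) \<noteq> 0" by auto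
  fix z assume z: "z \<in> UHP"
  have "eventually (\<lambda>w. slash D k f (tilde g) w = chi (tilde g) * f w) (at z)"
    using form cov z by (simp add: mero_modular_form_def)
  with eventually_in_UHP[OF z] show "eventually (\<lambda>w. Phi g w = chi (tilde g) ^ (4 * D) * f w ^ (4 * D)) (at z)"
  proof eventually_elim
    case (elim w)
    then show ?case using slash_power[OF gS, of w] by (simp add: power_mult_distrib)
  qed
qed

text \<open>The exponent is even, so everything descends from \<open>G\<close> to
  \<open>pm G\<close>.\<close>

lemma autfac_uminus_powi: "autfac (- A) z powi (- 4 * b) = autfac A z powi (- 4 * b)"
proof -
  have "autfac (- A) z = - autfac A z" by (simp add: autfac_def)
  then have "autfac (- A) z powi (- 4 * b) = (- autfac A z) powi (- 4 * b)" by simp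
  also have "\<dots> = autfac A z powi (- 4 * b)" by (subst power_int_minus_left) simp
  finally show ?thesis .
qed

lemma Phi_uminus: "Phi (- A) z = Phi A z"
  using autfac_uminus_powi[of A z] by (simp add: Phi_def)

lemma Phi_mult:
  assumes "A \<in> SL2Z" "B \<in> SL2Z" "z \<in> UHP"
  shows "Phi (A ** B) z = Phi A (mob B z) * autfac B z powi (- 4 * b)"
  using assms by (simp add: Phi_def mob_SL2Z_mult autfac_mult SL2Z_det power_int_mult_distrib mult.assoc)

text \<open>Numerator and denominator have the same weight \<open>4 * b\<close>, so elements of
  \<open>pm G\<close> change the quotient by scalars only.\<close>

definition phi :: "complex \<Rightarrow> complex" where "phi z = f z ^ (4 * D) / G4 z powi b"

lemma phi_mob:
  assumes "A \<in> SL2Z" "z \<in> UHP" shows "phi (mob A z) = Phi A z / G4 z powi b"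
proof -
  have j: "autfac A z \<noteq> 0" using autfac_nonzero[OF SL2Z_det[OF assms(1)] assms(2)] .
  have "G4 (mob A z) powi b = autfac A z powi (4 * b) * G4 z powi b"
    using assms by (simp add: G4_modular power_int_mult_distrib power_int_mult)
  moreover have "autfac A z powi (- 4 * b) = inverse (autfac A z powi (4 * b))"
    by (simp add: power_int_minus)
  ultimately show ?thesis using j by (simp add: phi_def Phi_def divide_inverse mult.assoc)
qed

lemma phi_G:
  assumes h: "h \<in> pm G"
  obtains v where "v \<noteq> 0" "\<And>z. z \<in> UHP \<Longrightarrow> eventually (\<lambda>w. phi (mob h w) = v * phi w) (at z)"
proof -
  obtain g where g: "g \<in> G" "h = g \<or> h = - g" using h by (auto simp: pm_def)
  have gS: "g \<in> SL2Z" using g subgroupD(5)[OF G] by blast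
  obtain v where v: "v \<noteq> 0" "\<And>z. z \<in> UHP \<Longrightarrow> eventually (\<lambda>w. Phi g w = v * f w ^ (4 * D)) (at z)"
    using Phi_G[OF g(1)] by blast
  show thesis
  proof (rule that[OF v(1)])
    fix z assume z: "z \<in> UHP"
    show "eventually (\<lambda>w. phi (mob h w) = v * phi w) (at z)"
      using v(2)[OF z] eventually_in_UHP[OF z]
    proof eventually_elim
      case (elim w)
      have "mob h w = mob g w" using g(2) by auto
      then show ?case using phi_mob[OF gS elim(2)] elim(1) by (simp add: phi_def)
    qed
  qed
qed

lemma phi_mero: "phi meromorphic_on UHP"
  unfolding phi_def[abs_def] by (intro meromorphic_intros f_mero G4_meromorphic)

lemma phi_mero_at: "z \<in> UHP \<Longrightarrow> phi meromorphic_on {z}"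
  using phi_mero meromorphic_on_subset by blast

lemma phi_eventually_nonzero: assumes "z \<in> UHP" shows "eventually (\<lambda>w. phi w \<noteq> 0) (at z)"
  using f_eventually_nonzero[OF assms] G4_eventually_nonzero[OF assms] by eventually_elim (simp add: phi_def)

lemma zorder_phi:
  assumes z: "z \<in> UHP"
  shows "zorder phi z = 4 * int D * zorder f z - b * zorder G4 z"
proof -
  have fr: "frequently (\<lambda>w. f w \<noteq> 0) (at z)" "frequently (\<lambda>w. G4 w \<noteq> 0) (at z)"
    using f_eventually_nonzero[OF z] G4_eventually_nonzero[OF z] eventually_frequently[OF at_neq_bot] by blast+
  have mG: "G4 meromorphic_on {z}" using G4_analytic[OF z] by (rule analytic_on_imp_meromorphic_on)
  have f1: "frequently (\<lambda>w. f w ^ (4 * D) \<noteq> 0) (at z)" using fr(1) by (rule frequently_elim1) simp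
  have f2: "frequently (\<lambda>w. G4 w powi b \<noteq> 0) (at z)" using fr(2) by (rule frequently_elim1) simp
  have "zorder phi z = zorder (\<lambda>w. f w ^ (4 * D)) z - zorder (\<lambda>w. G4 w powi b) z"
    unfolding phi_def[abs_def]
    by (rule Meromorphic.zorder_divide) (intro meromorphic_intros f_mero_at[OF z] mG f1 f2)+
  also have "zorder (\<lambda>w. f w ^ (4 * D)) z = int (4 * D) * zorder f z"
    by (rule zorder_power[OF f_mero_at[OF z] fr(1)])
  also have "zorder (\<lambda>w. G4 w powi b) z = b * zorder G4 z"
    by (rule zorder_power_int[OF mG fr(2)])
  finally show ?thesis by simp
qed

text \<open>Multiplication by a nonzero scalar leaves the order of \<open>phi\<close> unchanged, and
  the contribution of \<open>G4\<close> is invariant under the whole modular group.\<close>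

lemma zorder_f_G:
  assumes g: "g \<in> G" and z: "z \<in> UHP"
  shows "zorder f (mob g z) = zorder f z"
proof -
  have gS: "g \<in> SL2Z" using g subgroupD(5)[OF G] by blast
  have mz: "mob g z \<in> UHP" using gS z by simp
  have "g \<in> pm G" using g by (simp add: pm_def)
  then obtain v where v: "v \<noteq> 0" "\<And>z. z \<in> UHP \<Longrightarrow> eventually (\<lambda>w. phi (mob g w) = v * phi w) (at z)"
    using phi_G by blast
  have "zorder phi (mob g z) = zorder (\<lambda>w. phi (mob g w)) z"
    by (rule zorder_mob[symmetric, OF gS z phi_mero_at[OF mz] phi_eventually_nonzero[OF mz]])
  also have "\<dots> = zorder (\<lambda>w. v * phi w) z" by (rule zorder_cong[OF v(2)[OF z] refl])
  also have "\<dots> = zorder phi z" by (rule zorder_cmult[OF v(1)])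
  finally have "int D * zorder f (mob g z) = int D * zorder f z"
    using zorder_phi[OF z] zorder_phi[OF mz] zorder_G4_mob[OF gS z] by simp
  then show ?thesis using D by simp
qed

section \<open>The product over coset representatives\<close>

abbreviation "I \<equiv> Reps G"

lemma finite_I: "finite I" and card_I: "card I = pindex SL2Z G"
  using card_Reps[OF G fin] by auto

lemma I_SL2Z: "\<delta> \<in> I \<Longrightarrow> \<delta> \<in> SL2Z" using Reps_SL2Z[OF G] .

definition J :: "complex \<Rightarrow> complex" where "J z = (\<Prod>\<delta>\<in>I. phi (mob \<delta> z))"

lemma J_mero: "J meromorphic_on UHP"
  unfolding J_def[abs_def] by (intro meromorphic_intros meromorphic_mob[OF I_SL2Z phi_mero])

lemma phi_mob_eventually_nonzero: "A \<in> SL2Z \<Longrightarrow> z \<in> UHP \<Longrightarrow> eventually (\<lambda>w. phi (mob A w) \<noteq> 0) (at z)"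
  by (rule eventually_mob) (auto intro: phi_eventually_nonzero)

lemma J_eventually_nonzero: assumes z: "z \<in> UHP" shows "eventually (\<lambda>w. J w \<noteq> 0) (at z)"
proof -
  have "eventually (\<lambda>w. \<forall>\<delta>\<in>I. phi (mob \<delta> w) \<noteq> 0) (at z)"
    by (rule eventually_ball_finite[OF finite_I]) (use phi_mob_eventually_nonzero[OF I_SL2Z z] in blast)
  then show ?thesis by eventually_elim (simp add: J_def finite_I)
qed

text \<open>Right multiplication by \<gamma> permutes the cosets. The product of \<delta> and
  \<gamma> differs from the chosen representative of its coset by an element of \<open>pm G\<close>,
  which costs one scalar for each factor.\<close>

lemma J_quasi_invariant:
  assumes g: "\<gamma> \<in> SL2Z"
  obtains u where "u \<noteq> 0" "\<And>z. z \<in> UHP \<Longrightarrow> eventually (\<lambda>w. J (mob \<gamma> w) = u * J w) (at z)"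
proof -
  let ?H = "pm G"
  have H: "subgroup_SL2Z ?H" by (rule subgroup_pm'[OF G])
  define \<pi> where "\<pi> \<delta> = right_rep ?H (\<delta> ** \<gamma>)" for \<delta>
  have \<pi>I: "\<pi> \<delta> \<in> I" if "\<delta> \<in> I" for \<delta>
    unfolding \<pi>_def Reps_def using I_SL2Z[OF that] g by (intro imageI) simp
  have inj: "inj_on \<pi> I"
  proof (rule inj_onI)
    fix d e assume de: "d \<in> I" "e \<in> I" and eq: "\<pi> d = \<pi> e"
    have S: "d \<in> SL2Z" "e \<in> SL2Z" using de I_SL2Z by auto
    have "(e ** \<gamma>) ** matrix_inv (d ** \<gamma>) \<in> ?H"
      using eq right_rep_eq_iff[OF H, of "d ** \<gamma>" "e ** \<gamma>"] S g by (simp add: \<pi>_def)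
    also have "(e ** \<gamma>) ** matrix_inv (d ** \<gamma>) = e ** matrix_inv d"
      using S g by (simp add: matrix_inv_mult matrix_mul_assoc SL2Z_mult_inv_cancel(3)[OF g])
    finally have "right_rep ?H d = right_rep ?H e" using right_rep_eq_iff[OF H S] by simp
    moreover obtain d' e' where "d = right_rep ?H d'" "d' \<in> SL2Z" "e = right_rep ?H e'" "e' \<in> SL2Z"
      using de by (auto simp: Reps_def)
    ultimately show "d = e" using right_rep_right_rep[OF H] by simp
  qed
  have bij: "bij_betw \<pi> I I"
    using inj endo_inj_surj[OF finite_I _ inj] \<pi>I by (auto simp: bij_betw_def)
  have "\<exists>v. v \<noteq> 0 \<and> (\<forall>z\<in>UHP. eventually (\<lambda>w. phi (mob \<delta> (mob \<gamma> w)) = v * phi (mob (\<pi> \<delta>) w)) (at z))"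
    if d: "\<delta> \<in> I" for \<delta>
  proof -
    obtain h where h: "h \<in> ?H" "\<pi> \<delta> = h ** (\<delta> ** \<gamma>)" using right_rep_in[OF H] unfolding \<pi>_def by metis
    have hS: "h \<in> SL2Z" using h subgroupD(5)[OF H] by blast
    have dS: "\<delta> \<in> SL2Z" using d I_SL2Z by blast
    have eq: "\<delta> ** \<gamma> = matrix_inv h ** \<pi> \<delta>" using h SL2Z_mult_inv_cancel(2)[OF hS] by simp
    have ih: "matrix_inv h \<in> ?H" using subgroupD(4)[OF H h(1)] .
    obtain v where v: "v \<noteq> 0" "\<And>z. z \<in> UHP \<Longrightarrow> eventually (\<lambda>w. phi (mob (matrix_inv h) w) = v * phi w) (at z)"
      using phi_G[OF ih] by blast
    have pS: "\<pi> \<delta> \<in> SL2Z" using \<pi>I[OF d] I_SL2Z by blast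
    have "eventually (\<lambda>w. phi (mob \<delta> (mob \<gamma> w)) = v * phi (mob (\<pi> \<delta>) w)) (at z)" if z: "z \<in> UHP" for z
    proof -
      have "mob (\<pi> \<delta>) z \<in> UHP" using pS z by simp
      from eventually_mob[OF pS z v(2)[OF this]] eventually_in_UHP[OF z] show ?thesis
      proof eventually_elim
        case (elim w)
        have "mob \<delta> (mob \<gamma> w) = mob (matrix_inv h) (mob (\<pi> \<delta>) w)"
          using eq dS g pS elim(2) SL2Z_inv(1)[OF hS] by (simp flip: mob_SL2Z_mult)
        then show ?case using elim(1) by simp
      qed
    qed
    then show ?thesis using v(1) by blast
  qed
  then obtain v where v: "\<And>\<delta>. \<delta> \<in> I \<Longrightarrow> v \<delta> \<noteq> 0"
    "\<And>\<delta> z. \<delta> \<in> I \<Longrightarrow> z \<in> UHP \<Longrightarrow> eventually (\<lambda>w. phi (mob \<delta> (mob \<gamma> w)) = v \<delta> * phi (mob (\<pi> \<delta>) w)) (at z)"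
    by metis
  show thesis
  proof (rule that[of "\<Prod>\<delta>\<in>I. v \<delta>"])
    show "(\<Prod>\<delta>\<in>I. v \<delta>) \<noteq> 0" using v(1) finite_I by simp
    fix z assume z: "z \<in> UHP"
    have "eventually (\<lambda>w. \<forall>\<delta>\<in>I. phi (mob \<delta> (mob \<gamma> w)) = v \<delta> * phi (mob (\<pi> \<delta>) w)) (at z)"
      by (rule eventually_ball_finite[OF finite_I]) (use v(2)[OF _ z] in blast)
    then show "eventually (\<lambda>w. J (mob \<gamma> w) = (\<Prod>\<delta>\<in>I. v \<delta>) * J w) (at z)"
    proof eventually_elim
      case (elim w)
      have "J (mob \<gamma> w) = (\<Prod>\<delta>\<in>I. v \<delta> * phi (mob (\<pi> \<delta>) w))" unfolding J_def using elim by (intro prod.cong) auto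
      also have "\<dots> = (\<Prod>\<delta>\<in>I. v \<delta>) * (\<Prod>\<delta>\<in>I. phi (mob (\<pi> \<delta>) w))" by (rule prod.distrib)
      also have "(\<Prod>\<delta>\<in>I. phi (mob (\<pi> \<delta>) w)) = J w" unfolding J_def by (rule prod.reindex_bij_betw[OF bij])
      finally show ?case .
    qed
  qed
qed

text \<open>The factors \<open>s\<close> and \<open>t\<close> by which \<open>Smat\<close> and \<open>Tpow 1\<close> change \<open>J\<close> satisfy \<open>s\<^sup>2 = 1\<close> and \<open>(s * t) ^ 3 = 1\<close>, so the sixth
  power is invariant.\<close>

definition J6 :: "complex \<Rightarrow> complex" where "J6 z = J z ^ 6"

lemma J6_invariant:
  assumes g: "\<gamma> \<in> SL2Z" and z: "z \<in> UHP"
  shows "eventually (\<lambda>w. J6 (mob \<gamma> w) = J6 w) (at z)"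
proof -
  have pull: "eventually (\<lambda>w. J (mob A (mob B w)) = u * J (mob B w)) (at z)"
    if "\<forall>z\<in>UHP. eventually (\<lambda>w. J (mob A w) = u * J w) (at z)" "B \<in> SL2Z" "z \<in> UHP" for A B u z
  proof -
    have "mob B z \<in> UHP" using that by simp
    then have "eventually (\<lambda>w. J (mob A w) = u * J w) (at (mob B z))" using that(1) by blast
    then show ?thesis by (rule eventually_mob[OF that(2,3)])
  qed
  have iU: "\<i> \<in> UHP" by (simp add: UHP_def)
  obtain s where s: "s \<noteq> 0" "\<And>z. z \<in> UHP \<Longrightarrow> eventually (\<lambda>w. J (mob Smat w) = s * J w) (at z)"
    using J_quasi_invariant[OF Smat_SL2Z] by blast
  have sB: "\<forall>z\<in>UHP. eventually (\<lambda>w. J (mob Smat w) = s * J w) (at z)" using s(2) by blast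
  obtain t where t: "t \<noteq> 0" "\<And>z. z \<in> UHP \<Longrightarrow> eventually (\<lambda>w. J (mob (Tpow 1) w) = t * J w) (at z)"
    using J_quasi_invariant[OF Tpow_SL2Z] by blast
  \<comment> \<open>The square of \<open>Smat\<close> is minus the identity and acts trivially; a
    point near \<i> at which \<open>J\<close> does not vanish isolates the scalar.\<close>
  have s2: "s\<^sup>2 = 1"
  proof -
    have "eventually (\<lambda>w::complex. s\<^sup>2 = 1) (at \<i>)"
      using pull[OF sB Smat_SL2Z iU] s(2)[OF iU] J_eventually_nonzero[OF iU] eventually_in_UHP[OF iU]
    proof eventually_elim
      case (elim w)
      have "Smat ** Smat = - mat 1" by (simp add: Smat_def imat_mult mat1_imat uminus_imat)
      then have "mob Smat (mob Smat w) = w"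
        using mob_SL2Z_mult[OF Smat_SL2Z Smat_SL2Z elim(4)] by (simp del: mob_Smat)
      then have "J w = s * (s * J w)" using elim by simp
      then show ?case using elim(3) by (simp add: power2_eq_square)
    qed
    then show ?thesis by simp
  qed
  \<comment> \<open>This product has order 3 in PSL2(Z), which yields the second relation between
    the scalars.\<close>
  define W where "W = Smat ** Tpow 1"
  have WS: "W \<in> SL2Z" by (simp add: W_def)
  have W: "eventually (\<lambda>w. J (mob W w) = (s * t) * J w) (at z)" if z: "z \<in> UHP" for z
    using pull[OF sB Tpow_SL2Z[of 1] z] t(2)[OF z] eventually_in_UHP[OF z]
    by eventually_elim (simp add: W_def mob_SL2Z_mult del: mob_Smat mob_Tpow)
  have WB: "\<forall>z\<in>UHP. eventually (\<lambda>w. J (mob W w) = (s * t) * J w) (at z)" using W by blast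
  have WW: "W ** W \<in> SL2Z" using WS by simp
  have st: "(s * t) ^ 3 = 1"
  proof -
    have "eventually (\<lambda>w::complex. (s * t) ^ 3 = 1) (at \<i>)"
      using pull[OF WB WW iU] pull[OF WB WS iU] W[OF iU] J_eventually_nonzero[OF iU] eventually_in_UHP[OF iU]
    proof eventually_elim
      case (elim w)
      have "W ** (W ** W) = - mat 1" by (simp add: W_def Smat_def Tpow_def imat_mult mat1_imat uminus_imat)
      then have 1: "mob W (mob (W ** W) w) = w"
        using mob_SL2Z_mult[of W "W ** W" w] WS elim by simp
      have 2: "mob (W ** W) w = mob W (mob W w)" using mob_SL2Z_mult[OF WS WS elim(5)] .
      have "J w = (s * t) * J (mob (W ** W) w)" using elim(1) WS 1 by simp
      also have "\<dots> = (s * t) * ((s * t) * ((s * t) * J w))" using elim 2 by simp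
      finally show ?case using elim(4) by (simp add: power3_eq_cube mult.assoc)
    qed
    then show ?thesis by simp
  qed
  have s6: "s ^ 6 = 1"
  proof -
    have "s ^ 6 = (s\<^sup>2) ^ 3" by (simp flip: power_mult)
    then show ?thesis by (simp add: s2)
  qed
  have t6: "t ^ 6 = 1"
  proof -
    have "((s * t) ^ 3)\<^sup>2 = s ^ 6 * t ^ 6" by (simp add: power_mult_distrib flip: power_mult)
    then show ?thesis by (simp add: st s6)
  qed
  have "\<forall>z\<in>UHP. eventually (\<lambda>w. J6 (mob \<gamma> w) = J6 w) (at z)"
  proof (rule SL2Z_induct[where P = "\<lambda>\<gamma>. \<forall>z\<in>UHP. eventually (\<lambda>w. J6 (mob \<gamma> w) = J6 w) (at z)", OF g])
    show "\<forall>z\<in>UHP. eventually (\<lambda>w. J6 (mob Smat w) = J6 w) (at z)"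
    proof
      fix z assume "z \<in> UHP"
      from s(2)[OF this] show "eventually (\<lambda>w. J6 (mob Smat w) = J6 w) (at z)"
        by eventually_elim (simp add: J6_def power_mult_distrib s6 del: mob_Smat)
    qed
    show "\<forall>z\<in>UHP. eventually (\<lambda>w. J6 (mob (Tpow 1) w) = J6 w) (at z)"
    proof
      fix z assume "z \<in> UHP"
      from t(2)[OF this] show "eventually (\<lambda>w. J6 (mob (Tpow 1) w) = J6 w) (at z)"
        by eventually_elim (simp add: J6_def power_mult_distrib t6 del: mob_Tpow)
    qed
  next
    fix A B assume 3: "A \<in> SL2Z" "B \<in> SL2Z" "\<forall>z\<in>UHP. eventually (\<lambda>w. J6 (mob A w) = J6 w) (at z)"
      "\<forall>z\<in>UHP. eventually (\<lambda>w. J6 (mob B w) = J6 w) (at z)"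
    show "\<forall>z\<in>UHP. eventually (\<lambda>w. J6 (mob (A ** B) w) = J6 w) (at z)"
    proof
      fix z assume z: "z \<in> UHP"
      have "mob B z \<in> UHP" using 3 z by simp
      then have "eventually (\<lambda>w. J6 (mob A w) = J6 w) (at (mob B z))" using 3 by blast
      from eventually_mob[OF 3(2) z this] have "eventually (\<lambda>w. J6 (mob A (mob B w)) = J6 (mob B w)) (at z)" .
      moreover have "eventually (\<lambda>w. J6 (mob B w) = J6 w) (at z)" using 3 z by blast
      ultimately show "eventually (\<lambda>w. J6 (mob (A ** B) w) = J6 w) (at z)"
        using eventually_in_UHP[OF z] by eventually_elim (use 3 in \<open>simp add: mob_SL2Z_mult\<close>)
    qed
  next
    fix A assume 4: "A \<in> SL2Z" "\<forall>z\<in>UHP. eventually (\<lambda>w. J6 (mob A w) = J6 w) (at z)"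
    show "\<forall>z\<in>UHP. eventually (\<lambda>w. J6 (mob (matrix_inv A) w) = J6 w) (at z)"
    proof
      fix z assume z: "z \<in> UHP"
      have iA: "matrix_inv A \<in> SL2Z" using 4 SL2Z_inv by blast
      have "mob (matrix_inv A) z \<in> UHP" using iA z by simp
      then have "eventually (\<lambda>w. J6 (mob A w) = J6 w) (at (mob (matrix_inv A) z))" using 4 by blast
      from eventually_mob[OF iA z this]
      have "eventually (\<lambda>w. J6 (mob A (mob (matrix_inv A) w)) = J6 (mob (matrix_inv A) w)) (at z)" .
      then show "eventually (\<lambda>w. J6 (mob (matrix_inv A) w) = J6 w) (at z)"
        using eventually_in_UHP[OF z] by eventually_elim (use 4 mob_inv_cancel in simp)
    qed
  qed
  then show ?thesis using z by blast
qed

lemma J6_mero: "J6 meromorphic_on UHP"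
  unfolding J6_def[abs_def] by (intro meromorphic_intros J_mero)

text \<open>\<open>J6\<close> is invariant only off isolated points; removing singularities turns
  this into pointwise invariance, as \<open>invariant_degree_zero\<close> demands.\<close>

definition Jr :: "complex \<Rightarrow> complex" where "Jr = remove_sings J6"

lemma Jr_nice: "Jr nicely_meromorphic_on UHP"
  unfolding Jr_def by (rule remove_sings_nicely_meromorphic[OF J6_mero])

lemma Jr_invariant:
  assumes A: "A \<in> SL2Z" and z: "z \<in> UHP" shows "Jr (mob A z) = Jr z"
proof -
  have "Jr (mob A z) = remove_sings (J6 \<circ> mob A) z"
    unfolding Jr_def by (rule remove_sings_compose[OF filtermap_mob[OF A z], symmetric])
  also have "\<dots> = Jr z" unfolding Jr_def
    using J6_invariant[OF A z] by (intro remove_sings_cong) (simp_all add: o_def)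
  finally show ?thesis .
qed

lemma zorder_Jr:
  assumes z: "z \<in> UHP"
  shows "zorder Jr z = 6 * (\<Sum>\<delta>\<in>I. 4 * int D * zorder f (mob \<delta> z)) - 6 * int (card I) * b * zorder G4 z"
proof -
  have iso: "isolated_singularity_at J6 z" using J6_mero z by (simp add: meromorphic_on_altdef)
  have Jm: "J meromorphic_on {z}" using J_mero z meromorphic_on_subset by blast
  have "zorder Jr z = zorder J6 z" unfolding Jr_def by (rule zorder_remove_sings[OF iso])
  also have "\<dots> = int 6 * zorder J z" unfolding J6_def[abs_def]
    using J_eventually_nonzero[OF z] eventually_frequently[OF at_neq_bot] by (intro zorder_power Jm) blast
  also have "zorder J z = (\<Sum>\<delta>\<in>I. zorder (\<lambda>w. phi (mob \<delta> w)) z)"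
    unfolding J_def[abs_def]
  proof (rule zorder_prod)
    show "(\<lambda>w. phi (mob \<delta> w)) meromorphic_on {z}" if "\<delta> \<in> I" for \<delta>
      using meromorphic_mob[OF I_SL2Z[OF that] phi_mero] z meromorphic_on_subset by blast
    show "eventually (\<lambda>z. (\<Prod>\<delta>\<in>I. phi (mob \<delta> z)) \<noteq> 0) (at z)"
      using J_eventually_nonzero[OF z] unfolding J_def .
  qed
  also have "\<dots> = (\<Sum>\<delta>\<in>I. 4 * int D * zorder f (mob \<delta> z) - b * zorder G4 z)"
  proof (rule sum.cong[OF refl])
    fix \<delta> assume d: "\<delta> \<in> I"
    have mz: "mob \<delta> z \<in> UHP" using I_SL2Z[OF d] z by simp
    have "zorder (\<lambda>w. phi (mob \<delta> w)) z = zorder phi (mob \<delta> z)"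
      by (rule zorder_mob[OF I_SL2Z[OF d] z phi_mero_at[OF mz] phi_eventually_nonzero[OF mz]])
    then show "zorder (\<lambda>w. phi (mob \<delta> w)) z = 4 * int D * zorder f (mob \<delta> z) - b * zorder G4 z"
      using zorder_phi[OF mz] zorder_G4_mob[OF I_SL2Z[OF d] z] by simp
  qed
  finally show ?thesis by (simp add: sum_subtractf right_diff_distrib)
qed

section \<open>Orders at the cusps and the degree summed over representatives\<close>

definition cusp_order :: "mat2 \<Rightarrow> real" where "cusp_order A = ord_inf (slash D k f (tilde A))"

lemma f_mob_eventually_nonzero: "A \<in> SL2Z \<Longrightarrow> z \<in> UHP \<Longrightarrow> eventually (\<lambda>w. f (mob A w) \<noteq> 0) (at z)"
  by (rule eventually_mob) (auto intro: f_eventually_nonzero)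

lemma Phi_eventually_nonzero:
  assumes A: "A \<in> SL2Z" and z: "z \<in> UHP" shows "eventually (\<lambda>w. Phi A w \<noteq> 0) (at z)"
  using f_mob_eventually_nonzero[OF A z] eventually_in_UHP[OF z]
  by eventually_elim (use autfac_nonzero[OF SL2Z_det[OF A]] in \<open>simp add: Phi_def\<close>)

lemma Phi_growth:
  assumes A: "A \<in> SL2Z"
  obtains C where "C > 0" "((\<lambda>z. norm (Phi A z) * exp (4 * real D * (2 * pi * cusp_order A) * Im z)) \<longlongrightarrow> C) at_iinf"
proof -
  let ?g = "slash D k f (tilde A)"
  have q: "has_qexp ?g" using form A by (simp add: mero_modular_form_def)
  have "frequently (\<lambda>z. ?g z \<noteq> 0) at_iinf"
  proof (rule frequently_at_iinf)
    fix z assume z: "z \<in> UHP"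
    show "eventually (\<lambda>w. ?g w \<noteq> 0) (at z)"
      using Phi_eventually_nonzero[OF A z] eventually_in_UHP[OF z]
    proof eventually_elim
      case (elim w)
      have "?g w ^ (4 * D) = Phi A w" using slash_power[OF A] elim by simp
      then show ?case using elim(1) D by (metis mult_eq_0_iff not_one_le_zero power_0_left zero_neq_numeral)
    qed
  qed
  then obtain C where C: "C > 0" "((\<lambda>z. norm (?g z) * exp (2 * pi * cusp_order A * Im z)) \<longlongrightarrow> C) at_iinf"
    using ord_inf_growth[OF q] unfolding cusp_order_def by blast
  have "((\<lambda>z. (norm (?g z) * exp (2 * pi * cusp_order A * Im z)) ^ (4 * D)) \<longlongrightarrow> C ^ (4 * D)) at_iinf"
    by (intro tendsto_power C(2))
  moreover have "eventually (\<lambda>z. (norm (?g z) * exp (2 * pi * cusp_order A * Im z)) ^ (4 * D)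
      = norm (Phi A z) * exp (4 * real D * (2 * pi * cusp_order A) * Im z)) at_iinf"
    using eventually_UHP_at_iinf
  proof eventually_elim
    case (elim z)
    have "(norm (?g z) * exp (2 * pi * cusp_order A * Im z)) ^ (4 * D)
        = norm (?g z ^ (4 * D)) * exp (real (4 * D) * (2 * pi * cusp_order A * Im z))"
      by (simp only: power_mult_distrib norm_power exp_of_nat_mult)
    also have "real (4 * D) * (2 * pi * cusp_order A * Im z) = 4 * real D * (2 * pi * cusp_order A) * Im z" by simp
    finally show ?case unfolding slash_power[OF A elim] .
  qed
  ultimately have "((\<lambda>z. norm (Phi A z) * exp (4 * real D * (2 * pi * cusp_order A) * Im z)) \<longlongrightarrow> C ^ (4 * D)) at_iinf"
    by (rule Lim_transform_eventually)
  then show thesis using that[of "C ^ (4 * D)"] C(1) by simp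
qed

text \<open>Each factor contributes \<open>4 * D\<close> times its cusp order, and the sixth power
  makes this \<open>24 * D\<close>. The denominators tend to a power of the nonzero constant
  \<open>c4\<close> and do not affect the rate.\<close>

lemma J6_growth:
  obtains C where "C > 0"
    "((\<lambda>z. norm (J6 z) * exp (2 * pi * (24 * real D * (\<Sum>\<delta>\<in>I. cusp_order \<delta>)) * Im z)) \<longlongrightarrow> C) at_iinf"
proof -
  define a where "a \<delta> = 4 * real D * (2 * pi * cusp_order \<delta>)" for \<delta>
  have "\<forall>\<delta>\<in>I. \<exists>C. C > 0 \<and> ((\<lambda>z. norm (Phi \<delta> z) * exp (a \<delta> * Im z)) \<longlongrightarrow> C) at_iinf"
    unfolding a_def using Phi_growth[OF I_SL2Z] by metis
  then obtain C where C: "\<And>\<delta>. \<delta> \<in> I \<Longrightarrow> C \<delta> > 0"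
    "\<And>\<delta>. \<delta> \<in> I \<Longrightarrow> ((\<lambda>z. norm (Phi \<delta> z) * exp (a \<delta> * Im z)) \<longlongrightarrow> C \<delta>) at_iinf" by metis
  define L where "L = (\<Prod>\<delta>\<in>I. C \<delta> / norm c4 powi b) ^ 6"
  have c4: "norm c4 \<noteq> 0" using c4_bounds(1) by auto
  have "((\<lambda>z. (\<Prod>\<delta>\<in>I. norm (Phi \<delta> z) * exp (a \<delta> * Im z) / norm (G4 z) powi b) ^ 6) \<longlongrightarrow> L) at_iinf"
    unfolding L_def
    by (intro tendsto_power tendsto_prod tendsto_divide C(2) tendsto_power_int tendsto_norm G4_tendsto)
       (use c4 in auto)
  moreover have "eventually (\<lambda>z. (\<Prod>\<delta>\<in>I. norm (Phi \<delta> z) * exp (a \<delta> * Im z) / norm (G4 z) powi b) ^ 6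
      = norm (J6 z) * exp (2 * pi * (24 * real D * (\<Sum>\<delta>\<in>I. cusp_order \<delta>)) * Im z)) at_iinf"
    using eventually_UHP_at_iinf
  proof eventually_elim
    case (elim z)
    have "(\<Prod>\<delta>\<in>I. norm (Phi \<delta> z) * exp (a \<delta> * Im z) / norm (G4 z) powi b)
        = (\<Prod>\<delta>\<in>I. norm (phi (mob \<delta> z)) * exp (a \<delta> * Im z))"
      using phi_mob[OF I_SL2Z elim] by (intro prod.cong refl) (simp add: norm_divide norm_power_int)
    also have "\<dots> = norm (J z) * (\<Prod>\<delta>\<in>I. exp (a \<delta> * Im z))"
      by (simp add: prod.distrib J_def prod_norm)
    also have "(\<Prod>\<delta>\<in>I. exp (a \<delta> * Im z)) = exp ((\<Sum>\<delta>\<in>I. a \<delta> * Im z))"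
      using finite_I by (simp add: exp_sum)
    also have "(\<Sum>\<delta>\<in>I. a \<delta> * Im z) = 4 * real D * (2 * pi * (\<Sum>\<delta>\<in>I. cusp_order \<delta>)) * Im z"
      by (simp add: a_def sum_distrib_left sum_distrib_right)
    finally have "(\<Prod>\<delta>\<in>I. norm (Phi \<delta> z) * exp (a \<delta> * Im z) / norm (G4 z) powi b) ^ 6
        = norm (J6 z) * exp (real 6 * (4 * real D * (2 * pi * (\<Sum>\<delta>\<in>I. cusp_order \<delta>)) * Im z))"
      unfolding exp_of_nat_mult by (simp add: J6_def power_mult_distrib norm_power)
    also have "real 6 * (4 * real D * (2 * pi * (\<Sum>\<delta>\<in>I. cusp_order \<delta>)) * Im z)
        = 2 * pi * (24 * real D * (\<Sum>\<delta>\<in>I. cusp_order \<delta>)) * Im z" by simp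
    finally show ?case .
  qed
  ultimately have "((\<lambda>z. norm (J6 z) * exp (2 * pi * (24 * real D * (\<Sum>\<delta>\<in>I. cusp_order \<delta>)) * Im z)) \<longlongrightarrow> L) at_iinf"
    by (rule Lim_transform_eventually)
  moreover have "L > 0" unfolding L_def using C(1) c4 by (intro zero_less_power prod_pos divide_pos_pos) auto
  ultimately show thesis using that by blast
qed

lemma Phi_mero: "A \<in> SL2Z \<Longrightarrow> Phi A meromorphic_on UHP"
proof -
  assume A: "A \<in> SL2Z"
  have "autfac A meromorphic_on UHP"
    by (rule analytic_on_imp_meromorphic_on) (simp add: analytic_on_open[OF open_UHP] autfac_holomorphic)
  then show ?thesis unfolding Phi_def[abs_def] by (intro meromorphic_intros meromorphic_mob[OF A f_mero])
qed

lemma zorder_Phi: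
  assumes A: "A \<in> SL2Z" and z: "z \<in> UHP"
  shows "zorder (Phi A) z = 4 * int D * zorder f (mob A z)"
proof -
  have mz: "mob A z \<in> UHP" using A z by simp
  have "eventually (\<lambda>w. Phi A w = phi (mob A w) * G4 w powi b) (at z)"
    using eventually_in_UHP[OF z] G4_eventually_nonzero[OF z]
    by eventually_elim (use phi_mob[OF A] in simp)
  then have "zorder (Phi A) z = zorder (\<lambda>w. phi (mob A w) * G4 w powi b) z"
    by (rule zorder_cong) simp
  also have "\<dots> = zorder (\<lambda>w. phi (mob A w)) z + zorder (\<lambda>w. G4 w powi b) z"
  proof (rule zorder_mult)
    have mG: "G4 meromorphic_on {z}" using G4_analytic[OF z] by (rule analytic_on_imp_meromorphic_on)
    show "(\<lambda>w. phi (mob A w)) meromorphic_on {z}"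
      using meromorphic_mob[OF A phi_mero] z meromorphic_on_subset by blast
    show "(\<lambda>w. G4 w powi b) meromorphic_on {z}" by (intro meromorphic_intros mG)
    show "frequently (\<lambda>w. phi (mob A w) \<noteq> 0) (at z)"
      using phi_mob_eventually_nonzero[OF A z] eventually_frequently[OF at_neq_bot] by blast
    have "eventually (\<lambda>w. G4 w powi b \<noteq> 0) (at z)"
      using G4_eventually_nonzero[OF z] by eventually_elim simp
    then show "frequently (\<lambda>w. G4 w powi b \<noteq> 0) (at z)" using eventually_frequently[OF at_neq_bot] by blast
  qed
  also have "zorder (\<lambda>w. phi (mob A w)) z = zorder phi (mob A z)"
    by (rule zorder_mob[OF A z phi_mero_at[OF mz] phi_eventually_nonzero[OF mz]])
  also have "zorder (\<lambda>w. G4 w powi b) z = b * zorder G4 z"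
    using G4_analytic[OF z] G4_eventually_nonzero[OF z] eventually_frequently[OF at_neq_bot]
    by (intro zorder_power_int analytic_on_imp_meromorphic_on) blast+
  finally show ?thesis using zorder_phi[OF mz] zorder_G4_mob[OF A z] by simp
qed

text \<open>Growth at the cusp excludes zeros and poles above some height; the remaining part of the
  strip lies in a compact box.\<close>

lemma finite_zeros_strip:
  assumes A: "A \<in> SL2Z"
  shows "finite {z\<in>strip. Im z > 1/2 \<and> zorder f (mob A z) \<noteq> 0}"
proof -
  obtain C where C: "C > 0" "((\<lambda>z. norm (Phi A z) * exp (4 * real D * (2 * pi * cusp_order A) * Im z)) \<longlongrightarrow> C) at_iinf"
    using Phi_growth[OF A] by blast
  obtain Y where Y: "Y > 0" "\<And>z. Im z > Y \<Longrightarrow> \<exists>a B. a > 0 \<and> eventually (\<lambda>w. a \<le> norm (Phi A w) \<and> norm (Phi A w) \<le> B) (at z)"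
    using growth_near[OF C(2,1)] by blast
  define K where "K = cbox (Complex 0 (1/2)) (Complex 1 Y)"
  have KU: "K \<subseteq> UHP" by (auto simp: K_def UHP_def in_cbox_complex_iff)
  have "finite {z\<in>K. zorder (Phi A) z \<noteq> 0}"
    by (rule finite_zorder_nonzero_compact[OF Phi_mero[OF A] Phi_eventually_nonzero[OF A] _ KU]) (auto simp: K_def)
  moreover have "{z\<in>strip. Im z > 1/2 \<and> zorder f (mob A z) \<noteq> 0} \<subseteq> {z\<in>K. zorder (Phi A) z \<noteq> 0}"
  proof
    fix z assume z: "z \<in> {z\<in>strip. Im z > 1/2 \<and> zorder f (mob A z) \<noteq> 0}"
    then have zU: "z \<in> UHP" using strip_UHP by auto
    have nz: "zorder (Phi A) z \<noteq> 0" using zorder_Phi[OF A zU] z D by simp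
    have "Im z \<le> Y"
    proof (rule ccontr)
      assume "\<not> Im z \<le> Y"
      then obtain a B where "a > 0" "eventually (\<lambda>w. a \<le> norm (Phi A w) \<and> norm (Phi A w) \<le> B) (at z)"
        using Y(2)[of z] by auto
      then have "zorder (Phi A) z = 0"
        using Phi_mero[OF A] zU meromorphic_on_subset by (intro zorder_eq_0_bounded) blast+
      then show False using nz by simp
    qed
    then show "z \<in> {z\<in>K. zorder (Phi A) z \<noteq> 0}" using z nz by (auto simp: K_def in_cbox_complex_iff strip_def)
  qed
  ultimately show ?thesis using finite_subset by blast
qed

text \<open>One common index set for all the sums. Zeros and poles of different factors may cancel
  in \<open>Jr\<close>, so its support is merely contained in this set.\<close>

definition strip_divisor :: "complex set" where
  "strip_divisor = {z\<in>strip. Im z > 1/2 \<and> ((\<exists>\<delta>\<in>I. zorder f (mob \<delta> z) \<noteq> 0) \<or> zorder G4 z \<noteq> 0)}"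

lemma finite_strip_divisor: "finite strip_divisor"
proof -
  have "strip_divisor = (\<Union>\<delta>\<in>I. {z\<in>strip. Im z > 1/2 \<and> zorder f (mob \<delta> z) \<noteq> 0}) \<union> {z\<in>strip. Im z > 1/2 \<and> zorder G4 z \<noteq> 0}"
    by (auto simp: strip_divisor_def)
  then show ?thesis using finite_zeros_strip[OF I_SL2Z] finite_I G4_weighted_zeros(1) by simp
qed

lemma strip_divisor_UHP: "z \<in> strip_divisor \<Longrightarrow> z \<in> UHP" using strip_UHP by (auto simp: strip_divisor_def)

text \<open>Degree zero for \<open>Jr\<close> separates into \<open>24 * D\<close> times the
  left-hand side minus \<open>6 * card I * b\<close> times the degree 1/3 of \<open>G4\<close>;
  inserting \<open>b = D * k\<close> and cancelling \<open>D\<close> gives the claim.\<close>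

lemma degree_reps:
  "(\<Sum>\<delta>\<in>I. cusp_order \<delta>) + (\<Sum>z\<in>strip_divisor. \<Sum>\<delta>\<in>I. real_of_int (zorder f (mob \<delta> z)) * orbit_weight z) = real (card I) * k / 12"
proof -
  define R where "R = 24 * real D * (\<Sum>\<delta>\<in>I. cusp_order \<delta>)"
  define T where "T = (\<Sum>z\<in>strip_divisor. \<Sum>\<delta>\<in>I. real_of_int (zorder f (mob \<delta> z)) * orbit_weight z)"
  obtain C where C: "C > 0" "((\<lambda>z. norm (J6 z) * exp (2 * pi * R * Im z)) \<longlongrightarrow> C) at_iinf"
    using J6_growth unfolding R_def by blast
  have lim: "((\<lambda>z. norm (Jr z) * exp (2 * pi * R * Im z)) \<longlongrightarrow> C) at_iinf"
    unfolding Jr_def by (rule growth_remove_sings[OF J6_mero C(2,1)])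
  let ?S = "{z\<in>strip. Im z > 1/2 \<and> zorder Jr z \<noteq> 0}"
  have "R + (\<Sum>z\<in>?S. real_of_int (zorder Jr z) * orbit_weight z) = 0"
    by (rule invariant_degree_zero(2)[OF Jr_nice Jr_invariant lim C(1)])
  also have "(\<Sum>z\<in>?S. real_of_int (zorder Jr z) * orbit_weight z) = (\<Sum>z\<in>strip_divisor. real_of_int (zorder Jr z) * orbit_weight z)"
  proof (rule sum.mono_neutral_left[OF finite_strip_divisor])
    show "?S \<subseteq> strip_divisor"
    proof
      fix z assume z: "z \<in> ?S"
      then have "z \<in> UHP" using strip_UHP by auto
      from zorder_Jr[OF this] z have "(\<exists>\<delta>\<in>I. zorder f (mob \<delta> z) \<noteq> 0) \<or> zorder G4 z \<noteq> 0"
        by (metis (mono_tags, lifting) diff_0_right mem_Collect_eq mult_zero_right sum.neutral)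
      then show "z \<in> strip_divisor" using z by (simp add: strip_divisor_def)
    qed
    show "\<forall>z\<in>strip_divisor - ?S. real_of_int (zorder Jr z) * orbit_weight z = 0" by (auto simp: strip_divisor_def)
  qed
  also have "\<dots> = (\<Sum>z\<in>strip_divisor. 24 * real D * (\<Sum>\<delta>\<in>I. real_of_int (zorder f (mob \<delta> z)) * orbit_weight z)
      - 6 * real (card I) * real_of_int b * (real_of_int (zorder G4 z) * orbit_weight z))"
  proof (rule sum.cong[OF refl])
    fix z assume "z \<in> strip_divisor"
    then have "real_of_int (zorder Jr z) = 6 * (\<Sum>\<delta>\<in>I. 4 * real D * real_of_int (zorder f (mob \<delta> z)))
        - 6 * real (card I) * real_of_int b * real_of_int (zorder G4 z)"
      using zorder_Jr[OF strip_divisor_UHP] by simp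
    then show "real_of_int (zorder Jr z) * orbit_weight z = 24 * real D * (\<Sum>\<delta>\<in>I. real_of_int (zorder f (mob \<delta> z)) * orbit_weight z)
      - 6 * real (card I) * real_of_int b * (real_of_int (zorder G4 z) * orbit_weight z)"
      by (simp add: left_diff_distrib sum_distrib_left sum_distrib_right mult.assoc)
  qed
  also have "\<dots> = 24 * real D * T - 6 * real (card I) * real_of_int b * (\<Sum>z\<in>strip_divisor. real_of_int (zorder G4 z) * orbit_weight z)"
    by (simp add: T_def sum_subtractf sum_distrib_left)
  also have "(\<Sum>z\<in>strip_divisor. real_of_int (zorder G4 z) * orbit_weight z)
      = (\<Sum>z\<in>{z\<in>strip. Im z > 1/2 \<and> zorder G4 z \<noteq> 0}. real_of_int (zorder G4 z) * orbit_weight z)"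
    by (rule sum.mono_neutral_right[OF finite_strip_divisor]) (auto simp: strip_divisor_def)
  also have "\<dots> = 1 / 3" by (rule G4_weighted_zeros(2))
  finally have "24 * real D * (\<Sum>\<delta>\<in>I. cusp_order \<delta>) + 24 * real D * T = 2 * real (card I) * real_of_int b"
    by (simp add: R_def mult.commute mult.left_commute)
  then have "real D * (24 * ((\<Sum>\<delta>\<in>I. cusp_order \<delta>) + T)) = real D * (2 * real (card I) * k)"
    using b by (simp add: algebra_simps)
  then have "24 * ((\<Sum>\<delta>\<in>I. cusp_order \<delta>) + T) = 2 * real (card I) * k" using D by simp
  then show ?thesis by (simp add: T_def)
qed

section \<open>From sums over representatives to the divisor on orbits\<close>

lemma zorder_f_orbit:
  assumes "\<tau> \<in> UHP" "\<tau>' \<in> UHP" "Fin \<tau>' \<in> orbit G (Fin \<tau>)"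
  shows "zorder f \<tau>' = zorder f \<tau>"
proof -
  obtain g where g: "g \<in> G" "Fin \<tau>' = mob_pt g (Fin \<tau>)" using assms(3) by (auto simp: orbit_def)
  then have "\<tau>' = mob g \<tau>" using mob_pt_Fin[of g \<tau>] assms subgroupD(5)[OF G] by simp
  then show ?thesis using zorder_f_G[OF g(1) assms(1)] by simp
qed

text \<open>A pair stands for the point \<open>mob \<delta> z\<close>. Sorting the pairs by the
  \<open>G\<close>-orbit of that point turns the sum over representatives into a sum over
  \<open>G\<close>-orbits.\<close>

definition zero_pairs :: "(complex \<times> mat2) set" where "zero_pairs = {(z,\<delta>) \<in> strip_divisor \<times> I. zorder f (mob \<delta> z) \<noteq> 0}"

definition pair_orbit :: "complex \<times> mat2 \<Rightarrow> pt set" where "pair_orbit = (\<lambda>(z,\<delta>). orbit G (Fin (mob \<delta> z)))"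

lemma finite_zero_pairs: "finite zero_pairs"
  by (rule finite_subset[of _ "strip_divisor \<times> I"]) (auto simp: zero_pairs_def finite_strip_divisor finite_I)

text \<open>For each \<open>z\<close> in the strip orbit of \<tau>, the number of \<delta> carrying
  \<open>z\<close> into the \<open>G\<close>-orbit of \<tau> is the index of stabilisers, the same
  for all \<open>z\<close>. The orbit weights add up to \<open>2 / card (zstab \<tau>)\<close>, and
  \<open>pindex_stab_Fin\<close> combines the two factors.\<close>

lemma orbit_sum_H:
  assumes \<tau>: "\<tau> \<in> UHP" and nz: "zorder f \<tau> \<noteq> 0"
  shows "(\<Sum>(z,\<delta>)\<in>{q\<in>zero_pairs. pair_orbit q = orbit G (Fin \<tau>)}. real_of_int (zorder f (mob \<delta> z)) * orbit_weight z)
    = real_of_int (zorder f \<tau>) / real (card (proj ` stab G (Fin \<tau>)))"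
proof -
  let ?O = "orbit G (Fin \<tau>)"
  let ?P = "pindex (stab SL2Z (Fin \<tau>)) (stab G (Fin \<tau>))"
  define B where "B z = {\<delta>\<in>I. mob_pt \<delta> (Fin z) \<in> ?O}" for z
  have OU: "z \<in> UHP" if "z \<in> strip_orbit \<tau>" for z using that strip_UHP by (auto simp: strip_orbit_def)
  have zB: "zorder f (mob \<delta> z) = zorder f \<tau>" if "z \<in> strip_orbit \<tau>" "\<delta> \<in> B z" for z \<delta>
  proof -
    have dS: "\<delta> \<in> SL2Z" using that I_SL2Z by (auto simp: B_def)
    have "Fin (mob \<delta> z) \<in> ?O" using that mob_pt_Fin[OF dS OU[OF that(1)]] by (simp add: B_def)
    then show ?thesis using zorder_f_orbit[OF \<tau>] dS OU[OF that(1)] by simp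
  qed
  have set: "{q\<in>zero_pairs. pair_orbit q = ?O} = Sigma (strip_orbit \<tau>) B"
  proof (intro equalityI subsetI)
    fix q assume q: "q \<in> {q\<in>zero_pairs. pair_orbit q = ?O}"
    obtain z \<delta> where zd: "q = (z,\<delta>)" by (cases q)
    have z: "z \<in> strip_divisor" "\<delta> \<in> I" and o: "orbit G (Fin (mob \<delta> z)) = ?O" using q zd by (auto simp: zero_pairs_def pair_orbit_def)
    have dS: "\<delta> \<in> SL2Z" using z I_SL2Z by blast
    have zU: "z \<in> UHP" using strip_divisor_UHP z by blast
    have mem: "Fin (mob \<delta> z) \<in> ?O" using o orbit_refl[OF G] by blast
    then obtain g where g: "g \<in> G" "Fin (mob \<delta> z) = mob_pt g (Fin \<tau>)" by (auto simp: orbit_def)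
    have gS: "g \<in> SL2Z" using g subgroupD(5)[OF G] by blast
    have "mob \<delta> z = mob g \<tau>" using g mob_pt_Fin[OF gS \<tau>] by simp
    then have "z = mob (matrix_inv \<delta>) (mob g \<tau>)" using mob_inv_cancel(2)[OF dS zU] by simp
    then have "z = mob (matrix_inv \<delta> ** g) \<tau>" using dS gS \<tau> by (simp add: mob_SL2Z_mult SL2Z_inv)
    moreover have "matrix_inv \<delta> ** g \<in> SL2Z" using dS gS by (simp add: SL2Z_inv)
    ultimately have "z \<in> strip_orbit \<tau>" using z by (auto simp: strip_orbit_def strip_divisor_def)
    moreover have "\<delta> \<in> B z" using z mem mob_pt_Fin[OF dS zU] by (simp add: B_def)
    ultimately show "q \<in> Sigma (strip_orbit \<tau>) B" using zd by simp
  next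
    fix q assume q: "q \<in> Sigma (strip_orbit \<tau>) B"
    obtain z \<delta> where zd: "q = (z,\<delta>)" by (cases q)
    have z: "z \<in> strip_orbit \<tau>" "\<delta> \<in> B z" using q zd by auto
    have dI: "\<delta> \<in> I" and mem: "mob_pt \<delta> (Fin z) \<in> ?O" using z by (auto simp: B_def)
    have n: "zorder f (mob \<delta> z) \<noteq> 0" using zB[OF z] nz by simp
    then have "z \<in> strip_divisor" using z dI by (auto simp: strip_divisor_def strip_orbit_def)
    moreover have "orbit G (Fin (mob \<delta> z)) = ?O"
      using orbit_eq[OF G mem] mob_pt_Fin[OF I_SL2Z[OF dI] OU[OF z(1)]] by simp
    ultimately show "q \<in> {q\<in>zero_pairs. pair_orbit q = ?O}" using zd dI n by (simp add: zero_pairs_def pair_orbit_def)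
  qed
  have cardB: "card (B z) = ?P" if z: "z \<in> strip_orbit \<tau>" for z
  proof -
    obtain A where A: "A \<in> SL2Z" "z = mob A \<tau>" using z by (auto simp: strip_orbit_def)
    have iA: "matrix_inv A \<in> SL2Z" using A SL2Z_inv by blast
    have "mob_pt (matrix_inv A) (Fin z) = Fin \<tau>"
      using mob_pt_Fin[OF iA OU[OF z]] A mob_inv_cancel(2)[OF A(1) \<tau>] by simp
    then show ?thesis unfolding B_def using coset_count[OF G iA, of "Fin \<tau>" "Fin z"] by simp
  qed
  have finB: "finite (B z)" for z using finite_I by (simp add: B_def)
  have "(\<Sum>(z,\<delta>)\<in>{q\<in>zero_pairs. pair_orbit q = ?O}. real_of_int (zorder f (mob \<delta> z)) * orbit_weight z)
      = (\<Sum>z\<in>strip_orbit \<tau>. \<Sum>\<delta>\<in>B z. real_of_int (zorder f (mob \<delta> z)) * orbit_weight z)"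
    unfolding set using finite_strip_orbit[OF \<tau>] finB by (subst sum.Sigma) auto
  also have "\<dots> = (\<Sum>z\<in>strip_orbit \<tau>. \<Sum>\<delta>\<in>B z. real_of_int (zorder f \<tau>) * orbit_weight z)"
    by (intro sum.cong refl) (simp add: zB)
  also have "\<dots> = (\<Sum>z\<in>strip_orbit \<tau>. real ?P * real_of_int (zorder f \<tau>) * orbit_weight z)"
    by (intro sum.cong refl) (simp add: cardB)
  also have "\<dots> = real ?P * real_of_int (zorder f \<tau>) * (2 / card (zstab \<tau>))"
    unfolding sum_distrib_left[symmetric] sum_orbit_weight_strip_orbit[OF \<tau>] ..
  also have "\<dots> = real_of_int (zorder f \<tau>) / real (card (proj ` stab G (Fin \<tau>)))"
    using pindex_stab_Fin[OF G \<tau>] finite_zstab_bound(3)[OF \<tau>] by (simp add: field_simps)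
  finally show ?thesis .
qed

lemma divisor_H:
  assumes O: "O' \<in> orbits G" "\<tau>1 \<in> UHP" "Fin \<tau>1 \<in> O'"
  obtains \<tau> where "\<tau> \<in> UHP" "O' = orbit G (Fin \<tau>)"
    "divisor D k G f O' = real_of_int (zorder f \<tau>) / real (card (proj ` stab G (Fin \<tau>)))"
proof -
  define \<tau> where "\<tau> = (SOME \<tau>. \<tau> \<in> UHP \<and> Fin \<tau> \<in> O')"
  have "\<tau> \<in> UHP \<and> Fin \<tau> \<in> O'" unfolding \<tau>_def by (rule someI[of _ \<tau>1]) (use assms in auto)
  then have t: "\<tau> \<in> UHP" "Fin \<tau> \<in> O'" by auto
  obtain p where "O' = orbit G p" using O by (auto simp: orbits_def)
  then have "O' = orbit G (Fin \<tau>)" using orbit_eq[OF G] t by blast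
  moreover have "divisor D k G f O' = real_of_int (zorder f \<tau>) / real (card (proj ` stab G (Fin \<tau>)))"
    unfolding divisor_def \<tau>_def Let_def using assms by auto
  ultimately show thesis using that t by blast
qed

text \<open>Up to sign \<delta> is \<open>g ** \<gamma> ** Tpow n\<close>, so the two functions
  \<open>Phi\<close> agree up to a scalar and a horizontal translation, neither of which changes the
  growth rate.\<close>

lemma cusp_order_eq:
  assumes d: "\<delta> \<in> SL2Z" and g: "g \<in> G" and c: "\<gamma> \<in> SL2Z"
    and eq: "mob_pt \<delta> Infty = mob_pt g (mob_pt \<gamma> Infty)"
  shows "cusp_order \<delta> = cusp_order \<gamma>"
proof -
  have gS: "g \<in> SL2Z" using g subgroupD(5)[OF G] by blast
  define M where "M = g ** \<gamma>"
  have MS: "M \<in> SL2Z" using gS c by (simp add: M_def)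
  have iM: "matrix_inv M \<in> SL2Z" using SL2Z_inv[OF MS] by blast
  have tS: "matrix_inv M ** \<delta> \<in> SL2Z" using iM d by simp
  have "mob_pt (matrix_inv M ** \<delta>) Infty = Infty"
    using eq iM d gS c mob_pt_inv(1)[OF MS, of Infty] by (simp add: mob_pt_mult M_def)
  then obtain n where n: "matrix_inv M ** \<delta> = Tpow n \<or> matrix_inv M ** \<delta> = - Tpow n"
    using stab_Infty[OF tS] by blast
  have "\<delta> = M ** (matrix_inv M ** \<delta>)" using SL2Z_mult_inv_cancel(1)[OF MS] by simp
  then have "\<delta> = M ** Tpow n \<or> \<delta> = - (M ** Tpow n)" using n by (auto simp: mat2_uminus_mult)
  then have Pd: "Phi \<delta> z = Phi (M ** Tpow n) z" for z using Phi_uminus by auto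
  obtain v where v: "v \<noteq> 0" "\<And>z. z \<in> UHP \<Longrightarrow> eventually (\<lambda>w. Phi g w = v * f w ^ (4 * D)) (at z)"
    using Phi_G[OF g] by blast
  \<comment> \<open>The identity may fail at isolated points, so the rates are compared along the
    filter restricted to \<open>X\<close>, which is still nontrivial.\<close>
  define X where "X = {z. Phi \<delta> z = v * Phi \<gamma> (z + of_int n)}"
  have "frequently (\<lambda>z. z \<in> X) at_iinf"
  proof (rule frequently_at_iinf)
    fix z assume z: "z \<in> UHP"
    define A where "A = \<gamma> ** Tpow n"
    have AS: "A \<in> SL2Z" using c by (simp add: A_def)
    have "mob A z \<in> UHP" using AS z by simp
    from eventually_mob[OF AS z v(2)[OF this]] eventually_in_UHP[OF z]
    show "eventually (\<lambda>w. w \<in> X) (at z)"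
    proof eventually_elim
      case (elim w)
      have wn: "w + of_int n \<in> UHP" using elim(2) by (simp add: UHP_def)
      have mA: "mob A w = mob \<gamma> (w + of_int n)" using c elim(2) by (simp add: A_def mob_SL2Z_mult)
      have "Phi \<delta> w = Phi M (w + of_int n)" unfolding Pd using Phi_mult[OF MS Tpow_SL2Z elim(2)] by simp
      also have "\<dots> = Phi g (mob \<gamma> (w + of_int n)) * autfac \<gamma> (w + of_int n) powi (- 4 * b)"
        unfolding M_def by (rule Phi_mult[OF gS c wn])
      also have "Phi g (mob \<gamma> (w + of_int n)) = v * f (mob \<gamma> (w + of_int n)) ^ (4 * D)"
        using elim(1) unfolding mA .
      finally show ?case by (simp add: X_def Phi_def)
    qed
  qed
  then have bot: "inf at_iinf (principal X) \<noteq> bot"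
    unfolding frequently_def trivial_limit_def[symmetric] by (auto simp: trivial_limit_def eventually_inf_principal)
  obtain C where C: "C > 0" "((\<lambda>z. norm (Phi \<delta> z) * exp (4 * real D * (2 * pi * cusp_order \<delta>) * Im z)) \<longlongrightarrow> C) at_iinf"
    using Phi_growth[OF d] by blast
  obtain C' where C': "C' > 0" "((\<lambda>z. norm (Phi \<gamma> z) * exp (4 * real D * (2 * pi * cusp_order \<gamma>) * Im z)) \<longlongrightarrow> C') at_iinf"
    using Phi_growth[OF c] by blast
  have "((\<lambda>z. norm (Phi \<gamma> (z + of_int n)) * exp (4 * real D * (2 * pi * cusp_order \<gamma>) * Im (z + of_int n))) \<longlongrightarrow> C') at_iinf"
    by (rule filterlim_compose[OF C'(2) filterlim_shift_at_iinf])
  then have "((\<lambda>z. norm v * (norm (Phi \<gamma> (z + of_int n)) * exp (4 * real D * (2 * pi * cusp_order \<gamma>) * Im z))) \<longlongrightarrow> norm v * C') at_iinf"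
    by (intro tendsto_mult_left) simp
  then have "((\<lambda>z. norm v * (norm (Phi \<gamma> (z + of_int n)) * exp (4 * real D * (2 * pi * cusp_order \<gamma>) * Im z))) \<longlongrightarrow> norm v * C') (inf at_iinf (principal X))"
    by (rule tendsto_mono[OF inf_le1])
  moreover have "eventually (\<lambda>z. norm v * (norm (Phi \<gamma> (z + of_int n)) * exp (4 * real D * (2 * pi * cusp_order \<gamma>) * Im z))
      = norm (Phi \<delta> z) * exp (4 * real D * (2 * pi * cusp_order \<gamma>) * Im z)) (inf at_iinf (principal X))"
    unfolding eventually_inf_principal by (rule always_eventually) (auto simp: X_def norm_mult)
  ultimately have 2: "((\<lambda>z. norm (Phi \<delta> z) * exp (4 * real D * (2 * pi * cusp_order \<gamma>) * Im z)) \<longlongrightarrow> norm v * C') (inf at_iinf (principal X))"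
    by (rule Lim_transform_eventually)
  have 1: "((\<lambda>z. norm (Phi \<delta> z) * exp (4 * real D * (2 * pi * cusp_order \<delta>) * Im z)) \<longlongrightarrow> C) (inf at_iinf (principal X))"
    using C(2) by (rule tendsto_mono[OF inf_le1])
  have x: "filterlim Im at_top (inf at_iinf (principal X))"
    using filterlim_Im_at_iinf by (rule filterlim_mono) auto
  have "4 * real D * (2 * pi * cusp_order \<delta>) = 4 * real D * (2 * pi * cusp_order \<gamma>)"
    by (rule exp_rate_unique[OF bot x 1 2]) (use C(1) C'(1) v(1) in auto)
  then show ?thesis using D by simp
qed

definition cusp_class :: "mat2 \<Rightarrow> pt set" where "cusp_class \<delta> = orbit G (mob_pt \<delta> Infty)"

lemma cusp_not_UHP:
  assumes "\<delta> \<in> SL2Z" "\<tau> \<in> UHP" shows "Fin \<tau> \<notin> cusp_class \<delta>"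
proof
  assume "Fin \<tau> \<in> cusp_class \<delta>"
  then obtain g where g: "g \<in> G" "Fin \<tau> = mob_pt g (mob_pt \<delta> Infty)" by (auto simp: cusp_class_def orbit_def)
  have gS: "g \<in> SL2Z" using g subgroupD(5)[OF G] by blast
  have "Fin \<tau> = mob_pt (g ** \<delta>) Infty" using g gS assms by (simp add: mob_pt_mult)
  then have "\<exists>x::real. \<tau> = of_real x"
    by (auto simp: mob_pt_def simp flip: of_real_divide split: if_splits)
  then show False using assms(2) by (auto simp: UHP_def)
qed

text \<open>By \<open>coset_count\<close> the width is the number of representatives leading to the
  cusp, and all of them have the same cusp order. The points chosen in \<open>divisor\<close>
  therefore do not matter.\<close>

lemma divisor_cusp:
  assumes d: "\<delta> \<in> SL2Z"
  shows "divisor D k G f (cusp_class \<delta>) = (\<Sum>\<delta>'\<in>{\<delta>'\<in>I. cusp_class \<delta>' = cusp_class \<delta>}. cusp_order \<delta>')"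
proof -
  let ?O = "cusp_class \<delta>"
  have no: "\<not> (\<exists>\<tau>\<in>UHP. Fin \<tau> \<in> ?O)" using cusp_not_UHP[OF d] by blast
  define x where "x = (SOME x. x \<in> ?O)"
  have "mob_pt \<delta> Infty \<in> ?O" unfolding cusp_class_def by (rule orbit_refl[OF G])
  then have x: "x \<in> ?O" unfolding x_def by (rule someI)
  then obtain g0 where g0: "g0 \<in> G" "x = mob_pt g0 (mob_pt \<delta> Infty)" by (auto simp: cusp_class_def orbit_def)
  have g0S: "g0 \<in> SL2Z" using g0 subgroupD(5)[OF G] by blast
  define \<gamma> where "\<gamma> = (SOME \<gamma>. \<gamma> \<in> SL2Z \<and> mob_pt \<gamma> Infty = x)"
  have "\<gamma> \<in> SL2Z \<and> mob_pt \<gamma> Infty = x" unfolding \<gamma>_def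
    by (rule someI[of _ "g0 ** \<delta>"]) (use g0 g0S d in \<open>simp add: mob_pt_mult\<close>)
  then have \<gamma>: "\<gamma> \<in> SL2Z" "mob_pt \<gamma> Infty = x" by auto
  have "divisor D k G f ?O = cusp_order \<gamma> * real (width G x)"
    unfolding divisor_def cusp_order_def Let_def if_not_P[OF no] x_def[symmetric] \<gamma>_def[symmetric] ..
  have O: "orbit G x = ?O" using orbit_eq[OF G, of x "mob_pt \<delta> Infty"] x unfolding cusp_class_def by blast
  have set: "{\<delta>'\<in>I. cusp_class \<delta>' = ?O} = {\<delta>'\<in>I. mob_pt \<delta>' Infty \<in> orbit G x}"
    by (rule Collect_cong) (use orbit_eq_iff[OF G, of _ x] O in \<open>auto simp: cusp_class_def\<close>)
  have "cusp_order \<delta>' = cusp_order \<gamma>" if d': "\<delta>' \<in> {\<delta>'\<in>I. mob_pt \<delta>' Infty \<in> orbit G x}" for \<delta>'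
  proof -
    obtain g where "g \<in> G" "mob_pt \<delta>' Infty = mob_pt g x" using d' by (auto simp: orbit_def)
    then show ?thesis using cusp_order_eq[of \<delta>' g \<gamma>] \<gamma> d' I_SL2Z by simp
  qed
  then have "(\<Sum>\<delta>'\<in>{\<delta>'\<in>I. cusp_class \<delta>' = ?O}. cusp_order \<delta>') = real (card {\<delta>'\<in>I. mob_pt \<delta>' Infty \<in> orbit G x}) * cusp_order \<gamma>"
    unfolding set by simp
  also have "card {\<delta>'\<in>I. mob_pt \<delta>' Infty \<in> orbit G x} = width G x"
    using coset_count[OF G \<gamma>(1), of x Infty] \<gamma>(2) by (simp add: width_def)
  finally show ?thesis using \<open>divisor D k G f ?O = cusp_order \<gamma> * real (width G x)\<close> by simp
qed

lemma cusp_orbit: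
  assumes "O' \<in> orbits G" "\<not> (\<exists>\<tau>\<in>UHP. Fin \<tau> \<in> O')"
  shows "O' \<in> cusp_class ` I"
proof -
  obtain p where p: "p \<in> Hbar" "O' = orbit G p" using assms by (auto simp: orbits_def)
  have "p \<in> O'" using orbit_refl[OF G] p by simp
  then have "\<not> (\<exists>\<tau>\<in>UHP. p = Fin \<tau>)" using assms(2) by blast
  then have "p = Infty \<or> (\<exists>q. p = Fin (of_real (of_rat q)))" using p by (auto simp: Hbar_def)
  then obtain \<gamma> where \<gamma>: "\<gamma> \<in> SL2Z" "mob_pt \<gamma> Infty = p"
  proof
    assume "p = Infty" then show thesis using that[of "mat 1"] by simp
  next
    assume "\<exists>q. p = Fin (of_real (of_rat q))"
    then obtain q where "p = Fin (of_real (of_rat q))" by blast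
    then show thesis using cusp_transitive[of q] that by metis
  qed
  define \<delta> where "\<delta> = right_rep (pm G) \<gamma>"
  have dI: "\<delta> \<in> I" using \<gamma> by (simp add: \<delta>_def Reps_def)
  obtain h where h: "h \<in> pm G" "\<delta> = h ** \<gamma>" using right_rep_in[OF subgroup_pm'[OF G]] unfolding \<delta>_def by metis
  have hS: "h \<in> SL2Z" using h subgroupD(5)[OF subgroup_pm'[OF G]] by blast
  have "mob_pt \<delta> Infty = mob_pt h p" using h hS \<gamma> by (simp add: mob_pt_mult)
  moreover have "mob_pt h p \<in> orbit G p" using h(1) by (auto simp: pm_def orbit_def)
  ultimately have "cusp_class \<delta> = O'" unfolding cusp_class_def p using orbit_eq[OF G] by metis
  then show ?thesis using dI by blast
qed

lemma cusp_class_orbits: "\<delta> \<in> I \<Longrightarrow> cusp_class \<delta> \<in> orbits G"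
proof -
  assume d: "\<delta> \<in> I"
  obtain a b' c e where m: "\<delta> = imat a b' c e" using SL2Z_E[OF I_SL2Z[OF d]] by metis
  have "mob_pt \<delta> Infty \<in> Hbar"
  proof (cases "c = 0")
    case False
    have "mob_pt \<delta> Infty = Fin (of_real (of_rat (of_int a / of_int c)))"
      using False by (simp add: m mob_pt_def of_rat_divide)
    then show ?thesis by (auto simp: Hbar_def)
  qed (simp add: m mob_pt_def Hbar_def)
  then show ?thesis by (auto simp: cusp_class_def orbits_def)
qed

text \<open>Both parts of \<open>degree_reps\<close> are regrouped by fibres: pairs over the
  interior orbits, representatives over the cusps.\<close>

lemma valence:
  "finite (div_support D k G f) \<and> div_degree D k G f = real (pindex SL2Z G) * k / 12"
proof -
  define SH where "SH = {X \<in> div_support D k G f. \<exists>\<tau>\<in>UHP. Fin \<tau> \<in> X}"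
  define SC where "SC = {X \<in> div_support D k G f. \<not> (\<exists>\<tau>\<in>UHP. Fin \<tau> \<in> X)}"
  have un: "div_support D k G f = SH \<union> SC" "SH \<inter> SC = {}" by (auto simp: SH_def SC_def)
  let ?w = "\<lambda>(z,\<delta>). real_of_int (zorder f (mob \<delta> z)) * orbit_weight z"
  have SH: "SH = pair_orbit ` zero_pairs"
  proof (intro equalityI subsetI)
    fix X assume "X \<in> SH"
    then have X: "X \<in> orbits G" "divisor D k G f X \<noteq> 0" and "\<exists>\<tau>\<in>UHP. Fin \<tau> \<in> X"
      by (auto simp: SH_def div_support_def)
    then obtain \<tau> where \<tau>: "\<tau> \<in> UHP" "X = orbit G (Fin \<tau>)"
      "divisor D k G f X = real_of_int (zorder f \<tau>) / real (card (proj ` stab G (Fin \<tau>)))"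
      using divisor_H by metis
    then have nz: "zorder f \<tau> \<noteq> 0" using X(2) by auto
    \<comment> \<open>The sum over the fibre is the value of the divisor; as it is nonzero, the
      fibre cannot be empty.\<close>
    have ne: "sum ?w {q\<in>zero_pairs. pair_orbit q = X} \<noteq> 0" using orbit_sum_H[OF \<tau>(1) nz] X(2) \<tau>(2,3) by simp
    show "X \<in> pair_orbit ` zero_pairs"
    proof (rule ccontr)
      assume "X \<notin> pair_orbit ` zero_pairs"
      then have "{q\<in>zero_pairs. pair_orbit q = X} = {}" by blast
      then show False using ne by (simp only: sum.empty)
    qed
  next
    fix X assume "X \<in> pair_orbit ` zero_pairs"
    then obtain z \<delta> where zd: "(z,\<delta>) \<in> zero_pairs" "X = orbit G (Fin (mob \<delta> z))" by (auto simp: pair_orbit_def)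
    have z: "z \<in> UHP" "\<delta> \<in> I" "zorder f (mob \<delta> z) \<noteq> 0" using zd strip_divisor_UHP by (auto simp: zero_pairs_def)
    have mz: "mob \<delta> z \<in> UHP" using z I_SL2Z by simp
    have memX: "Fin (mob \<delta> z) \<in> X" using zd orbit_refl[OF G] by simp
    have X: "X \<in> orbits G" using zd mz by (auto simp: orbits_def Hbar_def)
    obtain \<tau> where \<tau>: "\<tau> \<in> UHP" "X = orbit G (Fin \<tau>)"
      "divisor D k G f X = real_of_int (zorder f \<tau>) / real (card (proj ` stab G (Fin \<tau>)))"
      using divisor_H[OF X mz memX] by blast
    have "zorder f \<tau> \<noteq> 0" using zorder_f_orbit[OF \<tau>(1) mz] memX \<tau>(2) z(3) by simp
    then have "divisor D k G f X \<noteq> 0" using \<tau>(3) pindex_stab_Fin(2)[OF G \<tau>(1)] by simp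
    then show "X \<in> SH" using X memX mz by (auto simp: SH_def div_support_def)
  qed
  have "(\<Sum>X\<in>SH. divisor D k G f X) = (\<Sum>X\<in>pair_orbit ` zero_pairs. sum ?w {q\<in>zero_pairs. pair_orbit q = X})"
  proof (rule sum.cong[OF SH])
    fix X assume "X \<in> pair_orbit ` zero_pairs"
    then have "X \<in> SH" using SH by simp
    then have X: "X \<in> orbits G" "divisor D k G f X \<noteq> 0" and "\<exists>\<tau>\<in>UHP. Fin \<tau> \<in> X"
      by (auto simp: SH_def div_support_def)
    then obtain \<tau> where \<tau>: "\<tau> \<in> UHP" "X = orbit G (Fin \<tau>)"
      "divisor D k G f X = real_of_int (zorder f \<tau>) / real (card (proj ` stab G (Fin \<tau>)))"
      using divisor_H by metis
    then have nz: "zorder f \<tau> \<noteq> 0" using X(2) by auto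
    show "divisor D k G f X = sum ?w {q\<in>zero_pairs. pair_orbit q = X}" using orbit_sum_H[OF \<tau>(1) nz] \<tau>(2,3) by simp
  qed
  also have "\<dots> = sum ?w zero_pairs" by (rule sum.image_gen[OF finite_zero_pairs, symmetric])
  also have "\<dots> = sum ?w (strip_divisor \<times> I)"
    by (rule sum.mono_neutral_left) (auto simp: zero_pairs_def finite_strip_divisor finite_I)
  also have "\<dots> = (\<Sum>z\<in>strip_divisor. \<Sum>\<delta>\<in>I. real_of_int (zorder f (mob \<delta> z)) * orbit_weight z)"
    by (simp add: sum.cartesian_product)
  finally have sumH: "(\<Sum>X\<in>SH. divisor D k G f X) = (\<Sum>z\<in>strip_divisor. \<Sum>\<delta>\<in>I. real_of_int (zorder f (mob \<delta> z)) * orbit_weight z)" .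
  have SCsub: "SC \<subseteq> cusp_class ` I" using cusp_orbit by (auto simp: SC_def div_support_def)
  have "(\<Sum>X\<in>SC. divisor D k G f X) = (\<Sum>X\<in>cusp_class ` I. divisor D k G f X)"
  \<comment> \<open>Cusp classes missing from \<open>SC\<close> are those at which the divisor is
    0.\<close>
  proof (rule sum.mono_neutral_left[OF _ SCsub])
    show "\<forall>X\<in>cusp_class ` I - SC. divisor D k G f X = 0"
      using cusp_class_orbits cusp_not_UHP[OF I_SL2Z] by (auto simp: SC_def div_support_def)
  qed (simp add: finite_I)
  also have "\<dots> = (\<Sum>X\<in>cusp_class ` I. \<Sum>\<delta>\<in>{\<delta>\<in>I. cusp_class \<delta> = X}. cusp_order \<delta>)"
    by (rule sum.cong[OF refl]) (auto simp: divisor_cusp[OF I_SL2Z])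
  also have "\<dots> = (\<Sum>\<delta>\<in>I. cusp_order \<delta>)" by (rule sum.image_gen[OF finite_I, symmetric])
  finally have sumC: "(\<Sum>X\<in>SC. divisor D k G f X) = (\<Sum>\<delta>\<in>I. cusp_order \<delta>)" .
  have finH: "finite SH" unfolding SH using finite_zero_pairs by simp
  have finC: "finite SC" using SCsub finite_I finite_subset by blast
  have "div_degree D k G f = (\<Sum>X\<in>SH. divisor D k G f X) + (\<Sum>X\<in>SC. divisor D k G f X)"
    unfolding div_degree_def un(1) by (rule sum.union_disjoint[OF finH finC un(2)])
  also have "\<dots> = real (pindex SL2Z G) * k / 12"
    using degree_reps unfolding sumH sumC card_I by simp
  finally show ?thesis using un(1) finH finC by simp
qed

end

theorem theorem3p2:
  fixes G :: "mat2 set" and D :: nat and k :: real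
    and chi :: "mat2 \<times> complex \<Rightarrow> complex" and f :: "complex \<Rightarrow> complex"
  assumes "subgroup_SL2Z G"
    and "finite (lcosets SL2Z G)"
    and "D \<ge> 1"
    and "real D * k \<in> \<int>"
    and "multiplier_system D k G chi"
    and "mero_modular_form D k G chi f"
    and "nonzero_mero f"
  shows "finite (div_support D k G f) \<and>
         div_degree D k G f = real (pindex SL2Z G) * k / 12"
proof -
  obtain b where "real D * k = of_int b" using assms(4) by (elim Ints_cases)
  then interpret modform G D k chi f b using assms by unfold_locales
  show ?thesis by (rule valence)
qed

end
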